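(* Let $\Omega\subset\mathbb{R}^N$ be a bounded domain and $j\in\{1,\dots,N\}$; let $u_0\in C(\overline\Omega)$ with $u_0|_{\partial\Omega}=g$. Let $\Omega_R$ be a strictly convex bounded domain with $\overline{\Omega}\subset\Omega_R$, and let $\mu_R>0$ and $\psi_R\in C(\overline{\Omega_R})$ be such that $\psi_R>0$ in $\Omega_R$, $\psi_R=0$ on $\partial\Omega_R$ and $-\lambda_N(D^2\psi_R)=\mu_R\psi_R$ in $\Omega_R$ in the viscosity sense; set $\varphi_R=-\psi_R$ (so $\varphi_R<0$ in $\Omega_R$, $\varphi_R=0$ on $\partial\Omega_R$, $-\lambda_1(D^2\varphi_R)=\mu_R\varphi_R$). Let $u$ be the viscosity solution of $u_t-\lambda_j(D^2u)=0$ in $\Omega\times(0,\infty)$, $u=g$ on $\partial\Omega\times(0,\infty)$, $u(\cdot,0)=u_0$, and $z$ the viscosity solution of $\lambda_j(D^2z)=0$ in $\Omega$, $z=g$ on $\partial\Omega$. Then there exist constants $C_1,C_2>0$ depending on $u_0$ such that for all $x\in\Omega$, $t>0$, \[ z(x)+C_1e^{-\mu_R t}\varphi_R(x)\le u(x,t)\le z(x)+C_2e^{-\mu_R t}\psi_R(x). \]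
   Context: $\lambda_j(A)$ is the $j$-th smallest eigenvalue of a symmetric matrix $A$, $\lambda_j(A)=\inf_{\dim S=j}\sup_{v\in S,|v|=1}\langle Av,v\rangle$. Solutions are viscosity solutions continuous up to the boundary. (Such positive eigenpairs $(\mu_R,\psi_R)$ exist for strictly convex domains.) *)

theory Defs
  imports "HOL-Analysis.Analysis"
begin

text \<open>j-th smallest eigenvalue via the Courant--Fischer min-max formula.\<close>
definition eig :: "nat \<Rightarrow> real^'n^'n \<Rightarrow> real" where
  "eig j A = Inf ((\<lambda>S. Sup ((\<lambda>v. (A *v v) \<bullet> v) ` {v \<in> S. norm v = 1}))
                   ` {S. subspace S \<and> dim S = j})"

definition strictly_convex :: "(real^'n) set \<Rightarrow> bool" where
  "strictly_convex S \<longleftrightarrow> convex S \<and>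
     (\<forall>x\<in>closure S. \<forall>y\<in>closure S. x \<noteq> y \<longrightarrow> open_segment x y \<subseteq> interior S)"

definition domain :: "(real^'n) set \<Rightarrow> bool" where
  "domain S \<longleftrightarrow> open S \<and> connected S \<and> S \<noteq> {}"

definition C2_on :: "(real^'n) set \<Rightarrow> (real^'n \<Rightarrow> real) \<Rightarrow> (real^'n \<Rightarrow> real^'n)
                     \<Rightarrow> (real^'n \<Rightarrow> real^'n^'n) \<Rightarrow> bool" where
  "C2_on U phi Dphi D2phi \<longleftrightarrow>
     (\<forall>y\<in>U. (phi has_derivative (\<lambda>h. Dphi y \<bullet> h)) (at y)) \<and>
     (\<forall>y\<in>U. (Dphi has_derivative (\<lambda>h. D2phi y *v h)) (at y)) \<and>
     continuous_on U D2phi"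

text \<open>Continuous viscosity sub/supersolutions of F(x, u, Du, D^2u) = 0 in the open set W
  (F degenerate elliptic convention: subsolution tested from above with F <= 0).\<close>
definition visc_sub :: "(real^'n \<Rightarrow> real \<Rightarrow> real^'n \<Rightarrow> real^'n^'n \<Rightarrow> real)
                        \<Rightarrow> (real^'n) set \<Rightarrow> (real^'n \<Rightarrow> real) \<Rightarrow> bool" where
  "visc_sub F W u \<longleftrightarrow> continuous_on W u \<and>
     (\<forall>x0\<in>W. \<forall>U phi Dphi D2phi. open U \<and> x0 \<in> U \<and> U \<subseteq> W \<and> C2_on U phi Dphi D2phi \<and>
        (\<forall>y\<in>U. u y - phi y \<le> u x0 - phi x0)
        \<longrightarrow> F x0 (u x0) (Dphi x0) (D2phi x0) \<le> 0)"

definition visc_super :: "(real^'n \<Rightarrow> real \<Rightarrow> real^'n \<Rightarrow> real^'n^'n \<Rightarrow> real)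
                        \<Rightarrow> (real^'n) set \<Rightarrow> (real^'n \<Rightarrow> real) \<Rightarrow> bool" where
  "visc_super F W u \<longleftrightarrow> continuous_on W u \<and>
     (\<forall>x0\<in>W. \<forall>U phi Dphi D2phi. open U \<and> x0 \<in> U \<and> U \<subseteq> W \<and> C2_on U phi Dphi D2phi \<and>
        (\<forall>y\<in>U. u y - phi y \<ge> u x0 - phi x0)
        \<longrightarrow> F x0 (u x0) (Dphi x0) (D2phi x0) \<ge> 0)"

definition visc_sol where
  "visc_sol F W u \<longleftrightarrow> visc_sub F W u \<and> visc_super F W u"

definition C21_on :: "((real^'n) \<times> real) set \<Rightarrow> ((real^'n) \<times> real \<Rightarrow> real) \<Rightarrow> ((real^'n) \<times> real \<Rightarrow> real)
                     \<Rightarrow> ((real^'n) \<times> real \<Rightarrow> real^'n) \<Rightarrow> ((real^'n) \<times> real \<Rightarrow> real^'n^'n) \<Rightarrow> bool" where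
  "C21_on U phi Dt Dx Dxx \<longleftrightarrow>
     (\<forall>(y,s)\<in>U. ((\<lambda>x. phi (x, s)) has_derivative (\<lambda>h. Dx (y,s) \<bullet> h)) (at y)) \<and>
     (\<forall>(y,s)\<in>U. ((\<lambda>t. phi (y, t)) has_real_derivative Dt (y,s)) (at s)) \<and>
     (\<forall>(y,s)\<in>U. ((\<lambda>x. Dx (x, s)) has_derivative (\<lambda>h. Dxx (y,s) *v h)) (at y)) \<and>
     continuous_on U Dt \<and> continuous_on U Dx \<and> continuous_on U Dxx"

definition pvisc_sub :: "((real^'n) \<times> real \<Rightarrow> real \<Rightarrow> real^'n \<Rightarrow> real^'n^'n \<Rightarrow> real)
                        \<Rightarrow> ((real^'n) \<times> real) set \<Rightarrow> ((real^'n) \<times> real \<Rightarrow> real) \<Rightarrow> bool" where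
  "pvisc_sub F W u \<longleftrightarrow> continuous_on W u \<and>
     (\<forall>p0\<in>W. \<forall>U phi Dt Dx Dxx. open U \<and> p0 \<in> U \<and> U \<subseteq> W \<and> C21_on U phi Dt Dx Dxx \<and>
        (\<forall>q\<in>U. u q - phi q \<le> u p0 - phi p0)
        \<longrightarrow> Dt p0 + F p0 (u p0) (Dx p0) (Dxx p0) \<le> 0)"

definition pvisc_super :: "((real^'n) \<times> real \<Rightarrow> real \<Rightarrow> real^'n \<Rightarrow> real^'n^'n \<Rightarrow> real)
                        \<Rightarrow> ((real^'n) \<times> real) set \<Rightarrow> ((real^'n) \<times> real \<Rightarrow> real) \<Rightarrow> bool" where
  "pvisc_super F W u \<longleftrightarrow> continuous_on W u \<and>
     (\<forall>p0\<in>W. \<forall>U phi Dt Dx Dxx. open U \<and> p0 \<in> U \<and> U \<subseteq> W \<and> C21_on U phi Dt Dx Dxx \<and>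
        (\<forall>q\<in>U. u q - phi q \<ge> u p0 - phi p0)
        \<longrightarrow> Dt p0 + F p0 (u p0) (Dx p0) (Dxx p0) \<ge> 0)"

definition pvisc_sol where
  "pvisc_sol F W u \<longleftrightarrow> pvisc_sub F W u \<and> pvisc_super F W u"

end

theory Submission
  imports Defs
begin

text \<open>
  For symmetric matrices the inequality \<open>X \<le> Y + Z\<close> gives
  \<open>\<lambda>\<^sub>j X \<le> \<lambda>\<^sub>j Y + \<lambda>\<^sub>N Z\<close>. Hence \<open>z + C e\<^sup>-\<^sup>\<mu>\<^sup>t \<psi>\<close> is formally a supersolution of the evolution
  equation, and \<open>z - C e\<^sup>-\<^sup>\<mu>\<^sup>t \<psi>\<close> a subsolution. As \<open>\<psi>\<close> is bounded below on the closure of \<open>\<Omega>\<close>,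
  a large \<open>C\<close> gives the right order at time 0, and the claim is a comparison principle for the three
  functions \<open>u\<close>, \<open>z\<close> and \<open>C e\<^sup>-\<^sup>\<mu>\<^sup>t \<psi>\<close>.

  To make this rigorous, replace each of the three functions (with the appropriate sign) by its
  sup-convolution, which is semiconvex, and consider the set A of points at which the sum is
  touched from above by an affine function of small slope. On A each summand is squeezed between
  two paraboloids, so its gradient is Lipschitz on A; the sum of the gradients maps A onto a ball, so
  A is not negligible. By Rademacher's theorem, applied to extensions of the gradients, some
  density point of A carries second-order expansions of all three summands, and these are the jets
  needed in the viscosity inequalities. Neither Alexandrov's theorem nor Jensen's lemma is needed.
\<close>

text \<open>No variables are doubled: each function is regularized separately in space-time, and one
  contact point yields three jets at three possibly different maximizers nearby. This is harmless
  because the equations compared contain neither position nor gradient, nor the function value once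
  the factor \<open>exp (- \<mu> * t)\<close> has absorbed the zero-order term of the eigenvalue
  equation.

  The slope of the touching affine function is small but not zero, so the subsolution must be
  strict; an exponential in time is subtracted from it. The same exponential settles the final time,
  where compactness forces a lid without boundary data.

  At a contact point the affine function bounds the sum from above and semiconvexity bounds two
  summands from below, which bounds the third from above. Such two-sided control exists only around
  points of A. Hence the gradients are differentiated as extended Lipschitz maps, and it remains to
  show that the derivative of the extension really is a second-order term of the function; nearby
  points of A provide this. All measure theory is reduced to lines, where differentiation of
  integrals is enough.\<close>

section \<open>Differentiation of Lipschitz functions on the line\<close>

text \<open>Average the measure over translations along v and exchange the integrals.\<close>
lemma null_sets_of_null_lines:
  fixes v :: "'a::euclidean_space"
  assumes N: "N \<in> sets borel"
    and slice: "\<And>x. {s::real. x + s *\<^sub>R v \<in> N} \<in> null_sets lborel"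
  shows "N \<in> null_sets lborel"
proof -
  have [measurable]: "N \<in> sets borel" by fact
  have "(\<integral>\<^sup>+x. indicator N x \<partial>(lborel :: 'a measure)) =
      (\<integral>\<^sup>+s. (\<integral>\<^sup>+x. indicator N x \<partial>(lborel :: 'a measure)) \<partial>uniform_measure lborel {0..1::real})"
  proof -
    have "emeasure (uniform_measure lborel {0..1::real}) UNIV = 1"
      by (subst emeasure_uniform_measure) auto
    thus ?thesis by simp
  qed
  also have "\<dots> = (\<integral>\<^sup>+s. (\<integral>\<^sup>+x. indicator N (x + s *\<^sub>R v) \<partial>(lborel :: 'a measure)) \<partial>uniform_measure lborel {0..1::real})"
  proof (rule nn_integral_cong)
    fix s :: real
    have "(\<integral>\<^sup>+x. indicator N x \<partial>(lborel :: 'a measure)) = (\<integral>\<^sup>+x. indicator N x \<partial>distr lborel borel ((+) (s *\<^sub>R v)))"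
      by (simp add: lborel_distr_plus)
    also have "\<dots> = (\<integral>\<^sup>+x. indicator N (s *\<^sub>R v + x) \<partial>(lborel :: 'a measure))"
      by (subst nn_integral_distr) auto
    finally show "(\<integral>\<^sup>+x. indicator N x \<partial>(lborel :: 'a measure)) = (\<integral>\<^sup>+x. indicator N (x + s *\<^sub>R v) \<partial>lborel)"
      by (simp add: add.commute)
  qed
  also have "\<dots> = (\<integral>\<^sup>+s. (\<integral>\<^sup>+x. indicator N (x + s *\<^sub>R v) \<partial>(lborel :: 'a measure)) * indicator {0..1} s \<partial>(lborel :: real measure))"
    by (subst nn_integral_uniform_measure) (auto simp: divide_ennreal_def)
  also have "\<dots> \<le> (\<integral>\<^sup>+s. (\<integral>\<^sup>+x. indicator N (x + s *\<^sub>R v) \<partial>(lborel :: 'a measure)) \<partial>(lborel :: real measure))"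
    by (intro nn_integral_mono) (auto simp: indicator_def)
  also have "\<dots> = (\<integral>\<^sup>+x. (\<integral>\<^sup>+s. indicator N (x + s *\<^sub>R v) \<partial>(lborel :: real measure)) \<partial>(lborel :: 'a measure))"
    by (rule lborel_pair.Fubini') measurable
  also have "\<dots> = (\<integral>\<^sup>+x. 0 \<partial>(lborel :: 'a measure))"
  proof (rule nn_integral_cong)
    fix x :: 'a
    have "(\<integral>\<^sup>+s. indicator N (x + s *\<^sub>R v) \<partial>(lborel :: real measure))
        = (\<integral>\<^sup>+s. indicator {s. x + s *\<^sub>R v \<in> N} s \<partial>(lborel :: real measure))"
      by (simp add: indicator_def)
    also have "\<dots> = emeasure lborel {s. x + s *\<^sub>R v \<in> N}"
      using slice[of x] by (intro nn_integral_indicator) auto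
    also have "\<dots> = 0" using slice[of x] by auto
    finally show "(\<integral>\<^sup>+s. indicator N (x + s *\<^sub>R v) \<partial>(lborel :: real measure)) = 0" .
  qed
  finally show ?thesis by (simp add: null_sets_def)
qed

text \<open>An inequality between measures does not pass to complements, so it cannot be extended
  from intervals to Borel sets by Dynkin's argument. The complementary function \<open>H\<close>
  turns it into an identity, the two Stieltjes measures adding up to \<open>L\<close> times Lebesgue
  measure, and an identity does pass. Intersecting with a bounded interval keeps all terms finite,
  as the subtraction in the complement step requires.\<close>

lemma emeasure_interval_measure_le_lborel:
  fixes F H :: "real \<Rightarrow> real"
  assumes F: "mono F" "continuous_on UNIV F" and H: "mono H" "continuous_on UNIV H"
    and sum: "\<And>x. F x + H x = L * x" and A: "A \<in> sets borel"
  shows "emeasure (interval_measure F) A \<le> ennreal L * emeasure lborel A"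
proof -
  have L: "L \<ge> 0" using sum[of 0] sum[of 1] monoD[OF F(1), of 0 1] monoD[OF H(1), of 0 1] by simp
  let ?M = "interval_measure F" and ?N = "interval_measure H"
  have mF: "x \<le> y \<Longrightarrow> F x \<le> F y" for x y using F(1) by (auto dest: monoD)
  have mH: "x \<le> y \<Longrightarrow> H x \<le> H y" for x y using H(1) by (auto dest: monoD)
  have rF: "continuous (at_right a) F" for a
    using F(2) by (simp add: continuous_on_eq_continuous_at continuous_at_imp_continuous_within)
  have rH: "continuous (at_right a) H" for a
    using H(2) by (simp add: continuous_on_eq_continuous_at continuous_at_imp_continuous_within)
  have eF: "emeasure ?M {a<..b} = (if a \<le> b then F b - F a else 0)" for a b
    by (rule emeasure_interval_measure_Ioc_eq[OF mF rF])
  have eH: "emeasure ?N {a<..b} = (if a \<le> b then H b - H a else 0)" for a b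
    by (rule emeasure_interval_measure_Ioc_eq[OF mH rH])
  interpret SF: sigma_finite_measure ?M by (rule sigma_finite_interval_measure[OF mF rF])
  interpret SH: sigma_finite_measure ?N by (rule sigma_finite_interval_measure[OF mH rH])
  have bd: "emeasure ?M (A \<inter> {a<..b}) + emeasure ?N (A \<inter> {a<..b}) = ennreal L * emeasure lborel (A \<inter> {a<..b})"
    if ab: "a \<le> b" and "A \<in> sets borel" for a b A
  proof -
    let ?I = "{a<..b}"
    have finF: "emeasure ?M (A \<inter> ?I) < \<infinity>" for A
    proof -
      have "emeasure ?M (A \<inter> ?I) \<le> emeasure ?M ?I" by (rule emeasure_mono) auto
      also have "\<dots> < \<infinity>" unfolding eF by auto
      finally show ?thesis .
    qed
    have finH: "emeasure ?N (A \<inter> ?I) < \<infinity>" for A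
    proof -
      have "emeasure ?N (A \<inter> ?I) \<le> emeasure ?N ?I" by (rule emeasure_mono) auto
      also have "\<dots> < \<infinity>" unfolding eH by auto
      finally show ?thesis .
    qed
    have finL: "emeasure lborel (A \<inter> ?I) < \<infinity>" for A
    proof -
      have "emeasure lborel (A \<inter> ?I) \<le> emeasure lborel ?I" by (rule emeasure_mono) auto
      also have "\<dots> < \<infinity>" by (cases "a \<le> b") auto
      finally show ?thesis .
    qed
    have int: "emeasure ?M {c<..d} + emeasure ?N {c<..d} = ennreal L * emeasure lborel {c<..d}" for c d
    proof (cases "c \<le> d")
      case True
      have "emeasure ?M {c<..d} + emeasure ?N {c<..d} = ennreal ((F d - F c) + (H d - H c))"
        unfolding eF eH using True mF[OF True] mH[OF True] by simp
      also have "(F d - F c) + (H d - H c) = L * (d - c)" using sum[of d] sum[of c] by (simp add: algebra_simps)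
      finally show ?thesis using True L by (simp add: ennreal_mult)
    qed (auto simp: eF eH)
    let ?G = "range (\<lambda>(a::real, b). {a<..b})"
    have "Int_stable ?G"
    proof (rule Int_stableI)
      fix S T assume "S \<in> ?G" "T \<in> ?G"
      then obtain p q r s where "S = {p<..q}" "T = {r<..s}" by auto
      hence "S \<inter> T = (case (max p r, min q s) of (a, b) \<Rightarrow> {a<..b})" by auto
      thus "S \<inter> T \<in> ?G" by blast
    qed
    moreover have "?G \<subseteq> Pow UNIV" by auto
    moreover have "A \<in> sigma_sets UNIV ?G" using that(2) by (simp add: borel_sigma_sets_Ioc)
    ultimately show ?thesis
    proof (induction rule: sigma_sets_induct_disjoint)
      case (basic A)
      then obtain p q where "A = {p<..q}" by auto
      hence "A \<inter> {a<..b} = {max p a<..min q b}" by auto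
      thus ?case using int by simp
    next
      case empty show ?case by simp
    next
      case (compl A)
      have sA[measurable]: "A \<in> sets borel" using compl(1) by (simp add: borel_sigma_sets_Ioc)
      have eq: "(UNIV - A) \<inter> ?I = ?I - A \<inter> ?I" by auto
      have "emeasure ?M (?I - A \<inter> ?I) = emeasure ?M ?I - emeasure ?M (A \<inter> ?I)"
           "emeasure ?N (?I - A \<inter> ?I) = emeasure ?N ?I - emeasure ?N (A \<inter> ?I)"
           "emeasure lborel (?I - A \<inter> ?I) = emeasure lborel ?I - emeasure lborel (A \<inter> ?I)"
        using finF[of A] finH[of A] finL[of A] by (auto intro!: emeasure_Diff)
      moreover obtain m where m: "emeasure ?M (A \<inter> ?I) = ennreal m" "m \<ge> 0" using finF[of A] by (metis ennreal_cases infinity_ennreal_def less_irrefl)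
      moreover obtain n where n: "emeasure ?N (A \<inter> ?I) = ennreal n" "n \<ge> 0" using finH[of A] by (metis ennreal_cases infinity_ennreal_def less_irrefl)
      moreover obtain l where l: "emeasure lborel (A \<inter> ?I) = ennreal l" "l \<ge> 0" using finL[of A] by (metis ennreal_cases infinity_ennreal_def less_irrefl)
      moreover have "m \<le> F b - F a"
      proof -
        have "emeasure ?M (A \<inter> ?I) \<le> emeasure ?M ?I" by (rule emeasure_mono) auto
        thus ?thesis using m ab mF[OF ab] by (simp add: eF)
      qed
      moreover have "n \<le> H b - H a"
      proof -
        have "emeasure ?N (A \<inter> ?I) \<le> emeasure ?N ?I" by (rule emeasure_mono) auto
        thus ?thesis using n ab mH[OF ab] by (simp add: eH)
      qed
      moreover have "l \<le> b - a"
      proof -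
        have "emeasure lborel (A \<inter> ?I) \<le> emeasure lborel ?I" by (rule emeasure_mono) auto
        thus ?thesis using l ab by simp
      qed
      moreover have "m + n = L * l"
        using compl(2) m n l L by (simp add: ennreal_mult[symmetric] ennreal_plus[symmetric] del: ennreal_plus)
      moreover have "(F b - F a) + (H b - H a) = L * (b - a)" using sum[of b] sum[of a] by (simp add: algebra_simps)
      ultimately have num: "(F b - F a - m) + (H b - H a - n) = L * (b - a - l)"
        and ge: "F b - F a - m \<ge> 0" "H b - H a - n \<ge> 0" "b - a - l \<ge> 0"
        and vals: "emeasure ?M (?I - A \<inter> ?I) = ennreal (F b - F a - m)"
          "emeasure ?N (?I - A \<inter> ?I) = ennreal (H b - H a - n)"
          "emeasure lborel (?I - A \<inter> ?I) = ennreal (b - a - l)"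
        using ab by (simp_all add: eF eH ennreal_minus right_diff_distrib)
      have "emeasure ?M (?I - A \<inter> ?I) + emeasure ?N (?I - A \<inter> ?I) = ennreal ((F b - F a - m) + (H b - H a - n))"
        unfolding vals using ge by simp
      also have "\<dots> = ennreal L * emeasure lborel (?I - A \<inter> ?I)"
        unfolding num vals using ge L by (simp add: ennreal_mult)
      finally show ?case unfolding eq .
    next
      case (union B)
      have sB: "range B \<subseteq> sets borel" using union(2) by (auto simp: borel_sigma_sets_Ioc)
      have eq: "(\<Union>i. B i) \<inter> ?I = (\<Union>i. B i \<inter> ?I)" by auto
      have dj: "disjoint_family (\<lambda>i. B i \<inter> ?I)" using union(1) by (auto simp: disjoint_family_on_def)
      have un: "emeasure K (\<Union>i. B i \<inter> ?I) = (\<Sum>i. emeasure K (B i \<inter> ?I))" if "sets K = sets borel" for K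
      proof (rule suminf_emeasure[symmetric])
        show "range (\<lambda>i. B i \<inter> ?I) \<subseteq> sets K" using sB that by auto
      qed (rule dj)
      have "emeasure ?M (\<Union>i. B i \<inter> ?I) + emeasure ?N (\<Union>i. B i \<inter> ?I)
          = (\<Sum>i. emeasure ?M (B i \<inter> ?I) + emeasure ?N (B i \<inter> ?I))"
        by (subst un, simp, subst un, simp, rule suminf_add) auto
      also have "\<dots> = (\<Sum>i. ennreal L * emeasure lborel (B i \<inter> ?I))" using union(3) by simp
      also have "\<dots> = ennreal L * emeasure lborel (\<Union>i. B i \<inter> ?I)"
        by (subst un) auto
      finally show ?case unfolding eq .
    qed
  qed
  have bd': "emeasure ?M (A \<inter> {a<..b}) \<le> ennreal L * emeasure lborel A" if "a \<le> b" for a b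
  proof -
    have "emeasure ?M (A \<inter> {a<..b}) \<le> ennreal L * emeasure lborel (A \<inter> {a<..b})"
      by (subst bd[symmetric, OF that A]) simp
    also have "\<dots> \<le> ennreal L * emeasure lborel A"
      using A by (intro mult_left_mono emeasure_mono) auto
    finally show ?thesis .
  qed
  have "emeasure ?M A = emeasure ?M (\<Union>n::nat. A \<inter> {-real n<..real n})"
  proof (rule arg_cong[of _ _ "emeasure ?M"], safe)
    fix x assume "x \<in> A"
    obtain n :: nat where "real n > \<bar>x\<bar>" using reals_Archimedean2 by blast
    thus "x \<in> (\<Union>n::nat. A \<inter> {-real n<..real n})" using \<open>x \<in> A\<close> by (intro UN_I[of n]) auto
  qed
  also have "\<dots> = (SUP n. emeasure ?M (A \<inter> {-real n<..real n}))"
    using A by (intro SUP_emeasure_incseq[symmetric]) (auto simp: incseq_def)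
  also have "\<dots> \<le> ennreal L * emeasure lborel A"
    by (intro SUP_least bd') auto
  finally show ?thesis .
qed

text \<open>Radon--Nikodym for the Stieltjes measure of a Lipschitz function, followed by Lebesgue
  differentiation of the resulting density.\<close>
lemma mono_lipschitz_right_derivative:
  fixes F :: "real \<Rightarrow> real"
  assumes F: "mono F" and lip: "L-lipschitz_on UNIV F"
  shows "AE x in lebesgue. \<exists>l. ((\<lambda>t. (F (x + t) - F x) / t) \<longlongrightarrow> l) (at_right 0)"
proof -
  define H where "H = (\<lambda>x. L * x - F x)"
  have cF: "continuous_on UNIV F" using lip by (rule lipschitz_on_continuous_on)
  have cH: "continuous_on UNIV H" unfolding H_def by (intro continuous_intros cF)
  have H: "mono H"
  proof (rule monoI)
    fix x y :: real assume "x \<le> y"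
    have "F y - F x \<le> L * (y - x)" using lipschitz_onD[OF lip, of y x] \<open>x \<le> y\<close> by (auto simp: dist_real_def)
    thus "H x \<le> H y" by (simp add: H_def algebra_simps)
  qed
  let ?M = "interval_measure F"
  have le: "emeasure ?M A \<le> ennreal L * emeasure lborel A" if "A \<in> sets borel" for A
    by (rule emeasure_interval_measure_le_lborel[OF F cF H cH _ that]) (simp add: H_def)
  have ac: "absolutely_continuous lborel ?M"
    unfolding absolutely_continuous_def
  proof
    fix A :: "real set" assume A: "A \<in> null_sets lborel"
    hence "A \<in> sets borel" "emeasure lborel A = 0" by auto
    with le[of A] show "A \<in> null_sets ?M" by (simp add: null_sets_def)
  qed
  obtain g where g[measurable]: "g \<in> borel_measurable borel" and gM: "density lborel g = ?M"
    using sigma_finite_measure.Radon_Nikodym[OF sigma_finite_lborel ac] by auto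
  have rF: "continuous (at_right a) F" for a
    using cF by (simp add: continuous_on_eq_continuous_at continuous_at_imp_continuous_within)
  have mF: "x \<le> y \<Longrightarrow> F x \<le> F y" for x y using F by (auto dest: monoD)
  have gi: "(\<integral>\<^sup>+x. g x * indicator {a..b} x \<partial>lborel) = ennreal (F b - F a)" if "a \<le> b" for a b
  proof -
    have "(\<integral>\<^sup>+x. g x * indicator {a..b} x \<partial>lborel) = emeasure ?M {a..b}"
      by (subst gM[symmetric], subst emeasure_density) auto
    also have "\<dots> = ennreal (F b - F a)"
      using that mF cF by (intro emeasure_interval_measure_Icc) (auto intro: monoD)
    finally show ?thesis .
  qed
  have finAE: "AE x in lborel. g x \<noteq> \<infinity>"
  proof -
    have "AE x in lborel. \<forall>n::nat. g x * indicator {-real n..real n} x \<noteq> \<infinity>"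
      unfolding AE_all_countable
    proof
      fix n :: nat
      show "AE x in lborel. g x * indicator {-real n..real n} x \<noteq> \<infinity>"
        by (rule nn_integral_PInf_AE) (auto simp: gi)
    qed
    thus ?thesis
    proof eventually_elim
      case (elim x)
      obtain n :: nat where "real n > \<bar>x\<bar>" using reals_Archimedean2 by blast
      thus ?case using elim[rule_format, of n] by (auto simp: indicator_def abs_less_iff split: if_splits)
    qed
  qed
  define G where "G = (\<lambda>x. enn2real (g x))"
  have Gm[measurable]: "G \<in> borel_measurable borel" unfolding G_def by measurable
  have hi: "(G has_integral (F b - F a)) {a..b}" if "a \<le> b" for a b
  proof -
    have e: "(\<integral>\<^sup>+x. ennreal (indicator {a..b} x * G x) \<partial>lborel) = ennreal (F b - F a)"
    proof -
      have "(\<integral>\<^sup>+x. ennreal (indicator {a..b} x * G x) \<partial>lborel) = (\<integral>\<^sup>+x. g x * indicator {a..b} x \<partial>lborel)"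
      proof (rule nn_integral_cong_AE)
        show "AE x in lborel. ennreal (indicator {a..b} x * G x) = g x * indicator {a..b} x"
          using finAE by eventually_elim (auto simp: G_def indicator_def less_top)
      qed
      thus ?thesis using gi[OF that] by simp
    qed
    have "((\<lambda>x. indicator {a..b} x * G x) has_integral (F b - F a)) UNIV"
      by (rule nn_integral_has_integral[OF _ _ e]) (use mF[OF that] in \<open>auto simp: G_def\<close>)
    moreover have "(\<lambda>x. indicator {a..b} x * G x) = (\<lambda>x. if x \<in> {a..b} then G x else 0)"
      by (auto simp: indicator_def)
    ultimately show ?thesis using has_integral_restrict_UNIV[of "{a..b}" G] by simp
  qed
  have "G integrable_on cbox a b" for a b :: real
    using hi[of a b] by (cases "a \<le> b") (auto simp: integrable_on_def)
  \<comment> \<open>Averages over the forward intervals from \<open>x\<close> to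
    \<open>x + h\<close> converge off a null set. Being one-sided they give right derivatives, which
    is why limits along \<open>at_right 0\<close> are used from here on.\<close>
  then obtain N where N: "negligible N" "\<And>x e. \<lbrakk>x \<notin> N; 0 < e\<rbrakk> \<Longrightarrow>
               \<exists>d>0. \<forall>h. 0 < h \<and> h < d \<longrightarrow>
                         norm(integral (cbox x (x + h *\<^sub>R One)) G /\<^sub>R h ^ DIM(real) - G x) < e"
    using integrable_ccontinuous_explicit[of G] by metis
  show ?thesis
  proof (rule AE_I'[of N], use N(1) in \<open>simp add: negligible_iff_null_sets\<close>, clarify, rule ccontr)
    fix x assume "x \<notin> N" and no: "\<nexists>l. ((\<lambda>t. (F (x + t) - F x) / t) \<longlongrightarrow> l) (at_right 0)"
    have "((\<lambda>t. (F (x + t) - F x) / t) \<longlongrightarrow> G x) (at_right 0)"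
    proof (rule tendstoI)
      fix e :: real assume "e > 0"
      then obtain d where d: "d > 0" "\<And>h. 0 < h \<Longrightarrow> h < d \<Longrightarrow> norm(integral (cbox x (x + h *\<^sub>R One)) G /\<^sub>R h ^ DIM(real) - G x) < e"
        using N(2)[OF \<open>x \<notin> N\<close>] by metis
      have "dist ((F (x + t) - F x) / t) (G x) < e" if "0 < t" "t < d" for t
      proof -
        have "integral (cbox x (x + t *\<^sub>R One)) G = F (x + t) - F x"
          using hi[of x "x+t"] that by (simp add: integral_unique)
        thus ?thesis using d(2)[OF that] by (simp add: dist_real_def divide_inverse mult.commute)
      qed
      thus "\<forall>\<^sub>F t in at_right 0. dist ((F (x + t) - F x) / t) (G x) < e"
        unfolding eventually_at_right_field using d(1) by blast
    qed
    thus False using no by blast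
  qed
qed

text \<open>Adding \<open>L * x\<close> makes the function monotone, with Lipschitz constant
  \<open>2 * L\<close>, and only shifts the limit by \<open>L\<close>.\<close>

lemma lipschitz_right_derivative:
  fixes f :: "real \<Rightarrow> real"
  assumes lip: "L-lipschitz_on UNIV f"
  shows "AE x in lebesgue. \<exists>l. ((\<lambda>t. (f (x + t) - f x) / t) \<longlongrightarrow> l) (at_right 0)"
proof -
  have L: "L \<ge> 0" using lip by (rule lipschitz_on_nonneg)
  let ?F = "\<lambda>x. f x + L * x"
  have d: "\<bar>f x - f y\<bar> \<le> L * \<bar>x - y\<bar>" for x y using lipschitz_onD[OF lip, of x y] by (simp add: dist_real_def)
  have 1: "mono ?F"
  proof (rule monoI)
    fix x y :: real assume "x \<le> y" thus "?F x \<le> ?F y" using d[of x y] by (auto simp: algebra_simps)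
  qed
  have 2: "(2*L)-lipschitz_on UNIV ?F"
  proof (rule lipschitz_onI)
    fix x y :: real
    have "\<bar>?F x - ?F y\<bar> = \<bar>(f x - f y) + L * (x - y)\<bar>" by (simp add: algebra_simps)
    also have "\<dots> \<le> \<bar>f x - f y\<bar> + \<bar>L * (x - y)\<bar>" by linarith
    also have "\<dots> \<le> 2 * L * \<bar>x - y\<bar>" using d[of x y] L by (simp add: abs_mult)
    finally show "dist (?F x) (?F y) \<le> 2 * L * dist x y" by (simp add: dist_real_def)
  qed (use L in auto)
  from mono_lipschitz_right_derivative[OF 1 2] show ?thesis
  proof eventually_elim
    case (elim x)
    then obtain l where l: "((\<lambda>t. (?F (x + t) - ?F x) / t) \<longlongrightarrow> l) (at_right 0)" by blast
    have "((\<lambda>t. (?F (x + t) - ?F x) / t - L) \<longlongrightarrow> l - L) (at_right 0)" by (intro tendsto_intros l)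
    moreover have "(?F (x + t) - ?F x) / t - L = (f (x + t) - f x) / t" if "t > 0" for t
      using that by (simp add: field_simps)
    hence "\<forall>\<^sub>F t in at_right 0. (?F (x + t) - ?F x) / t - L = (f (x + t) - f x) / t"
      unfolding eventually_at_right_field by (intro exI[of _ 1]) auto
    ultimately have "((\<lambda>t. (f (x + t) - f x) / t) \<longlongrightarrow> l - L) (at_right 0)"
      by (rule Lim_transform_eventually)
    thus ?case by blast
  qed
qed

section \<open>Directional density and directional derivatives\<close>

lemma AE_lborel_slices:
  fixes v :: "'a::euclidean_space"
  assumes N: "N \<in> sets borel" and slice: "\<And>x. AE s in lborel. x + s *\<^sub>R v \<notin> N"
  shows "AE x in lborel. x \<notin> N"
proof (rule AE_not_in, rule null_sets_of_null_lines[OF N, of v])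
  fix x
  have "(\<lambda>s. x + s *\<^sub>R v) -` N \<inter> space borel \<in> sets (borel :: real measure)"
    by (rule measurable_sets[OF _ N]) (intro borel_measurable_continuous_onI continuous_intros)
  hence "{s. x + s *\<^sub>R v \<in> N} \<in> sets lborel" by (simp add: vimage_def)
  thus "{s. x + s *\<^sub>R v \<in> N} \<in> null_sets lborel"
    using slice[of x] AE_iff_null[of lborel "\<lambda>s. x + s *\<^sub>R v \<notin> N"] by simp
qed

text \<open>A weak, one-sided density along a ray: the gap between t and the nearest smaller
  parameter that lands in \<open>A\<close> is o(t). One point per scale is all that a Lipschitz
  estimate needs.\<close>

definition dir_dense :: "'a::euclidean_space set \<Rightarrow> 'a \<Rightarrow> 'a \<Rightarrow> bool" where
  "dir_dense A v x \<longleftrightarrow> (\<forall>\<eta>>0. \<forall>\<^sub>F t in at_right 0. \<exists>s\<in>{(1-\<eta>)*t..t}. x + s *\<^sub>R v \<in> A)"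

text \<open>If \<open>S\<close> missed the points \<open>x + s\<close> with \<open>s\<close> in
  \<open>{(1-\<eta>)*t..t}\<close>, the average of its indicator over the forward interval of length
  t would be at most \<open>1 - \<eta>\<close>; at almost every point of \<open>S\<close> these
  averages tend to 1.\<close>

lemma AE_density_real:
  fixes S :: "real set"
  assumes S: "closed S" and \<eta>: "0 < \<eta>"
  shows "AE x in lborel. x \<in> S \<longrightarrow> (\<forall>\<^sub>F t in at_right 0. \<exists>s\<in>{(1-\<eta>)*t..t}. x + s \<in> S)"
proof -
  have int: "(indicat_real S) integrable_on cbox a b" for a b :: real
  proof -
    have "S \<inter> cbox a b \<in> lmeasurable" using S by (intro lmeasurable_compact closed_Int_compact) auto
    hence "(\<lambda>x. 1::real) integrable_on (S \<inter> cbox a b)" by (simp add: lmeasurable_iff_integrable_on)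
    hence "(\<lambda>x. if x \<in> S then 1::real else 0) integrable_on cbox a b"
      by (subst integrable_restrict_Int)
    moreover have "(\<lambda>x. if x \<in> S then 1::real else 0) = indicat_real S" by (auto simp: indicator_def)
    ultimately show ?thesis by simp
  qed
  then obtain N where N: "negligible N" "\<And>x e. \<lbrakk>x \<notin> N; 0 < e\<rbrakk> \<Longrightarrow>
               \<exists>d>0. \<forall>h. 0 < h \<and> h < d \<longrightarrow>
                   norm (integral (cbox x (x + h *\<^sub>R One)) (indicat_real S) /\<^sub>R h ^ DIM(real) - indicat_real S x) < e"
    using integrable_ccontinuous_explicit[of "indicat_real S"] by metis
  have "AE x in lebesgue. x \<in> S \<longrightarrow> (\<forall>\<^sub>F t in at_right 0. \<exists>s\<in>{(1-\<eta>)*t..t}. x + s \<in> S)"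
  proof (rule AE_I'[of N], use N(1) in \<open>simp add: negligible_iff_null_sets\<close>, clarify, rule ccontr)
    fix x assume xN: "x \<notin> N" and x: "x \<in> S" and no: "\<not> (\<forall>\<^sub>F t in at_right 0. \<exists>s\<in>{(1-\<eta>)*t..t}. x + s \<in> S)"
    \<comment> \<open>Capping at 1 keeps the comparison interval of length \<open>(1-e)*t\<close>
      meaningful when \<open>\<eta>\<close> exceeds 1.\<close>
    define e where "e = min \<eta> 1"
    have e: "0 < e" "e \<le> 1" "e \<le> \<eta>" using \<eta> by (auto simp: e_def)
    obtain d where d: "d > 0" "\<And>h. 0 < h \<Longrightarrow> h < d \<Longrightarrow>
        norm (integral (cbox x (x + h *\<^sub>R One)) (indicat_real S) /\<^sub>R h ^ DIM(real) - indicat_real S x) < e"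
      using N(2)[OF xN e(1)] by metis
    obtain t where t: "0 < t" "t < d" "\<not> (\<exists>s\<in>{(1-\<eta>)*t..t}. x + s \<in> S)"
      using no d(1) unfolding eventually_at_right_field by blast
    have "integral (cbox x (x + t)) (indicat_real S) \<le> integral (cbox x (x+t)) (indicat_real {x..x + (1-e)*t})"
    proof (rule integral_le[OF int])
      show "indicat_real {x..x + (1-e)*t} integrable_on cbox x (x+t)"
        using has_integral_restrict_UNIV integrable_on_indicator by auto
      fix y assume y: "y \<in> cbox x (x+t)"
      show "indicat_real S y \<le> indicat_real {x..x + (1-e)*t} y"
      proof (cases "y \<in> S")
        case True
        have "\<not> (y - x \<in> {(1-\<eta>)*t..t})" using t(3) True by force
        hence "y - x < (1-\<eta>)*t" using y by auto
        also have "\<dots> \<le> (1-e)*t" using e t by simp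
        finally show ?thesis using y by (auto simp: indicator_def)
      qed (auto simp: indicator_def)
    qed
    also have "\<dots> = (1-e)*t"
    proof -
      have "((\<lambda>_. 1::real) has_integral (1-e)*t) {x..x + (1-e)*t}"
        using has_integral_const_real[of "1::real" x "x + (1-e)*t"] e t by simp
      moreover have "{x..x + (1-e)*t} \<subseteq> cbox x (x+t)" using e t by (auto simp: algebra_simps mult_le_cancel_right1 intro: order_trans)
      ultimately have "((\<lambda>y. if y \<in> {x..x + (1-e)*t} then 1::real else 0) has_integral (1-e)*t) (cbox x (x+t))"
        by (subst has_integral_restrict)
      moreover have "(\<lambda>y. if y \<in> {x..x + (1-e)*t} then 1::real else 0) = indicat_real {x..x + (1-e)*t}" by (auto simp: indicator_def)
      ultimately show ?thesis by (simp add: integral_unique)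
    qed
    finally have "integral (cbox x (x + t)) (indicat_real S) / t \<le> 1 - e" using t by (simp add: field_simps)
    moreover have "\<bar>integral (cbox x (x + t)) (indicat_real S) / t - 1\<bar> < e"
      using d(2)[OF t(1,2)] x by (simp add: divide_inverse mult.commute)
    ultimately show False by linarith
  qed
  thus ?thesis by (simp add: AE_completion_iff)
qed

lemma AE_dir_dense:
  fixes v :: "'a::euclidean_space"
  assumes A: "closed A"
  shows "AE x in lborel. x \<in> A \<longrightarrow> dir_dense A v x"
proof -
  define P where "P \<eta> x \<longleftrightarrow> (\<forall>\<^sub>F t in at_right 0. \<exists>s\<in>{(1-\<eta>)*t..t}. x + s *\<^sub>R v \<in> A)" for \<eta> :: real and x
  have 1: "AE x in lborel. x \<notin> {x\<in>A. \<not> P \<eta> x}" if \<eta>: "\<eta> > 0" for \<eta>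
  proof (rule AE_lborel_slices[of _ v])
    define U where "U t = {x. \<forall>s\<in>{(1-\<eta>)*t..t}. x + s *\<^sub>R v \<notin> A}" for t :: real
    have opU: "open (U t)" for t
    proof -
      have "closed (\<Union>s\<in>{(1-\<eta>)*t..t}. (\<lambda>y. y - s *\<^sub>R v) ` A)"
      proof -
        have "(\<Union>s\<in>{(1-\<eta>)*t..t}. (\<lambda>y. y - s *\<^sub>R v) ` A) = (\<Union>y\<in>A. \<Union>z \<in> (\<lambda>s. - (s *\<^sub>R v)) ` {(1-\<eta>)*t..t}. {y + z})"
          by auto
        moreover have "closed \<dots>"
          by (intro closed_compact_sums A compact_continuous_image continuous_intros) auto
        ultimately show ?thesis by simp
      qed
      moreover have "U t = - (\<Union>s\<in>{(1-\<eta>)*t..t}. (\<lambda>y. y - s *\<^sub>R v) ` A)"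
      proof (intro set_eqI)
        fix x
        have "x \<in> (\<lambda>y. y - s *\<^sub>R v) ` A \<longleftrightarrow> x + s *\<^sub>R v \<in> A" for s
          by (auto simp: algebra_simps intro!: image_eqI[of _ _ "x + s *\<^sub>R v"])
        thus "x \<in> U t \<longleftrightarrow> x \<in> - (\<Union>s\<in>{(1-\<eta>)*t..t}. (\<lambda>y. y - s *\<^sub>R v) ` A)" by (simp add: U_def)
      qed
      ultimately show ?thesis by (simp only: open_Compl)
    qed
    \<comment> \<open>The slicing lemma needs a Borel set. The union over uncountably many
      \<open>t\<close> is harmless since each \<open>U t\<close> is open: the bad set is a closed
      set intersected with a G_delta set.\<close>
    have "{x\<in>A. \<not> P \<eta> x} = A \<inter> (\<Inter>n::nat. \<Union>t\<in>{0<..<1/(real n+1)}. U t)"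
    proof (intro set_eqI iffI)
      fix x assume x: "x \<in> {x\<in>A. \<not> P \<eta> x}"
      have "\<exists>t\<in>{0<..<1/(real n+1)}. x \<in> U t" for n :: nat
      proof (rule ccontr)
        assume "\<not> ?thesis"
        hence "P \<eta> x" unfolding P_def eventually_at_right_field U_def
          by (intro exI[of _ "1/(real n+1)"]) auto
        thus False using x by simp
      qed
      thus "x \<in> A \<inter> (\<Inter>n::nat. \<Union>t\<in>{0<..<1/(real n+1)}. U t)" using x by auto
    next
      fix x assume x: "x \<in> A \<inter> (\<Inter>n::nat. \<Union>t\<in>{0<..<1/(real n+1)}. U t)"
      have "\<not> P \<eta> x"
      proof
        assume "P \<eta> x"
        then obtain b where b: "b > 0" "\<And>t. 0 < t \<Longrightarrow> t < b \<Longrightarrow> \<exists>s\<in>{(1-\<eta>)*t..t}. x + s *\<^sub>R v \<in> A"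
          unfolding P_def eventually_at_right_field by auto
        obtain n :: nat where n: "1 / (real n + 1) < b"
          using reals_Archimedean[OF b(1)] by (auto simp: inverse_eq_divide add.commute)
        obtain t where "t\<in>{0<..<1/(real n+1)}" "x \<in> U t" using x by blast
        thus False using b(2)[of t] n by (auto simp: U_def)
      qed
      thus "x \<in> {x\<in>A. \<not> P \<eta> x}" using x by auto
    qed
    also have "\<dots> \<in> sets borel"
    proof -
      have "(\<Union>t\<in>{0<..<1/(real n+1)}. U t) \<in> sets borel" for n :: nat
        using opU by (intro borel_open open_UN) auto
      hence "(\<Inter>n::nat. \<Union>t\<in>{0<..<1/(real n+1)}. U t) \<in> sets borel"
        by (intro sets.countable_INT image_subsetI) auto
      thus ?thesis using borel_closed[OF A] by (rule sets.Int[rotated])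
    qed
    finally show "{x\<in>A. \<not> P \<eta> x} \<in> sets borel" .
    fix x
    have "closed {s. x + s *\<^sub>R v \<in> A}"
      using continuous_closed_vimage[OF A, of "\<lambda>s. x + s *\<^sub>R v"] by (simp add: vimage_def)
    from AE_density_real[OF this \<eta>]
    show "AE s in lborel. x + s *\<^sub>R v \<notin> {x\<in>A. \<not> P \<eta> x}"
      by eventually_elim (simp add: P_def scaleR_add_left add.assoc)
  qed
  have "AE x in lborel. \<forall>n::nat. x \<notin> {x\<in>A. \<not> P (1/(real n+1)) x}"
    unfolding AE_all_countable by (intro allI 1) auto
  thus ?thesis
  proof eventually_elim
    case (elim x)
    show ?case unfolding dir_dense_def
    proof (intro impI allI)
      fix \<eta> :: real assume x: "x \<in> A" and "\<eta> > 0"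
      then obtain n :: nat where n: "1 / (real n + 1) < \<eta>"
        using reals_Archimedean[OF \<open>\<eta> > 0\<close>] by (auto simp: inverse_eq_divide add.commute)
      have "\<forall>\<^sub>F t in at_right 0. \<exists>s\<in>{(1-1/(real n+1))*t..t}. x + s *\<^sub>R v \<in> A"
        using elim[rule_format, of n] x by (simp add: P_def)
      moreover have "\<forall>\<^sub>F t in at_right (0::real). t > 0" by (rule eventually_at_right_less)
      ultimately show "\<forall>\<^sub>F t in at_right 0. \<exists>s\<in>{(1-\<eta>)*t..t}. x + s *\<^sub>R v \<in> A"
      proof eventually_elim
        case (elim t)
        have "(1-\<eta>)*t \<le> (1-1/(real n+1))*t" using n elim(2) by (intro mult_right_mono) auto
        thus ?case using elim(1) by (meson atLeastAtMost_iff order_trans)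
      qed
    qed
  qed
qed

text \<open>Only the right limit is required, since this is what differentiation on the line
  supplies; \<open>-v\<close> counts as a direction of its own.\<close>

definition has_dir_deriv :: "('a::euclidean_space \<Rightarrow> real) \<Rightarrow> 'a \<Rightarrow> 'a \<Rightarrow> real \<Rightarrow> bool" where
  "has_dir_deriv f x v l \<longleftrightarrow> ((\<lambda>t. (f (x + t *\<^sub>R v) - f x) / t) \<longlongrightarrow> l) (at_right 0)"

lemma has_dir_deriv_unique: "has_dir_deriv f x v l \<Longrightarrow> has_dir_deriv f x v m \<Longrightarrow> l = m"
  unfolding has_dir_deriv_def by (rule tendsto_unique) auto

lemma has_dir_derivD:
  assumes "has_dir_deriv f x v l" "e > 0"
  shows "\<forall>\<^sub>F t in at_right 0. \<bar>f (x + t *\<^sub>R v) - f x - t * l\<bar> \<le> e * t"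
proof -
  have "\<forall>\<^sub>F t in at_right (0::real). t > 0" by (rule eventually_at_right_less)
  with tendstoD[OF assms[unfolded has_dir_deriv_def]] show ?thesis
  proof eventually_elim
    case (elim t)
    have "\<bar>f (x + t *\<^sub>R v) - f x - t * l\<bar> = \<bar>(f (x + t *\<^sub>R v) - f x) / t - l\<bar> * t"
      using elim(2) by (simp add: abs_if field_simps)
    also have "\<dots> \<le> e * t" using elim by (intro mult_right_mono) (auto simp: dist_real_def)
    finally show ?case .
  qed
qed

lemma has_dir_derivI:
  assumes "\<And>e. e > 0 \<Longrightarrow> \<forall>\<^sub>F t in at_right 0. \<bar>f (x + t *\<^sub>R v) - f x - t * l\<bar> \<le> e * t"
  shows "has_dir_deriv f x v l"
  unfolding has_dir_deriv_def
proof (rule tendstoI)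
  fix e :: real assume "e > 0"
  hence "\<forall>\<^sub>F t in at_right 0. \<bar>f (x + t *\<^sub>R v) - f x - t * l\<bar> \<le> e/2 * t" by (intro assms) auto
  moreover have "\<forall>\<^sub>F t in at_right (0::real). t > 0" by (rule eventually_at_right_less)
  ultimately show "\<forall>\<^sub>F t in at_right 0. dist ((f (x + t *\<^sub>R v) - f x) / t) l < e"
  proof eventually_elim
    case (elim t)
    have "\<bar>(f (x + t *\<^sub>R v) - f x) / t - l\<bar> * t = \<bar>f (x + t *\<^sub>R v) - f x - t * l\<bar>"
      using elim(2) by (simp add: abs_if field_simps)
    also have "\<dots> \<le> e/2 * t" by (rule elim)
    finally have "\<bar>(f (x + t *\<^sub>R v) - f x) / t - l\<bar> \<le> e/2" using elim(2) by simp
    thus ?case using \<open>e > 0\<close> by (simp add: dist_real_def)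
  qed
qed

lemma has_dir_deriv_scale:
  assumes "has_dir_deriv f x v l" "c \<ge> 0"
  shows "has_dir_deriv f x (c *\<^sub>R v) (c * l)"
proof (cases "c = 0")
  case True thus ?thesis by (simp add: has_dir_deriv_def)
next
  case False
  hence c: "c > 0" using assms by simp
  show ?thesis
  proof (rule has_dir_derivI)
    fix e :: real assume "e > 0"
    hence "\<forall>\<^sub>F t in at_right 0. \<bar>f (x + t *\<^sub>R v) - f x - t * l\<bar> \<le> e/c * t"
      using c by (intro has_dir_derivD[OF assms(1)]) auto
    then obtain b where b: "b > 0" "\<And>t. 0 < t \<Longrightarrow> t < b \<Longrightarrow> \<bar>f (x + t *\<^sub>R v) - f x - t * l\<bar> \<le> e/c * t"
      unfolding eventually_at_right_field by blast
    show "\<forall>\<^sub>F t in at_right 0. \<bar>f (x + t *\<^sub>R c *\<^sub>R v) - f x - t * (c * l)\<bar> \<le> e * t"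
      unfolding eventually_at_right_field
    proof (intro exI[of _ "b/c"] conjI allI impI)
      fix t assume "0 < t" "t < b/c"
      hence "0 < t * c" "t * c < b" using c by (auto simp: field_simps)
      from b(2)[OF this] show "\<bar>f (x + t *\<^sub>R c *\<^sub>R v) - f x - t * (c * l)\<bar> \<le> e * t"
        using c by (simp add: field_simps)
    qed (use b c in auto)
  qed
qed

text \<open>The Cauchy criterion with countable outer quantifiers. In this form the points without a
  directional derivative form a Borel set, because the quantifiers over \<open>s\<close> and
  \<open>t\<close> become unions of open sets.\<close>

lemma convergent_at_right_iff:
  fixes Q :: "real \<Rightarrow> real"
  shows "(\<exists>l. (Q \<longlongrightarrow> l) (at_right 0)) \<longleftrightarrow>
    (\<forall>k::nat. \<exists>n::nat. \<forall>s\<in>{0<..<1/(real n+1)}. \<forall>t\<in>{0<..<1/(real n+1)}. \<bar>Q s - Q t\<bar> \<le> 1/(real k+1))"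
  (is "?L \<longleftrightarrow> ?R")
proof
  assume ?L
  then obtain l where l: "(Q \<longlongrightarrow> l) (at_right 0)" by blast
  show ?R
  proof
    fix k :: nat
    have "1/(real k+1)/2 > 0" by simp
    from tendstoD[OF l this] obtain b where b: "b > 0" "\<And>t. 0 < t \<Longrightarrow> t < b \<Longrightarrow> \<bar>Q t - l\<bar> < 1/(real k+1)/2"
      unfolding eventually_at_right_field dist_real_def by blast
    obtain n :: nat where n: "1 / (real n + 1) < b"
      using reals_Archimedean[OF b(1)] by (auto simp: inverse_eq_divide add.commute)
    show "\<exists>n::nat. \<forall>s\<in>{0<..<1/(real n+1)}. \<forall>t\<in>{0<..<1/(real n+1)}. \<bar>Q s - Q t\<bar> \<le> 1/(real k+1)"
    proof (intro exI[of _ n] ballI)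
      fix s t assume "s \<in> {0<..<1/(real n+1)}" "t \<in> {0<..<1/(real n+1)}"
      hence "\<bar>Q s - l\<bar> < 1/(real k+1)/2" "\<bar>Q t - l\<bar> < 1/(real k+1)/2" using b(2) n by auto
      moreover have "1/(real k+1)/2 + 1/(real k+1)/2 = 1/(real k+1)" by (rule field_sum_of_halves)
      ultimately show "\<bar>Q s - Q t\<bar> \<le> 1/(real k+1)" by argo
    qed
  qed
next
  assume R: ?R
  have "cauchy_filter (filtermap Q (at_right 0))"
    unfolding cauchy_filter_metric_filtermap
  proof (intro allI impI)
    fix e :: real assume "e > 0"
    then obtain k :: nat where k: "1 / (real k + 1) < e"
      using reals_Archimedean[OF \<open>e > 0\<close>] by (auto simp: inverse_eq_divide add.commute)
    obtain n :: nat where n: "\<And>s t. s\<in>{0<..<1/(real n+1)} \<Longrightarrow> t\<in>{0<..<1/(real n+1)} \<Longrightarrow> \<bar>Q s - Q t\<bar> \<le> 1/(real k+1)"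
      using R by blast
    show "\<exists>P. eventually P (at_right 0) \<and> (\<forall>x y. P x \<and> P y \<longrightarrow> dist (Q x) (Q y) < e)"
    proof (intro exI[of _ "\<lambda>s. s\<in>{0<..<1/(real n+1)}"] conjI allI impI)
      show "\<forall>\<^sub>F s in at_right 0. s\<in>{0<..<1/(real n+1)}"
        unfolding eventually_at_right_field by (intro exI[of _ "1/(real n+1)"]) auto
    qed (use n k in \<open>fastforce simp: dist_real_def\<close>)
  qed
  moreover have "complete (UNIV :: real set)" by (rule complete_UNIV)
  ultimately have "\<exists>l\<in>UNIV. filtermap Q (at_right 0) \<le> nhds l"
    unfolding complete_uniform by (auto simp: filtermap_bot_iff trivial_limit_at_right_real)
  thus ?L by (auto simp: filterlim_def)
qed

lemma AE_ex_dir_deriv: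
  fixes f :: "'a::euclidean_space \<Rightarrow> real"
  assumes lip: "L-lipschitz_on UNIV f"
  shows "AE x in lborel. \<exists>l. has_dir_deriv f x v l"
proof -
  have cf: "continuous_on A f" for A
    using lipschitz_on_continuous_on[OF lip] continuous_on_subset by blast
  define Q where "Q x t = (f (x + t *\<^sub>R v) - f x) / t" for x t
  let ?N = "{x. \<not> (\<exists>l. has_dir_deriv f x v l)}"
  have "?N = (\<Union>k::nat. \<Inter>n::nat. \<Union>s\<in>{0<..<1/(real n+1)}. \<Union>t\<in>{0<..<1/(real n+1)}. {x. \<bar>Q x s - Q x t\<bar> > 1/(real k+1)})"
    unfolding has_dir_deriv_def convergent_at_right_iff Q_def by (simp add: set_eq_iff not_le)
  also have "\<dots> \<in> sets borel"
  proof -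
    have "open {x. 1/(real k+1) < \<bar>Q x s - Q x t\<bar>}" if "s \<in> {0<..<1/(real n+1)}" "t \<in> {0<..<1/(real n+1)}" for k n :: nat and s t
      using that unfolding Q_def by (intro open_Collect_less continuous_intros continuous_on_compose2[OF cf[of UNIV]]) auto
    hence "open (\<Union>s\<in>{0<..<1/(real n+1)}. \<Union>t\<in>{0<..<1/(real n+1)}. {x. \<bar>Q x s - Q x t\<bar> > 1/(real k+1)})" for k n :: nat
      by (intro open_UN ballI)
    thus ?thesis by (intro sets.countable_UN sets.countable_INT image_subsetI borel_open) auto
  qed
  finally have N: "?N \<in> sets borel" by simp
  have "AE x in lborel. x \<notin> ?N"
  proof (rule AE_lborel_slices[OF N, of v])
    fix x
    have "(L * norm v)-lipschitz_on UNIV (\<lambda>s. f (x + s *\<^sub>R v))"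
    proof (rule lipschitz_onI)
      fix s t :: real
      have "dist (f (x + s *\<^sub>R v)) (f (x + t *\<^sub>R v)) \<le> L * dist (x + s *\<^sub>R v) (x + t *\<^sub>R v)"
        by (rule lipschitz_onD[OF lip]) auto
      also have "dist (x + s *\<^sub>R v) (x + t *\<^sub>R v) = norm v * dist s t"
        by (simp add: dist_norm scaleR_diff_left[symmetric])
      finally show "dist (f (x + s *\<^sub>R v)) (f (x + t *\<^sub>R v)) \<le> L * norm v * dist s t" by (simp add: mult.assoc)
    qed (use lipschitz_on_nonneg[OF lip] in auto)
    from lipschitz_right_derivative[OF this]
    have "AE s in lborel. \<exists>l. ((\<lambda>t. (f (x + (s + t) *\<^sub>R v) - f (x + s *\<^sub>R v)) / t) \<longlongrightarrow> l) (at_right 0)"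
      by (simp add: AE_completion_iff)
    thus "AE s in lborel. x + s *\<^sub>R v \<notin> ?N"
      by eventually_elim (simp add: has_dir_deriv_def scaleR_add_left add.assoc)
  qed
  thus ?thesis by simp
qed

section \<open>Rademacher's theorem\<close>

text \<open>The sets E k n b, where the difference quotient in direction w is uniformly close to b, are
  closed, so almost every point of such a set has points of the same set near x + t v.
  Existence of the derivative in direction v + w comes for free.\<close>
lemma AE_has_dir_deriv_add:
  fixes f :: "'a::euclidean_space \<Rightarrow> real"
  assumes lip: "L-lipschitz_on UNIV f"
    and v: "AE x in lborel. has_dir_deriv f x v (l x)"
    and w: "AE x in lborel. has_dir_deriv f x w (m x)"
  shows "AE x in lborel. has_dir_deriv f x (v + w) (l x + m x)"
proof -
  have cf: "continuous_on A f" for A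
    using lipschitz_on_continuous_on[OF lip] continuous_on_subset by blast
  have L: "L \<ge> 0" using lip by (rule lipschitz_on_nonneg)
  define E where "E k n b = {x. \<forall>t\<in>{0<..1/(real n+1)}. \<bar>f (x + t *\<^sub>R w) - f x - t * of_rat b\<bar> \<le> 1/(real k+1) * t}"
    for k n :: nat and b :: rat
  have clE: "closed (E k n b)" for k n b
  proof -
    have "E k n b = (\<Inter>t\<in>{0<..1/(real n+1)}. {x. \<bar>f (x + t *\<^sub>R w) - f x - t * of_rat b\<bar> \<le> 1/(real k+1) * t})"
      by (auto simp: E_def)
    also have "closed \<dots>"
      by (intro closed_INT ballI closed_Collect_le continuous_intros continuous_on_compose2[OF cf[of UNIV]]) auto
    finally show ?thesis .
  qed
  \<comment> \<open>Restricting \<open>b\<close> to rationals keeps the family countable, so one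
    null set serves all its members.\<close>
  have d: "AE x in lborel. \<forall>k n b. x \<in> E k n b \<longrightarrow> dir_dense (E k n b) v x"
    unfolding AE_all_countable by (intro allI AE_dir_dense clE)
  from d v w show ?thesis
  proof eventually_elim
    case (elim x)
    show ?case
    proof (rule has_dir_derivI)
      fix e :: real assume e: "e > 0"
      \<comment> \<open>Four errors of size \<open>\<epsilon> * t\<close> occur: the expansion along
        \<open>v\<close>, the two Lipschitz estimates for replacing \<open>x + t *\<^sub>R v\<close>
        by a point of the closed set (together), the defining bound of \<open>E k n b\<close>, and
        the distance from \<open>b\<close> to \<open>m x\<close>.\<close>
      define \<epsilon> where "\<epsilon> = e / 4"
      have \<epsilon>: "\<epsilon> > 0" using e by (simp add: \<epsilon>_def)
      define \<eta> where "\<eta> = \<epsilon> / (2 * L * norm v + 1)"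
      have den: "2 * L * norm v + 1 > 0" using L by (simp add: add_nonneg_pos)
      have \<eta>: "\<eta> > 0" "2 * L * norm v * \<eta> \<le> \<epsilon>"
      proof -
        show "\<eta> > 0" using \<epsilon> den by (simp add: \<eta>_def)
        have "2 * L * norm v * \<eta> = \<epsilon> * (2 * L * norm v / (2 * L * norm v + 1))" by (simp add: \<eta>_def)
        also have "\<dots> \<le> \<epsilon> * 1" using den \<epsilon> by (intro mult_left_mono) auto
        finally show "2 * L * norm v * \<eta> \<le> \<epsilon>" by simp
      qed
      obtain k :: nat where k: "1 / (real k + 1) < \<epsilon>"
        using reals_Archimedean[OF \<epsilon>] by (auto simp: inverse_eq_divide add.commute)
      define \<kappa> where "\<kappa> = 1/(real k+1)"
      have \<kappa>: "\<kappa> > 0" "\<kappa> < \<epsilon>" using k by (auto simp: \<kappa>_def)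
      obtain b :: rat where b: "m x - \<kappa>/2 < of_rat b" "of_rat b < m x + \<kappa>/2"
        using of_rat_dense[of "m x - \<kappa>/2" "m x + \<kappa>/2"] \<kappa> by auto
      have "\<forall>\<^sub>F t in at_right 0. \<bar>f (x + t *\<^sub>R w) - f x - t * m x\<bar> \<le> \<kappa>/2 * t"
        using has_dir_derivD[OF elim(3), of "\<kappa>/2"] \<kappa> by simp
      then obtain c where c: "c > 0" "\<And>t. 0 < t \<Longrightarrow> t < c \<Longrightarrow> \<bar>f (x + t *\<^sub>R w) - f x - t * m x\<bar> \<le> \<kappa>/2 * t"
        unfolding eventually_at_right_field by blast
      obtain n :: nat where n: "1 / (real n + 1) < c"
        using reals_Archimedean[OF c(1)] by (auto simp: inverse_eq_divide add.commute)
      have "x \<in> E k n b"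
        unfolding E_def \<kappa>_def[symmetric]
      proof safe
        fix t assume t: "t \<in> {0<..1/(real n+1)}"
        have "\<bar>f (x + t *\<^sub>R w) - f x - t * m x\<bar> \<le> \<kappa>/2 * t" using c(2)[of t] t n by auto
        moreover have "\<bar>t * m x - t * of_rat b\<bar> \<le> \<kappa>/2 * t"
        proof -
          have "\<bar>t * m x - t * of_rat b\<bar> = \<bar>m x - of_rat b\<bar> * t"
            using t by (simp add: right_diff_distrib[symmetric] abs_mult mult.commute)
          also have "\<dots> \<le> \<kappa>/2 * t" using b t by (intro mult_right_mono; (linarith | simp))
          finally show ?thesis .
        qed
        ultimately show "\<bar>f (x + t *\<^sub>R w) - f x - t * of_rat b\<bar> \<le> \<kappa> * t" by linarith
      qed
      hence "dir_dense (E k n b) v x" using elim(1) by blast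
      hence "\<forall>\<^sub>F t in at_right 0. \<exists>s\<in>{(1-\<eta>)*t..t}. x + s *\<^sub>R v \<in> E k n b" using \<eta> by (simp add: dir_dense_def)
      moreover have "\<forall>\<^sub>F t in at_right 0. \<bar>f (x + t *\<^sub>R v) - f x - t * l x\<bar> \<le> \<epsilon> * t"
        using has_dir_derivD[OF elim(2) \<epsilon>] .
      moreover have "\<forall>\<^sub>F t in at_right (0::real). t \<in> {0<..<1/(real n+1)}"
        unfolding eventually_at_right_field by (intro exI[of _ "1/(real n+1)"]) auto
      ultimately show "\<forall>\<^sub>F t in at_right 0. \<bar>f (x + t *\<^sub>R (v + w)) - f x - t * (l x + m x)\<bar> \<le> e * t"
      proof eventually_elim
        case (elim t)
        have t: "t > 0" "t \<le> 1/(real n+1)" using elim(3) by auto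
        obtain s where s: "s\<in>{(1-\<eta>)*t..t}" "x + s *\<^sub>R v \<in> E k n b" using elim(1) by blast
        define y where "y = x + s *\<^sub>R v"
        have 1: "\<bar>f (y + t *\<^sub>R w) - f y - t * of_rat b\<bar> \<le> \<kappa> * t"
          using s(2) t by (auto simp: E_def y_def \<kappa>_def)
        have "\<bar>t - s\<bar> \<le> \<eta> * t" using s(1) by (auto simp: algebra_simps)
        hence st: "L * (\<bar>t - s\<bar> * norm v) \<le> L * (\<eta> * t * norm v)"
          using L by (intro mult_left_mono mult_right_mono) auto
        have "\<bar>f (x + t *\<^sub>R v) - f y\<bar> \<le> L * dist (x + t *\<^sub>R v) y"
          using lipschitz_onD[OF lip, of "x + t *\<^sub>R v" y] by (simp add: dist_real_def)
        also have "dist (x + t *\<^sub>R v) y = \<bar>t - s\<bar> * norm v"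
          by (simp add: dist_norm y_def scaleR_diff_left[symmetric])
        finally have 2: "\<bar>f (x + t *\<^sub>R v) - f y\<bar> \<le> L * (\<eta> * t * norm v)" using st by linarith
        have "\<bar>f (x + t *\<^sub>R (v + w)) - f (y + t *\<^sub>R w)\<bar> \<le> L * dist (x + t *\<^sub>R (v + w)) (y + t *\<^sub>R w)"
          using lipschitz_onD[OF lip, of "x + t *\<^sub>R (v + w)" "y + t *\<^sub>R w"] by (simp add: dist_real_def)
        also have "dist (x + t *\<^sub>R (v + w)) (y + t *\<^sub>R w) = \<bar>t - s\<bar> * norm v"
          by (simp add: dist_norm y_def scaleR_diff_left[symmetric] scaleR_add_right)
        finally have 3: "\<bar>f (x + t *\<^sub>R (v + w)) - f (y + t *\<^sub>R w)\<bar> \<le> L * (\<eta> * t * norm v)" using st by linarith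
        have 4: "L * (\<eta> * t * norm v) * 2 \<le> \<epsilon> * t"
          using mult_right_mono[OF \<eta>(2), of t] t by (simp add: mult_ac)
        have 5: "\<bar>t * of_rat b - t * m x\<bar> \<le> \<kappa> * t"
        proof -
          have "\<bar>t * of_rat b - t * m x\<bar> = \<bar>of_rat b - m x\<bar> * t"
            using t by (simp add: right_diff_distrib[symmetric] abs_mult mult.commute)
          also have "\<dots> \<le> \<kappa> * t" using b t \<kappa> by (intro mult_right_mono; (linarith | simp))
          finally show ?thesis .
        qed
        have 6: "\<kappa> * t \<le> \<epsilon> * t" using \<kappa> t by simp
        have 7: "e * t = 4 * (\<epsilon> * t)" by (simp add: \<epsilon>_def)
        show ?case unfolding 7 distrib_left using 1 2 3 4 5 6 elim(2) by linarith
      qed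
    qed
  qed
qed

text \<open>Where the directional derivative exists, \<open>SOME\<close> returns it by uniqueness;
  elsewhere the value is arbitrary, which affects no statement that holds almost everywhere.\<close>

definition grad :: "('a::euclidean_space \<Rightarrow> real) \<Rightarrow> 'a \<Rightarrow> 'a" where
  "grad f x = (\<Sum>i\<in>Basis. (SOME l. has_dir_deriv f x i l) *\<^sub>R i)"

lemma AE_has_dir_deriv_grad:
  fixes f :: "'a::euclidean_space \<Rightarrow> real"
  assumes lip: "L-lipschitz_on UNIV f"
  shows "AE x in lborel. has_dir_deriv f x v (grad f x \<bullet> v)"
proof -
  let ?D = "\<lambda>x i. SOME l. has_dir_deriv f x i l"
  have D: "AE x in lborel. has_dir_deriv f x i (?D x i)" for i
    using AE_ex_dir_deriv[OF lip, of i] by eventually_elim (rule someI_ex)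
  \<comment> \<open>A right derivative along \<open>-i\<close> need not be the negative of the one
    along \<open>i\<close>, as the absolute value at 0 shows. Additivity, applied to two directions
    with sum 0, supplies the sign almost everywhere.\<close>
  have neg: "AE x in lborel. has_dir_deriv f x (-i) (- ?D x i)" for i
  proof -
    from AE_has_dir_deriv_add[OF lip D[of i] D[of "-i"]] D[of "-i"] show ?thesis
    proof eventually_elim
      case (elim x)
      have "has_dir_deriv f x 0 0" by (simp add: has_dir_deriv_def)
      with elim(1) have "?D x i + ?D x (-i) = 0" by (intro has_dir_deriv_unique) auto
      hence "?D x (-i) = - ?D x i" by simp
      with elim(2) show ?case by simp
    qed
  qed
  have sc: "AE x in lborel. has_dir_deriv f x (c *\<^sub>R i) (c * ?D x i)" for c i
  proof (cases "c \<ge> 0")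
    case True
    show ?thesis using D[of i] by eventually_elim (rule has_dir_deriv_scale[OF _ True])
  next
    case False
    show ?thesis using neg[of i]
    proof eventually_elim
      case (elim x)
      from has_dir_deriv_scale[OF elim, of "-c"] False show ?case by simp
    qed
  qed
  have "AE x in lborel. has_dir_deriv f x (\<Sum>i\<in>B. (v \<bullet> i) *\<^sub>R i) (\<Sum>i\<in>B. (v \<bullet> i) * ?D x i)" if "finite B" for B
    using that
  proof (induction B rule: finite_induct)
    case empty
    show ?case by (simp add: has_dir_deriv_def)
  next
    case (insert i B)
    show ?case using AE_has_dir_deriv_add[OF lip sc[of "v \<bullet> i" i] insert.IH] insert.hyps by simp
  qed
  from this[OF finite_Basis] show ?thesis
    unfolding euclidean_representation grad_def inner_sum_left
    by (simp add: mult.commute inner_commute[of v])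
qed

text \<open>By compactness of the unit sphere finitely many directions of \<open>D\<close> come
  within \<open>e\<close> of every direction, and finitely many eventual properties hold at a common
  scale. This serves both differentiability and density.\<close>

lemma eventually_uniform_directions:
  fixes D :: "'a::euclidean_space set"
  assumes D: "\<And>x e. e > 0 \<Longrightarrow> \<exists>v\<in>D. dist v x < e"
    and R: "\<And>v. v \<in> D \<Longrightarrow> \<forall>\<^sub>F t in at_right (0::real). R t v" and e: "e > 0"
  shows "\<exists>r>0. \<forall>h. h \<noteq> 0 \<and> norm h < r \<longrightarrow> (\<exists>v\<in>D. R (norm h) v \<and> norm (h - norm h *\<^sub>R v) \<le> e * norm h)"
proof -
  have "sphere (0::'a) 1 \<subseteq> (\<Union>v\<in>D. ball v e)"
  proof
    fix x :: 'a
    show "x \<in> (\<Union>v\<in>D. ball v e)" using D[OF e, of x] by (auto simp: dist_commute)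
  qed
  then obtain V where V: "V \<subseteq> D" "finite V" "sphere 0 1 \<subseteq> (\<Union>v\<in>V. ball v e)"
    using compactE_image[of "sphere (0::'a) 1" D "\<lambda>v. ball v e"] by auto
  have "\<forall>\<^sub>F t in at_right (0::real). \<forall>v\<in>V. R t v"
    using V by (intro eventually_ball_finite) (auto intro: R)
  then obtain r where r: "r > 0" "\<And>t v. 0 < t \<Longrightarrow> t < r \<Longrightarrow> v \<in> V \<Longrightarrow> R t v"
    unfolding eventually_at_right_field by blast
  show ?thesis
  proof (intro exI[of _ r] conjI allI impI r)
    fix h :: 'a assume h: "h \<noteq> 0 \<and> norm h < r"
    have "h /\<^sub>R norm h \<in> sphere 0 1" using h by simp
    hence "h /\<^sub>R norm h \<in> (\<Union>v\<in>V. ball v e)" using V(3) by blast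
    then obtain v where v: "v \<in> V" "dist v (h /\<^sub>R norm h) < e" by auto
    have "h - norm h *\<^sub>R v = norm h *\<^sub>R (h /\<^sub>R norm h - v)" using h by (simp add: scaleR_diff_right)
    hence "norm (h - norm h *\<^sub>R v) = norm h * dist v (h /\<^sub>R norm h)" by (simp add: dist_norm norm_minus_commute)
    also have "\<dots> \<le> e * norm h" using v mult_left_mono[of "dist v (h /\<^sub>R norm h)" e "norm h"] by (simp add: mult.commute)
    finally show "\<exists>v\<in>D. R (norm h) v \<and> norm (h - norm h *\<^sub>R v) \<le> e * norm h"
      using v V h r(2)[of "norm h" v] by auto
  qed
qed

lemma countable_dense_directions:
  obtains D :: "'a::euclidean_space set" where "countable D" "\<And>x e. e > 0 \<Longrightarrow> \<exists>v\<in>D. dist v x < e"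
proof -
  obtain D :: "'a set" where D: "countable D" "\<And>X. open X \<Longrightarrow> X \<noteq> {} \<Longrightarrow> \<exists>d\<in>D. d \<in> X"
    using countable_dense_setE by blast
  show ?thesis
  proof (rule that[OF D(1)])
    fix x :: 'a and e :: real assume "e > 0"
    thus "\<exists>v\<in>D. dist v x < e" using D(2)[of "ball x e"] by (auto simp: dist_commute)
  qed
qed

theorem rademacher_real:
  fixes f :: "'a::euclidean_space \<Rightarrow> real"
  assumes lip: "L-lipschitz_on UNIV f"
  shows "AE x in lborel. (f has_derivative (\<lambda>h. grad f x \<bullet> h)) (at x)"
proof -
  obtain D :: "'a set" where D: "countable D" "\<And>x e. e > 0 \<Longrightarrow> \<exists>v\<in>D. dist v x < e"
    using countable_dense_directions by blast
  have L: "L \<ge> 0" using lip by (rule lipschitz_on_nonneg)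
  have "AE x in lborel. \<forall>v\<in>D. has_dir_deriv f x v (grad f x \<bullet> v)"
    by (intro AE_ball_countable' AE_has_dir_deriv_grad[OF lip] D)
  thus ?thesis
  proof eventually_elim
    case (elim x)
    define g where "g = grad f x"
    show ?case unfolding g_def[symmetric] has_derivative_at_alt
    proof (intro conjI allI impI bounded_linear_inner_right)
      fix e :: real assume e: "e > 0"
      \<comment> \<open>Replacing \<open>h\<close> by \<open>norm h *\<^sub>R v\<close> changes
        \<open>f\<close> by at most \<open>L\<close> times, and the linear term by at most
        \<open>norm g\<close> times, the distance between them. The choice of \<open>\<eta>\<close>
        makes the total at most half of \<open>e * norm h\<close>.\<close>
      define c where "c = L + norm g + 1"
      have c: "c > 0" using L by (simp add: c_def add_nonneg_pos)
      define \<eta> where "\<eta> = e / (2*c)"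
      have \<eta>: "\<eta> > 0" using e c by (simp add: \<eta>_def)
      have "\<forall>\<^sub>F t in at_right 0. \<bar>f (x + t *\<^sub>R v) - f x - t * (g \<bullet> v)\<bar> \<le> e/2 * t" if "v \<in> D" for v
        using has_dir_derivD[of f x v "g \<bullet> v" "e/2"] elim that e by (simp add: g_def)
      from eventually_uniform_directions[of D "\<lambda>t v. \<bar>f (x + t *\<^sub>R v) - f x - t * (g \<bullet> v)\<bar> \<le> e/2 * t", OF D(2) this \<eta>]
      obtain r where r: "r > 0" "\<And>h. h \<noteq> 0 \<Longrightarrow> norm h < r \<Longrightarrow>
        \<exists>v\<in>D. \<bar>f (x + norm h *\<^sub>R v) - f x - norm h * (g \<bullet> v)\<bar> \<le> e/2 * norm h \<and> norm (h - norm h *\<^sub>R v) \<le> \<eta> * norm h"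
        by auto
      show "\<exists>d>0. \<forall>y. norm (y - x) < d \<longrightarrow> norm (f y - f x - g \<bullet> (y - x)) \<le> e * norm (y - x)"
      proof (intro exI[of _ r] conjI allI impI r)
        fix y assume y: "norm (y - x) < r"
        show "norm (f y - f x - g \<bullet> (y - x)) \<le> e * norm (y - x)"
        proof (cases "y = x")
          case False
          define h where "h = y - x"
          obtain v where v: "\<bar>f (x + norm h *\<^sub>R v) - f x - norm h * (g \<bullet> v)\<bar> \<le> e/2 * norm h"
            "norm (h - norm h *\<^sub>R v) \<le> \<eta> * norm h"
            using r(2)[of h] y False by (auto simp: h_def)
          define w where "w = h - norm h *\<^sub>R v"
          have "\<bar>f y - f (x + norm h *\<^sub>R v)\<bar> \<le> L * norm w"
            using lipschitz_onD[OF lip, of y "x + norm h *\<^sub>R v"] by (simp add: dist_real_def dist_norm w_def h_def algebra_simps)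
          moreover have "\<bar>g \<bullet> w\<bar> \<le> norm g * norm w" by (rule Cauchy_Schwarz_ineq2)
          moreover have "g \<bullet> h = norm h * (g \<bullet> v) + g \<bullet> w" by (simp add: w_def inner_diff_right)
          moreover have "L * norm w + norm g * norm w \<le> e/2 * norm h"
          proof -
            have "L * norm w + norm g * norm w \<le> c * norm w" by (simp add: c_def algebra_simps)
            also have "\<dots> \<le> c * (\<eta> * norm h)" using c v(2) by (intro mult_left_mono) (auto simp: w_def)
            also have "\<dots> = e/2 * norm h" using c by (simp add: \<eta>_def)
            finally show ?thesis .
          qed
          ultimately have "\<bar>f y - f x - g \<bullet> h\<bar> \<le> e/2 * norm h + e/2 * norm h" using v(1) by linarith
          thus ?thesis by (simp add: h_def)
        qed simp
      qed
    qed
  qed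
qed

theorem rademacher:
  fixes f :: "'a::euclidean_space \<Rightarrow> 'b::euclidean_space"
  assumes lip: "L-lipschitz_on UNIV f"
  shows "AE x in lborel. f differentiable (at x)"
proof -
  have "L-lipschitz_on UNIV (\<lambda>x. f x \<bullet> i)" if "i \<in> Basis" for i
  proof (rule lipschitz_onI)
    fix x y
    have "dist (f x \<bullet> i) (f y \<bullet> i) = \<bar>(f x - f y) \<bullet> i\<bar>" by (simp add: dist_real_def inner_diff_left)
    also have "\<dots> \<le> dist (f x) (f y)" using Basis_le_norm[OF that] by (simp add: dist_norm)
    also have "\<dots> \<le> L * dist x y" using lipschitz_onD[OF lip] by auto
    finally show "dist (f x \<bullet> i) (f y \<bullet> i) \<le> L * dist x y" .
  qed (use lipschitz_on_nonneg[OF lip] in auto)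
  hence "AE x in lborel. \<forall>i\<in>Basis. ((\<lambda>x. f x \<bullet> i) has_derivative (\<lambda>h. grad (\<lambda>x. f x \<bullet> i) x \<bullet> h)) (at x)"
    by (intro AE_ball_countable' rademacher_real) (auto intro: countable_finite)
  thus ?thesis
  proof eventually_elim
    case (elim x)
    have "(f has_derivative (\<lambda>h. \<Sum>i\<in>Basis. (grad (\<lambda>x. f x \<bullet> i) x \<bullet> h) *\<^sub>R i)) (at x)"
      unfolding has_derivative_componentwise_within[of f] using elim by simp
    thus ?case by (auto simp: differentiable_def)
  qed
qed

text \<open>Rays in countably many dense directions meet \<open>A\<close> at all small scales;
  uniformity over directions upgrades this to a distance o(|h|) from \<open>x + h\<close> to
  \<open>A\<close>.\<close>

lemma AE_ball_dense:
  fixes A :: "'a::euclidean_space set"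
  assumes A: "closed A"
  shows "AE x in lborel. x \<in> A \<longrightarrow> (\<forall>\<eta>>0. \<exists>r>0. \<forall>h. norm h < r \<longrightarrow> (\<exists>y\<in>A. norm (x + h - y) \<le> \<eta> * norm h))"
proof -
  obtain D :: "'a set" where D: "countable D" "\<And>x e. e > 0 \<Longrightarrow> \<exists>v\<in>D. dist v x < e"
    using countable_dense_directions by blast
  have "AE x in lborel. \<forall>v\<in>D. x \<in> A \<longrightarrow> dir_dense A v x"
    by (intro AE_ball_countable' AE_dir_dense A D)
  thus ?thesis
  proof eventually_elim
    case (elim x)
    show ?case
    proof (intro impI allI)
      fix \<eta> :: real assume x: "x \<in> A" and \<eta>: "\<eta> > 0"
      define R where "R t v \<longleftrightarrow> (\<exists>s. \<bar>t - s\<bar> * norm v \<le> \<eta>/2 * t \<and> x + s *\<^sub>R v \<in> A)" for t v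
      have "\<forall>\<^sub>F t in at_right 0. R t v" if "v \<in> D" for v
      proof -
        define \<theta> where "\<theta> = \<eta>/2/(norm v + 1)"
        have nv: "norm v + 1 > 0" by (simp add: add_nonneg_pos)
        hence "\<theta> > 0" using \<eta> by (simp add: \<theta>_def)
        hence "\<forall>\<^sub>F t in at_right 0. \<exists>s\<in>{(1-\<theta>)*t..t}. x + s *\<^sub>R v \<in> A"
          using elim x that by (auto simp: dir_dense_def)
        moreover have "\<forall>\<^sub>F t in at_right (0::real). t > 0" by (rule eventually_at_right_less)
        ultimately show ?thesis
        proof eventually_elim
          case (elim t)
          then obtain s where s: "s\<in>{(1-\<theta>)*t..t}" "x + s *\<^sub>R v \<in> A" by blast
          have "\<bar>t - s\<bar> * norm v \<le> (\<theta> * t) * (norm v + 1)" using s(1)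
            using \<open>\<theta> > 0\<close> elim(2) by (intro mult_mono) (auto simp: algebra_simps)
          also have "\<dots> = (\<theta> * (norm v + 1)) * t" by simp
          also have "\<theta> * (norm v + 1) = \<eta>/2" unfolding \<theta>_def using nv by (subst nonzero_eq_divide_eq[symmetric]) auto
          finally show ?case using s(2) by (auto simp: R_def)
        qed
      qed
      from eventually_uniform_directions[of D R, OF D(2) this, of "\<eta>/2"] \<eta>
      obtain r where r: "r > 0" "\<And>h. h \<noteq> 0 \<Longrightarrow> norm h < r \<Longrightarrow>
        \<exists>v\<in>D. R (norm h) v \<and> norm (h - norm h *\<^sub>R v) \<le> \<eta>/2 * norm h"
        by auto
      show "\<exists>r>0. \<forall>h. norm h < r \<longrightarrow> (\<exists>y\<in>A. norm (x + h - y) \<le> \<eta> * norm h)"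
      proof (intro exI[of _ r] conjI allI impI r)
        fix h :: 'a assume h: "norm h < r"
        show "\<exists>y\<in>A. norm (x + h - y) \<le> \<eta> * norm h"
        proof (cases "h = 0")
          case False
          obtain v s where v: "norm (h - norm h *\<^sub>R v) \<le> \<eta>/2 * norm h" "\<bar>norm h - s\<bar> * norm v \<le> \<eta>/2 * norm h"
            "x + s *\<^sub>R v \<in> A" using r(2)[OF False h] by (auto simp: R_def)
          have "norm (x + h - (x + s *\<^sub>R v)) = norm ((h - norm h *\<^sub>R v) + (norm h - s) *\<^sub>R v)"
            by (simp add: algebra_simps)
          also have "\<dots> \<le> norm (h - norm h *\<^sub>R v) + \<bar>norm h - s\<bar> * norm v"
            by (rule norm_triangle_le) simp
          also have "\<dots> \<le> \<eta> * norm h" using v by linarith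
          finally show ?thesis using v(3) by blast
        qed (use x in auto)
      qed
    qed
  qed
qed

text \<open>McShane's construction: the lower envelope of the cones of slope \<open>L\<close> placed
  on the graph. The Lipschitz condition on \<open>A\<close> keeps every cone above the given
  data.\<close>

lemma lipschitz_extend_real:
  fixes g :: "'a::metric_space \<Rightarrow> real"
  assumes lip: "L-lipschitz_on A g" and A: "A \<noteq> {}"
  shows "\<exists>G. L-lipschitz_on UNIV G \<and> (\<forall>x\<in>A. G x = g x)"
proof -
  have L: "L \<ge> 0" using lip by (rule lipschitz_on_nonneg)
  define G where "G x = (INF y\<in>A. g y + L * dist x y)" for x
  obtain a where a: "a \<in> A" using A by blast
  have bdd: "bdd_below ((\<lambda>y. g y + L * dist x y) ` A)" for x
  proof (rule bdd_belowI2)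
    fix y assume y: "y \<in> A"
    have "g a - g y \<le> L * dist a y" using lipschitz_onD[OF lip a y] by (simp add: dist_real_def)
    also have "\<dots> \<le> L * (dist a x + dist x y)" using L by (intro mult_left_mono dist_triangle)
    finally show "g a - L * dist a x \<le> g y + L * dist x y" by (simp add: algebra_simps)
  qed
  have le: "G x \<le> G z + L * dist x z" for x z
  proof -
    have "G x - L * dist x z \<le> G z" unfolding G_def[of z]
    proof (rule cINF_greatest[OF A])
      fix y assume y: "y \<in> A"
      have "G x \<le> g y + L * dist x y" unfolding G_def by (rule cINF_lower[OF bdd y])
      also have "\<dots> \<le> g y + L * (dist x z + dist z y)" using L by (intro add_left_mono mult_left_mono dist_triangle)
      finally show "G x - L * dist x z \<le> g y + L * dist z y" by (simp add: algebra_simps)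
    qed
    thus ?thesis by simp
  qed
  show ?thesis
  proof (intro exI[of _ G] conjI ballI)
    show "L-lipschitz_on UNIV G"
    proof (rule lipschitz_onI)
      fix x z show "dist (G x) (G z) \<le> L * dist x z"
        using le[of x z] le[of z x] by (simp add: dist_real_def dist_commute abs_le_iff)
    qed (rule L)
    fix x assume x: "x \<in> A"
    show "G x = g x"
    proof (rule antisym)
      show "G x \<le> g x" unfolding G_def using cINF_lower[OF bdd x, of x] by simp
      show "g x \<le> G x" unfolding G_def
      proof (rule cINF_greatest[OF A])
        fix y assume y: "y \<in> A"
        show "g x \<le> g y + L * dist x y" using lipschitz_onD[OF lip x y] by (simp add: dist_real_def)
      qed
    qed
  qed
qed

text \<open>Extending coordinate by coordinate loses a dimensional factor, which is immaterial
  because Rademacher's theorem accepts any constant.\<close>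

lemma lipschitz_extend:
  fixes g :: "'a::metric_space \<Rightarrow> 'b::euclidean_space"
  assumes lip: "L-lipschitz_on A g"
  shows "\<exists>G. (real DIM('b) * L)-lipschitz_on UNIV G \<and> (\<forall>x\<in>A. G x = g x)"
proof (cases "A = {}")
  case True
  have L: "L \<ge> 0" using lip by (rule lipschitz_on_nonneg)
  show ?thesis by (intro exI[of _ "\<lambda>_. 0"]) (use True L in \<open>auto intro!: lipschitz_onI\<close>)
next
  case False
  have L: "L \<ge> 0" using lip by (rule lipschitz_on_nonneg)
  have "\<exists>G. L-lipschitz_on UNIV G \<and> (\<forall>x\<in>A. G x = g x \<bullet> i)" if "i \<in> Basis" for i
  proof -
    have "L-lipschitz_on A (\<lambda>x. g x \<bullet> i)"
    proof (rule lipschitz_onI)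
      fix x y assume xy: "x \<in> A" "y \<in> A"
      have "dist (g x \<bullet> i) (g y \<bullet> i) = \<bar>(g x - g y) \<bullet> i\<bar>" by (simp add: dist_real_def inner_diff_left)
      also have "\<dots> \<le> dist (g x) (g y)" using Basis_le_norm[OF that] by (simp add: dist_norm)
      also have "\<dots> \<le> L * dist x y" using lipschitz_onD[OF lip xy] by auto
      finally show "dist (g x \<bullet> i) (g y \<bullet> i) \<le> L * dist x y" .
    qed (rule L)
    from lipschitz_extend_real[OF this False] show ?thesis .
  qed
  hence "\<forall>i\<in>Basis. \<exists>G. L-lipschitz_on UNIV G \<and> (\<forall>x\<in>A. G x = g x \<bullet> i)" by blast
  from bchoice[OF this] obtain G where "\<forall>i\<in>Basis. L-lipschitz_on UNIV (G i) \<and> (\<forall>x\<in>A. G i x = g x \<bullet> i)" by blast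
  hence G: "\<And>i. i \<in> Basis \<Longrightarrow> L-lipschitz_on UNIV (G i)" "\<And>i x. i \<in> Basis \<Longrightarrow> x \<in> A \<Longrightarrow> G i x = g x \<bullet> i"
    by auto
  show ?thesis
  proof (intro exI[of _ "\<lambda>x. \<Sum>i\<in>Basis. G i x *\<^sub>R i"] conjI ballI)
    show "(real DIM('b) * L)-lipschitz_on UNIV (\<lambda>x. \<Sum>i\<in>Basis. G i x *\<^sub>R i)"
    proof (rule lipschitz_onI)
      fix x y
      have "dist (\<Sum>i\<in>Basis. G i x *\<^sub>R i) (\<Sum>i\<in>Basis. G i y *\<^sub>R (i::'b)) = norm (\<Sum>i\<in>Basis. (G i x - G i y) *\<^sub>R (i::'b))"
        by (simp add: dist_norm sum_subtractf scaleR_diff_left)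
      also have "\<dots> \<le> (\<Sum>i\<in>(Basis::'b set). L * dist x y)"
      proof (rule sum_norm_le)
        fix i :: 'b assume i: "i \<in> Basis"
        show "norm ((G i x - G i y) *\<^sub>R i) \<le> L * dist x y"
          using lipschitz_onD[OF G(1)[OF i], of x y] i by (simp add: dist_real_def)
      qed
      finally show "dist (\<Sum>i\<in>Basis. G i x *\<^sub>R i) (\<Sum>i\<in>Basis. G i y *\<^sub>R (i::'b)) \<le> real DIM('b) * L * dist x y"
        by (simp add: mult.assoc)
    qed (use L in auto)
    fix x assume "x \<in> A"
    thus "(\<Sum>i\<in>Basis. G i x *\<^sub>R i) = g x" by (simp add: G(2) euclidean_representation)
  qed
qed

section \<open>Second-order expansions at contact points\<close>

text \<open>Expand \<open>F (y + h)\<close> around \<open>y\<close> and around \<open>x\<close>, and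
  \<open>F y\<close> around \<open>x\<close>, with \<open>h\<close> parallel to
  \<open>q y - q x\<close> and as long as \<open>y - x\<close>. The function values cancel, and the
  errors 1 + 4 + 1 give the factor 6.\<close>

lemma gradient_lipschitz_of_quadratic_error:
  fixes F :: "'a::real_inner \<Rightarrow> real"
  assumes c11: "\<And>x h. x \<in> A \<Longrightarrow> norm h < \<delta> \<Longrightarrow> \<bar>F (x + h) - F x - q x \<bullet> h\<bar> \<le> C * (norm h)\<^sup>2"
    and x: "x \<in> A" and y: "y \<in> A" and d: "norm (y - x) < \<delta>/2"
  shows "norm (q y - q x) \<le> 6 * C * norm (y - x)"
proof (cases "y = x \<or> q y = q x")
  case True
  have "0 \<le> C * (norm (y - x))\<^sup>2"
    using c11[OF x, of "y - x"] d norm_ge_zero[of "y-x"] by linarith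
  hence "y \<noteq> x \<Longrightarrow> C \<ge> 0" by (simp add: zero_le_mult_iff)
  thus ?thesis using True by (cases "y = x") auto
next
  case False
  define g where "g = q y - q x"
  define s where "s = norm (y - x)"
  define h where "h = (s / norm g) *\<^sub>R g"
  have g: "norm g > 0" and s: "s > 0" using False by (auto simp: g_def s_def)
  have nh: "norm h = s" using g s by (simp add: h_def)
  have C: "C \<ge> 0"
  proof -
    have "0 \<le> C * s\<^sup>2" using c11[OF x, of "y - x"] d norm_ge_zero[of "y-x"] unfolding s_def by linarith
    thus ?thesis using s by (simp add: zero_le_mult_iff)
  qed
  have 1: "\<bar>F (y + h) - F y - q y \<bullet> h\<bar> \<le> C * s\<^sup>2"
    using c11[OF y, of h] d nh norm_ge_zero[of "y-x"] by (simp add: s_def)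
  have n2: "norm ((y - x) + h) \<le> 2 * s" using norm_triangle_ineq[of "y-x" h] nh by (simp add: s_def)
  have "\<bar>F (x + ((y - x) + h)) - F x - q x \<bullet> ((y - x) + h)\<bar> \<le> C * (norm ((y - x) + h))\<^sup>2"
    using n2 d by (intro c11[OF x]) (simp add: s_def)
  also have "\<dots> \<le> C * (2 * s)\<^sup>2" using n2 C by (intro mult_left_mono power_mono) auto
  finally have 2: "\<bar>F (y + h) - F x - q x \<bullet> ((y - x) + h)\<bar> \<le> 4 * (C * s\<^sup>2)" by (simp add: power_mult_distrib)
  have 3: "\<bar>F y - F x - q x \<bullet> (y - x)\<bar> \<le> C * s\<^sup>2"
    using c11[OF x, of "y - x"] d norm_ge_zero[of "y-x"] by (simp add: s_def)
  have "q y \<bullet> h - q x \<bullet> h \<le> 6 * (C * s\<^sup>2)"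
    using 1 2 3 unfolding inner_add_right by linarith
  moreover have "q y \<bullet> h - q x \<bullet> h = s * norm g"
  proof -
    have "q y \<bullet> h - q x \<bullet> h = g \<bullet> h" by (simp add: g_def inner_diff_left)
    also have "\<dots> = s / norm g * (norm g)\<^sup>2" by (simp add: h_def dot_square_norm)
    finally show ?thesis using g by (simp add: power2_eq_square)
  qed
  ultimately have "s * norm g \<le> s * (6 * C * s)" by (simp add: power2_eq_square mult_ac)
  thus ?thesis using s by (simp add: g_def s_def)
qed

text \<open>The expansion is obtained by summing first-order expansions along a fine subdivision of the
  segment from x to x + h, each taken at a nearby point of A. Only the quadratic form of M is seen,
  so M need not be symmetric.\<close>
lemma second_order_expansion:
  fixes F :: "'a::euclidean_space \<Rightarrow> real"
  assumes \<delta>: "\<delta> > 0" and C: "C \<ge> 0"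
    and c11: "\<And>x h. x \<in> A \<Longrightarrow> norm h < \<delta> \<Longrightarrow> \<bar>F (x + h) - F x - q x \<bullet> h\<bar> \<le> C * (norm h)\<^sup>2"
    and x: "x \<in> A" and G: "\<And>y. y \<in> A \<Longrightarrow> G y = q y" and dG: "(G has_derivative M) (at x)"
    and dense: "\<And>\<eta>. \<eta> > 0 \<Longrightarrow> \<exists>r>0. \<forall>h. norm h < r \<longrightarrow> (\<exists>y\<in>A. norm (x + h - y) \<le> \<eta> * norm h)"
    and \<kappa>: "\<kappa> > 0"
  shows "\<exists>r>0. \<forall>h. norm h < r \<longrightarrow> \<bar>F (x + h) - F x - q x \<bullet> h - M h \<bullet> h / 2\<bar> \<le> \<kappa> * (norm h)\<^sup>2"
proof -
  interpret M: bounded_linear M using dG by (rule has_derivative_bounded_linear)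
  obtain K where K: "K > 0" "\<And>h. norm (M h) \<le> norm h * K" using M.pos_bounded by blast
  \<comment> \<open>Errors of order \<open>(norm h)\<^sup>2 / m\<close> will have total coefficient
    \<open>5 * C + 2 * K\<close>. This \<open>m\<close> makes them at most half of the allowance
    \<open>\<kappa>\<close>; \<open>\<theta>\<close> takes the other half.\<close>
  define m :: nat where "m = Suc (nat \<lceil>2 * (5 * C + 2 * K) / \<kappa>\<rceil>)"
  have m: "m > 0" by (simp add: m_def)
  have m': "2 * (5 * C + 2 * K) \<le> \<kappa> * m"
  proof -
    have "2 * (5 * C + 2 * K) / \<kappa> \<le> real m" unfolding m_def by linarith
    thus ?thesis using \<kappa> by (simp add: field_simps)
  qed
  define \<theta> where "\<theta> = \<kappa> / 4"
  have \<theta>: "\<theta> > 0" using \<kappa> by (simp add: \<theta>_def)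
  obtain r1 where r1: "r1 > 0" "\<And>y. norm (y - x) < r1 \<Longrightarrow> norm (G y - G x - M (y - x)) \<le> \<theta> * norm (y - x)"
    using dG \<theta> unfolding has_derivative_at_alt by blast
  obtain r2 where r2: "r2 > 0" "\<And>h. norm h < r2 \<Longrightarrow> \<exists>y\<in>A. norm (x + h - y) \<le> 1/m * norm h"
    using dense[of "1/m"] m by auto
  define r where "r = min (r1/2) (min r2 (\<delta>/2))"
  show ?thesis
  proof (intro exI[of _ r] conjI allI impI)
    show "r > 0" using r1 r2 \<delta> by (simp add: r_def)
    fix h :: 'a assume h: "norm h < r"
    define \<sigma> where "\<sigma> = norm h / m"
    have m1: "1 \<le> real m" using m by simp
    have \<sigma>: "0 \<le> \<sigma>" "\<sigma> \<le> norm h" using m mult_right_mono[OF m1, of "norm h"] by (auto simp: \<sigma>_def field_simps)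
    define p where "p k = x + (real k / m) *\<^sub>R h" for k
    \<comment> \<open>\<open>F\<close> is expanded around a point \<open>y\<close> of
      \<open>A\<close> within \<open>\<sigma>\<close> of \<open>p k\<close>, so both ends of the
      step lie within \<open>2 * \<sigma>\<close> of \<open>y\<close>; then \<open>q y\<close> is
      replaced by its linearization at \<open>x\<close>. Since \<open>m * \<sigma>\<close> equals
      \<open>norm h\<close>, the sum of \<open>m\<close> errors \<open>\<sigma>\<^sup>2\<close>
      gains a factor \<open>1 / m\<close>.\<close>
    have step: "\<bar>F (p (Suc k)) - F (p k) - (q x \<bullet> h) / m - real k * (M h \<bullet> h / m\<^sup>2)\<bar>
        \<le> (5 * C + K) * \<sigma>\<^sup>2 + 2 * \<theta> * norm h * \<sigma>" if k: "k < m" for k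
    proof -
      have "norm ((real k / m) *\<^sub>R h) \<le> norm h" using k by (simp add: field_simps mult_le_cancel_right2 mult_right_mono)
      hence kh: "norm ((real k / m) *\<^sub>R h) \<le> norm h" "norm ((real k / m) *\<^sub>R h) < r2" using h by (auto simp: r_def)
      then obtain y where y: "y \<in> A" "norm (p k - y) \<le> 1/m * norm ((real k / m) *\<^sub>R h)"
        using r2(2) unfolding p_def by blast
      have yk: "norm (p k - y) \<le> \<sigma>"
      proof -
        have "1/m * norm ((real k / m) *\<^sub>R h) \<le> 1/m * norm h" using kh(1) by (intro mult_left_mono) auto
        thus ?thesis using y(2) by (simp add: \<sigma>_def)
      qed
      have ps: "p (Suc k) - p k = (1/m) *\<^sub>R h"
        by (simp add: p_def scaleR_diff_left[symmetric] diff_divide_distrib[symmetric])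
      have ns: "norm (p (Suc k) - p k) = \<sigma>" unfolding ps by (simp add: \<sigma>_def)
      have ysk: "norm (p (Suc k) - y) \<le> 2 * \<sigma>"
        using norm_triangle_ineq[of "p (Suc k) - p k" "p k - y"] ns yk by simp
      have "2 * \<sigma> < \<delta>" "\<sigma> < \<delta>" using \<sigma> h by (auto simp: r_def)
      have "\<bar>F (y + (p (Suc k) - y)) - F y - q y \<bullet> (p (Suc k) - y)\<bar> \<le> C * (norm (p (Suc k) - y))\<^sup>2"
        using ysk \<open>2 * \<sigma> < \<delta>\<close> by (intro c11[OF y(1)]) simp
      also have "\<dots> \<le> C * (2 * \<sigma>)\<^sup>2" using ysk C by (intro mult_left_mono power_mono) auto
      finally have 1: "\<bar>F (p (Suc k)) - F y - q y \<bullet> (p (Suc k) - y)\<bar> \<le> 4 * (C * \<sigma>\<^sup>2)" by (simp add: power_mult_distrib)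
      have "\<bar>F (y + (p k - y)) - F y - q y \<bullet> (p k - y)\<bar> \<le> C * (norm (p k - y))\<^sup>2"
        using yk \<open>\<sigma> < \<delta>\<close> by (intro c11[OF y(1)]) simp
      also have "\<dots> \<le> C * \<sigma>\<^sup>2" using yk C by (intro mult_left_mono power_mono) auto
      finally have 2: "\<bar>F (p k) - F y - q y \<bullet> (p k - y)\<bar> \<le> C * \<sigma>\<^sup>2" by simp
      have 3: "q y \<bullet> (p (Suc k) - y) - q y \<bullet> (p k - y) = (q y \<bullet> h) / m"
        by (simp add: inner_diff_right[symmetric] ps)
      define E where "E = q y - q x - M (y - x)"
      have "norm (y - x) \<le> norm (p k - x) + norm (p k - y)"
        using norm_triangle_ineq[of "p k - x" "y - p k"] by (simp add: norm_minus_commute)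
      hence yx: "norm (y - x) \<le> 2 * norm h" using kh(1) yk \<sigma> by (simp add: p_def)
      have "norm (y - x) < r1" using yx h by (simp add: r_def)
      hence "norm E \<le> \<theta> * norm (y - x)" using r1(2)[of y] y(1) x by (simp add: E_def G)
      also have "\<dots> \<le> \<theta> * (2 * norm h)" using \<theta> by (intro mult_left_mono yx) auto
      finally have E: "norm E \<le> 2 * \<theta> * norm h" by (simp add: mult_ac)
      have My: "M (y - x) = (real k / m) *\<^sub>R M h - M (p k - y)"
        by (simp add: p_def M.diff M.add M.scaleR)
      have qy: "q y = q x + (real k / m) *\<^sub>R M h - M (p k - y) + E" using My by (simp add: E_def)
      have "(q y \<bullet> h) / m = (q x \<bullet> h) / m + real k * (M h \<bullet> h / m\<^sup>2) + (E \<bullet> h - M (p k - y) \<bullet> h) / m"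
        unfolding qy by (simp add: inner_add_left inner_diff_left add_divide_distrib diff_divide_distrib power2_eq_square)
      moreover have "\<bar>(E \<bullet> h - M (p k - y) \<bullet> h) / m\<bar> \<le> 2 * \<theta> * norm h * \<sigma> + K * \<sigma>\<^sup>2"
      proof -
        have "\<bar>E \<bullet> h\<bar> \<le> norm E * norm h" by (rule Cauchy_Schwarz_ineq2)
        also have "\<dots> \<le> (2 * \<theta> * norm h) * norm h" by (intro mult_right_mono E) auto
        finally have a: "\<bar>E \<bullet> h\<bar> \<le> (2 * \<theta> * norm h) * norm h" .
        have "\<bar>M (p k - y) \<bullet> h\<bar> \<le> norm (M (p k - y)) * norm h" by (rule Cauchy_Schwarz_ineq2)
        also have "\<dots> \<le> (norm (p k - y) * K) * norm h" by (intro mult_right_mono K) auto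
        also have "\<dots> \<le> (\<sigma> * K) * norm h" using yk K(1) by (intro mult_right_mono) auto
        finally have b: "\<bar>M (p k - y) \<bullet> h\<bar> \<le> (\<sigma> * K) * norm h" .
        have "\<bar>(E \<bullet> h - M (p k - y) \<bullet> h) / m\<bar> \<le> ((2 * \<theta> * norm h) * norm h + (\<sigma> * K) * norm h) / m"
          using a b m by (simp add: abs_divide divide_right_mono)
        also have "\<dots> = 2 * \<theta> * norm h * \<sigma> + K * \<sigma>\<^sup>2"
          by (simp add: \<sigma>_def add_divide_distrib power2_eq_square)
        finally show ?thesis .
      qed
      moreover have "(5 * C + K) * \<sigma>\<^sup>2 = 5 * (C * \<sigma>\<^sup>2) + K * \<sigma>\<^sup>2" by (simp add: algebra_simps)
      ultimately show ?thesis using 1 2 3 by linarith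
    qed
    have "\<bar>\<Sum>k<m. F (p (Suc k)) - F (p k) - (q x \<bullet> h) / m - real k * (M h \<bullet> h / m\<^sup>2)\<bar>
        \<le> (\<Sum>k<m. (5 * C + K) * \<sigma>\<^sup>2 + 2 * \<theta> * norm h * \<sigma>)"
      by (rule order_trans[OF sum_abs sum_mono]) (use step in auto)
    also have "\<dots> = m * ((5 * C + K) * \<sigma>\<^sup>2 + 2 * \<theta> * norm h * \<sigma>)" by simp
    also have "\<dots> = (5 * C + K) * (norm h)\<^sup>2 / m + 2 * \<theta> * (norm h)\<^sup>2"
      using m by (simp add: \<sigma>_def power2_eq_square field_simps)
    also have "(\<Sum>k<m. F (p (Suc k)) - F (p k) - (q x \<bullet> h) / m - real k * (M h \<bullet> h / m\<^sup>2))
        = F (x + h) - F x - q x \<bullet> h - (M h \<bullet> h / 2 - M h \<bullet> h / (2 * m))"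
    proof -
      have "(\<Sum>k<m. F (p (Suc k)) - F (p k)) = F (p m) - F (p 0)" by (rule sum_lessThan_telescope)
      moreover have "p m = x + h" "p 0 = x" using m by (auto simp: p_def)
      moreover have "(\<Sum>k<m. (q x \<bullet> h) / m) = q x \<bullet> h" using m by simp
      \<comment> \<open>A left Riemann sum: it misses the factor one half by
        \<open>1 / (2 * m)\<close>, and this defect joins the errors of order
        \<open>1 / m\<close>.\<close>
      moreover have "(\<Sum>k<m. real k * (M h \<bullet> h / m\<^sup>2)) = M h \<bullet> h / 2 - M h \<bullet> h / (2 * m)"
      proof -
        have "(\<Sum>k<n. real k) = real n * (real n - 1) / 2" for n :: nat
          by (induction n) (auto simp: field_simps)
        hence "(\<Sum>k<m. real k) * (M h \<bullet> h / m\<^sup>2) = real m * (real m - 1) / 2 * (M h \<bullet> h / m\<^sup>2)"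
          by presburger
        hence "(\<Sum>k<m. real k * (M h \<bullet> h / m\<^sup>2)) = real m * (real m - 1) / 2 * (M h \<bullet> h / m\<^sup>2)"
          unfolding sum_distrib_right .
        also have "\<dots> = M h \<bullet> h / 2 - M h \<bullet> h / (2 * m)" using m by (simp add: field_simps power2_eq_square)
        finally show ?thesis .
      qed
      ultimately show ?thesis by (simp only: sum_subtractf)
    qed
    finally have "\<bar>F (x + h) - F x - q x \<bullet> h - M h \<bullet> h / 2\<bar>
        \<le> (5 * C + K) * (norm h)\<^sup>2 / m + 2 * \<theta> * (norm h)\<^sup>2 + \<bar>M h \<bullet> h / (2 * m)\<bar>" by linarith
    also have "\<bar>M h \<bullet> h / (2 * m)\<bar> \<le> K * (norm h)\<^sup>2 / m"
    proof -
      have "\<bar>M h \<bullet> h\<bar> \<le> norm (M h) * norm h" by (rule Cauchy_Schwarz_ineq2)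
      also have "\<dots> \<le> (norm h * K) * norm h" by (intro mult_right_mono K) auto
      finally have "\<bar>M h \<bullet> h\<bar> / (2 * m) \<le> K * (norm h)\<^sup>2 / (2 * m)"
        by (intro divide_right_mono) (auto simp: power2_eq_square mult_ac)
      also have "\<dots> \<le> K * (norm h)\<^sup>2 / m" using m K by (simp add: field_simps)
      finally show ?thesis by (simp add: abs_divide)
    qed
    also have "(5 * C + K) * (norm h)\<^sup>2 / m + 2 * \<theta> * (norm h)\<^sup>2 + K * (norm h)\<^sup>2 / m
       = ((5 * C + 2 * K) / m + 2 * \<theta>) * (norm h)\<^sup>2" using m by (simp add: field_simps)
    also have "\<dots> \<le> \<kappa> * (norm h)\<^sup>2"
    proof (rule mult_right_mono)
      have "5 * C + 2 * K \<le> \<kappa> / 2 * m" using m' by simp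
      hence "(5 * C + 2 * K) / m \<le> \<kappa> / 2" using m by (subst pos_divide_le_eq) auto
      thus "(5 * C + 2 * K) / m + 2 * \<theta> \<le> \<kappa>" unfolding \<theta>_def by linarith
    qed auto
    finally show "\<bar>F (x + h) - F x - q x \<bullet> h - M h \<bullet> h / 2\<bar> \<le> \<kappa> * (norm h)\<^sup>2" by simp
  qed
qed

text \<open>Adding the three lower bounds and comparing with the affine upper bound leaves a linear
  term dominated by a quadratic one, which forces the slopes to match. The upper bound minus two
  lower bounds then bounds the remaining function from above, with constant
  \<open>2 * c\<close>.\<close>

lemma contact_quadratic_error:
  fixes F1 F2 F3 :: "'a::real_inner \<Rightarrow> real"
  assumes \<delta>: "\<delta> > 0" and c: "c > 0"
    and lo: "\<And>h. F1 (x + h) \<ge> F1 x + q1 \<bullet> h - c * (norm h)\<^sup>2"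
      "\<And>h. F2 (x + h) \<ge> F2 x + q2 \<bullet> h - c * (norm h)\<^sup>2"
      "\<And>h. F3 (x + h) \<ge> F3 x + q3 \<bullet> h - c * (norm h)\<^sup>2"
    and up: "\<And>h. norm h < \<delta> \<Longrightarrow> F1 (x + h) + F2 (x + h) + F3 (x + h) \<le> F1 x + F2 x + F3 x + p \<bullet> h"
  shows "q1 + q2 + q3 = p"
    and "\<And>h. norm h < \<delta> \<Longrightarrow> \<bar>F1 (x + h) - F1 x - q1 \<bullet> h\<bar> \<le> 2 * c * (norm h)\<^sup>2"
    and "\<And>h. norm h < \<delta> \<Longrightarrow> \<bar>F2 (x + h) - F2 x - q2 \<bullet> h\<bar> \<le> 2 * c * (norm h)\<^sup>2"
    and "\<And>h. norm h < \<delta> \<Longrightarrow> \<bar>F3 (x + h) - F3 x - q3 \<bullet> h\<bar> \<le> 2 * c * (norm h)\<^sup>2"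
proof -
  define g where "g = q1 + q2 + q3 - p"
  have ineq: "g \<bullet> h \<le> 3 * (c * (norm h)\<^sup>2)" if "norm h < \<delta>" for h
    using lo[of h] up[OF that] unfolding g_def inner_add_left inner_diff_left by linarith
  have "g = 0"
  proof (rule ccontr)
    assume "g \<noteq> 0"
    hence ng: "norm g > 0" by simp
    \<comment> \<open>With \<open>h = t *\<^sub>R g\<close> the inequality fails once
      \<open>3 * c * t\<close> is at most 1/2; the first bound keeps this \<open>h\<close> in the
      ball of radius \<open>\<delta>\<close>.\<close>
    define t where "t = min (\<delta> / (2 * norm g)) (1 / (6 * c))"
    have t: "t > 0" "t * norm g < \<delta>" "6 * c * t \<le> 1"
    proof -
      show "t > 0" using \<delta> ng c by (simp add: t_def)
      have "t * norm g \<le> \<delta> / (2 * norm g) * norm g" using ng by (intro mult_right_mono) (auto simp: t_def)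
      thus "t * norm g < \<delta>" using ng \<delta> by simp
      have "t \<le> 1 / (6 * c)" by (simp add: t_def)
      thus "6 * c * t \<le> 1" using c by (simp add: field_simps)
    qed
    have "g \<bullet> (t *\<^sub>R g) \<le> 3 * (c * (norm (t *\<^sub>R g))\<^sup>2)" using t by (intro ineq) simp
    hence "t * (norm g)\<^sup>2 \<le> (3 * c * t) * (t * (norm g)\<^sup>2)"
      by (simp add: power2_norm_eq_inner[symmetric] power_mult_distrib power2_eq_square[of t] mult_ac)
    also have "\<dots> \<le> (1/2) * (t * (norm g)\<^sup>2)" using t ng by (intro mult_right_mono) auto
    finally show False using t ng by (simp add: mult_le_0_iff)
  qed
  thus sum: "q1 + q2 + q3 = p" by (simp add: g_def)
  fix h :: 'a assume h: "norm h < \<delta>"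
  have "p \<bullet> h = q1 \<bullet> h + q2 \<bullet> h + q3 \<bullet> h" by (simp add: sum[symmetric] inner_add_left)
  moreover have "c * (norm h)\<^sup>2 \<ge> 0" using c by simp
  ultimately show "\<bar>F1 (x + h) - F1 x - q1 \<bullet> h\<bar> \<le> 2 * c * (norm h)\<^sup>2"
    "\<bar>F2 (x + h) - F2 x - q2 \<bullet> h\<bar> \<le> 2 * c * (norm h)\<^sup>2"
    "\<bar>F3 (x + h) - F3 x - q3 \<bullet> h\<bar> \<le> 2 * c * (norm h)\<^sup>2"
    using lo[of h] up[OF h] unfolding mult.assoc by linarith+
qed

text \<open>On compact \<open>K\<close> the supremum of a continuous function is attained, and a
  maximizer \<open>y\<close> encodes the slope \<open>(2 * c) *\<^sub>R (y - x)\<close> of a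
  paraboloid touching from below at \<open>x\<close>.\<close>

definition sup_conv :: "real \<Rightarrow> 'a::euclidean_space set \<Rightarrow> ('a \<Rightarrow> real) \<Rightarrow> 'a \<Rightarrow> real" where
  "sup_conv c K f x = (SUP y\<in>K. f y - c * (norm (x - y))\<^sup>2)"

lemma sup_conv_attained:
  fixes K :: "'a::euclidean_space set"
  assumes K: "compact K" "K \<noteq> {}" and f: "continuous_on K f"
  shows "\<exists>y\<in>K. sup_conv c K f x = f y - c * (norm (x - y))\<^sup>2 \<and> (\<forall>z\<in>K. f z - c * (norm (x - z))\<^sup>2 \<le> sup_conv c K f x)"
proof -
  have "continuous_on K (\<lambda>y. f y - c * (norm (x - y))\<^sup>2)" by (intro continuous_intros f)
  from continuous_attains_sup[OF K this] obtain y where y: "y \<in> K"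
    "\<And>z. z \<in> K \<Longrightarrow> f z - c * (norm (x - z))\<^sup>2 \<le> f y - c * (norm (x - y))\<^sup>2" by blast
  have "sup_conv c K f x = f y - c * (norm (x - y))\<^sup>2"
    unfolding sup_conv_def by (rule cSup_eq_maximum) (use y in auto)
  thus ?thesis using y by auto
qed

lemma sup_conv_ge:
  fixes K :: "'a::euclidean_space set"
  assumes "compact K" "continuous_on K f" "z \<in> K"
  shows "f z - c * (norm (x - z))\<^sup>2 \<le> sup_conv c K f x"
proof -
  have "K \<noteq> {}" using assms(3) by blast
  from sup_conv_attained[OF assms(1) this assms(2), of c x] assms(3) show ?thesis by metis
qed

text \<open>The maximizer for \<open>x\<close> is kept as a competitor at
  \<open>x + h\<close>.\<close>

lemma sup_conv_lower_paraboloid: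
  fixes K :: "'a::euclidean_space set"
  assumes K: "compact K" and f: "continuous_on K f" and y: "y \<in> K"
    and eq: "sup_conv c K f x = f y - c * (norm (x - y))\<^sup>2"
  shows "sup_conv c K f (x + h) \<ge> sup_conv c K f x + ((2 * c) *\<^sub>R (y - x)) \<bullet> h - c * (norm h)\<^sup>2"
proof -
  have "(norm (x + h - y))\<^sup>2 = (norm (x - y))\<^sup>2 + 2 * ((x - y) \<bullet> h) + (norm h)\<^sup>2"
    by (simp add: power2_norm_eq_inner inner_diff_left inner_diff_right inner_add_left inner_add_right inner_commute)
  hence "c * (norm (x + h - y))\<^sup>2 = c * (norm (x - y))\<^sup>2 + 2 * c * ((x - y) \<bullet> h) + c * (norm h)\<^sup>2"
    by (simp add: distrib_left)
  moreover have "((2 * c) *\<^sub>R (y - x)) \<bullet> h = - (2 * c * ((x - y) \<bullet> h))"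
    by (simp add: inner_diff_left right_diff_distrib)
  ultimately have "sup_conv c K f x + ((2 * c) *\<^sub>R (y - x)) \<bullet> h - c * (norm h)\<^sup>2 = f y - c * (norm (x + h - y))\<^sup>2"
    unfolding eq by linarith
  also have "\<dots> \<le> sup_conv c K f (x + h)" by (rule sup_conv_ge[OF K f y])
  finally show ?thesis .
qed

text \<open>After adding \<open>c * (norm x)\<^sup>2\<close> the supremum runs over affine functions
  of \<open>x\<close>; it is convex, and a finite convex function on the whole space is
  continuous.\<close>

lemma sup_conv_continuous:
  fixes K :: "'a::euclidean_space set"
  assumes K: "compact K" "K \<noteq> {}" and f: "continuous_on K f" and c: "c > 0"
  shows "continuous_on UNIV (sup_conv c K f)"
proof -
  let ?g = "\<lambda>x. sup_conv c K f x + c * (norm x)\<^sup>2"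
  have "convex_on UNIV ?g"
  proof (rule convex_onI)
    fix t :: real and x y :: 'a assume t: "0 < t" "t < 1"
    define w where "w = (1 - t) *\<^sub>R x + t *\<^sub>R y"
    obtain k where k: "k \<in> K" "sup_conv c K f w = f k - c * (norm (w - k))\<^sup>2"
      using sup_conv_attained[OF K f, of c w] by blast
    have aff: "f k - c * (norm (v - k))\<^sup>2 + c * (norm v)\<^sup>2 = f k - c * (k \<bullet> k) + 2 * c * (v \<bullet> k)" for v
      by (simp add: power2_norm_eq_inner inner_diff_left inner_diff_right inner_commute algebra_simps)
    have le: "f k - c * (k \<bullet> k) + 2 * c * (v \<bullet> k) \<le> ?g v" for v
      using sup_conv_ge[OF K(1) f k(1), of c v] aff[of v] by linarith
    have "?g w = f k - c * (k \<bullet> k) + 2 * c * (w \<bullet> k)" using k(2) aff[of w] by simp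
    also have "\<dots> = (1 - t) * (f k - c * (k \<bullet> k) + 2 * c * (x \<bullet> k)) + t * (f k - c * (k \<bullet> k) + 2 * c * (y \<bullet> k))"
      by (simp add: w_def inner_add_left algebra_simps)
    also have "\<dots> \<le> (1 - t) * ?g x + t * ?g y"
      using t by (intro add_mono mult_left_mono le) auto
    finally show "?g ((1 - t) *\<^sub>R x + t *\<^sub>R y) \<le> (1 - t) * ?g x + t * ?g y" by (simp add: w_def)
  qed auto
  hence "continuous_on UNIV ?g" by (intro convex_on_continuous) auto
  moreover have "continuous_on UNIV (\<lambda>x::'a. c * (norm x)\<^sup>2)" by (intro continuous_intros)
  ultimately have "continuous_on UNIV (\<lambda>x. ?g x - c * (norm x)\<^sup>2)" by (rule continuous_on_diff)
  moreover have "(\<lambda>x. ?g x - c * (norm x)\<^sup>2) = sup_conv c K f" by auto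
  ultimately show ?thesis by metis
qed

text \<open>Bounding the slopes makes the pairs of contact point and slope a compact set, of which
  this set is the projection. The density lemma needs closedness.\<close>

lemma compact_contact_set:
  fixes K :: "'a::euclidean_space set"
  assumes K: "compact K" and w: "continuous_on K w"
  shows "compact {x\<in>K. \<exists>p. norm p \<le> \<rho> \<and> (\<forall>y\<in>K. w y - p \<bullet> y \<le> w x - p \<bullet> x)}"
proof -
  let ?T = "K \<times> cball (0::'a) \<rho>"
  have "closed {z\<in>?T. w y - snd z \<bullet> y - (w (fst z) - snd z \<bullet> fst z) \<in> {..0}}" for y
  proof (rule continuous_closed_preimage[unfolded vimage_def Int_def mem_Collect_eq, of ?T])
    show "continuous_on ?T (\<lambda>z. w y - snd z \<bullet> y - (w (fst z) - snd z \<bullet> fst z))"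
      by (intro continuous_intros continuous_on_compose2[OF w]) auto
    show "closed ?T" using K by (intro closed_Times compact_imp_closed) auto
  qed auto
  hence "closed (\<Inter>y\<in>K. {z\<in>?T. w y - snd z \<bullet> y - (w (fst z) - snd z \<bullet> fst z) \<in> {..0}})"
    by (intro closed_INT) auto
  hence "compact (?T \<inter> (\<Inter>y\<in>K. {z\<in>?T. w y - snd z \<bullet> y - (w (fst z) - snd z \<bullet> fst z) \<in> {..0}}))"
    using K by (intro compact_Int_closed compact_Times) auto
  hence "compact (fst ` (?T \<inter> (\<Inter>y\<in>K. {z\<in>?T. w y - snd z \<bullet> y - (w (fst z) - snd z \<bullet> fst z) \<in> {..0}})))"
    by (intro compact_continuous_image continuous_intros)
  also have "fst ` (?T \<inter> (\<Inter>y\<in>K. {z\<in>?T. w y - snd z \<bullet> y - (w (fst z) - snd z \<bullet> fst z) \<in> {..0}}))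
    = {x\<in>K. \<exists>p. norm p \<le> \<rho> \<and> (\<forall>y\<in>K. w y - p \<bullet> y \<le> w x - p \<bullet> x)}"
  proof (intro set_eqI iffI)
    fix x assume "x \<in> {x\<in>K. \<exists>p. norm p \<le> \<rho> \<and> (\<forall>y\<in>K. w y - p \<bullet> y \<le> w x - p \<bullet> x)}"
    then obtain p where "x \<in> K" "norm p \<le> \<rho>" "\<forall>y\<in>K. w y - p \<bullet> y \<le> w x - p \<bullet> x" by blast
    thus "x \<in> fst ` (?T \<inter> (\<Inter>y\<in>K. {z\<in>?T. w y - snd z \<bullet> y - (w (fst z) - snd z \<bullet> fst z) \<in> {..0}}))"
      by (intro image_eqI[of _ _ "(x, p)"]) auto
  qed force
  finally show ?thesis .
qed

section \<open>A theorem on sums for three functions\<close>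

text \<open>\<open>M\<close> is only linear because it will be the derivative of an extended
  gradient map, whose symmetry is not established. The quantifier over \<open>\<kappa>\<close>
  expresses an error o(|h|^2).\<close>

definition superjet :: "('a::euclidean_space \<Rightarrow> real) \<Rightarrow> 'a \<Rightarrow> 'a \<Rightarrow> ('a \<Rightarrow> 'a) \<Rightarrow> bool" where
  "superjet f y q M \<longleftrightarrow> linear M \<and>
     (\<forall>\<kappa>>0. \<exists>r>0. \<forall>h. norm h < r \<longrightarrow> f (y + h) \<le> f y + q \<bullet> h + M h \<bullet> h / 2 + \<kappa> * (norm h)\<^sup>2)"

text \<open>Shifting \<open>x\<close> and \<open>y\<close> together leaves the penalty unchanged: up
  to a constant, \<open>f (y + h)\<close> lies below the sup-convolution at \<open>x + h\<close>,
  with equality for \<open>h = 0\<close>. So the jet moves from \<open>x\<close> to \<open>y\<close>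
  with the same \<open>q\<close> and \<open>M\<close>.\<close>

lemma superjet_of_sup_conv:
  fixes K :: "'a::euclidean_space set"
  assumes K: "compact K" and f: "continuous_on K f" and y: "y \<in> K"
    and eq: "sup_conv c K f x = f y - c * (norm (x - y))\<^sup>2"
    and M: "linear M" and r0: "r0 > 0" "ball y r0 \<subseteq> K"
    and exp: "\<And>\<kappa>. \<kappa> > 0 \<Longrightarrow> \<exists>r>0. \<forall>h. norm h < r \<longrightarrow>
       \<bar>sup_conv c K f (x + h) - sup_conv c K f x - q \<bullet> h - M h \<bullet> h / 2\<bar> \<le> \<kappa> * (norm h)\<^sup>2"
  shows "superjet f y q M"
  unfolding superjet_def
proof (intro conjI M allI impI)
  fix \<kappa> :: real assume "\<kappa> > 0"
  then obtain r where r: "r > 0" "\<And>h. norm h < r \<Longrightarrow>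
       \<bar>sup_conv c K f (x + h) - sup_conv c K f x - q \<bullet> h - M h \<bullet> h / 2\<bar> \<le> \<kappa> * (norm h)\<^sup>2"
    using exp by blast
  show "\<exists>r>0. \<forall>h. norm h < r \<longrightarrow> f (y + h) \<le> f y + q \<bullet> h + M h \<bullet> h / 2 + \<kappa> * (norm h)\<^sup>2"
  proof (intro exI[of _ "min r r0"] conjI allI impI)
    fix h :: 'a assume h: "norm h < min r r0"
    have "y + h \<in> K" using h r0(2) by (auto simp: dist_norm subset_eq)
    from sup_conv_ge[OF K f this, of c "x + h"]
    have "f (y + h) \<le> sup_conv c K f (x + h) + c * (norm (x - y))\<^sup>2" by simp
    thus "f (y + h) \<le> f y + q \<bullet> h + M h \<bullet> h / 2 + \<kappa> * (norm h)\<^sup>2"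
      using r(2)[of h] h eq by (simp add: abs_le_iff)
  qed (use r r0 in auto)
qed

text \<open>Stands in for the Crandall-Ishii lemma. The base points may differ because each
  maximizes its own sup-convolution; slopes and quadratic forms are tied together because all come
  from one contact point of the sum.\<close>

lemma theorem_on_sums:
  fixes K W :: "'a::euclidean_space set"
  assumes K: "compact K" and W: "open W" "W \<subseteq> K"
    and f1: "continuous_on K f1" and f2: "continuous_on K f2" and f3: "continuous_on K f3"
    and pos: "x0 \<in> W" "f1 x0 + f2 x0 + f3 x0 > 0"
    and bd: "\<And>x. x \<in> K - W \<Longrightarrow> f1 x + f2 x + f3 x \<le> 0" and \<rho>0: "\<rho>0 > 0"
  shows "\<exists>y1 y2 y3 q1 q2 q3 M1 M2 M3. y1 \<in> W \<and> y2 \<in> W \<and> y3 \<in> W \<and> norm (q1 + q2 + q3) \<le> \<rho>0 \<and>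
    (\<forall>h. M1 h \<bullet> h + M2 h \<bullet> h + M3 h \<bullet> h \<le> 0) \<and>
    superjet f1 y1 q1 M1 \<and> superjet f2 y2 q2 M2 \<and> superjet f3 y3 q3 M3"
proof -

  \<comment> \<open>Uniform bounds and the scale of the regularization\<close>
  define m where "m = f1 x0 + f2 x0 + f3 x0"
  have m: "m > 0" using pos by (simp add: m_def)
  have K0: "K \<noteq> {}" using pos W by auto
  have x0K: "x0 \<in> K" using pos W by auto
  have bnd: "\<exists>B. \<forall>x\<in>K. \<bar>f x\<bar> \<le> B" if "continuous_on K f" for f :: "'a \<Rightarrow> real"
    using compact_imp_bounded[OF compact_continuous_image[OF that K]] unfolding bounded_iff by auto
  obtain B1 B2 B3 where "\<forall>x\<in>K. \<bar>f1 x\<bar> \<le> B1" "\<forall>x\<in>K. \<bar>f2 x\<bar> \<le> B2" "\<forall>x\<in>K. \<bar>f3 x\<bar> \<le> B3"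
    using bnd[OF f1] bnd[OF f2] bnd[OF f3] by blast
  define B where "B = max 1 (max B1 (max B2 B3))"
  have B: "B > 0" "\<And>x. x \<in> K \<Longrightarrow> \<bar>f1 x\<bar> \<le> B" "\<And>x. x \<in> K \<Longrightarrow> \<bar>f2 x\<bar> \<le> B" "\<And>x. x \<in> K \<Longrightarrow> \<bar>f3 x\<bar> \<le> B"
    using \<open>\<forall>x\<in>K. \<bar>f1 x\<bar> \<le> B1\<close> \<open>\<forall>x\<in>K. \<bar>f2 x\<bar> \<le> B2\<close> \<open>\<forall>x\<in>K. \<bar>f3 x\<bar> \<le> B3\<close> by (fastforce simp: B_def)+
  obtain R where R: "R > 0" "\<And>x. x \<in> K \<Longrightarrow> norm x \<le> R"
    using compact_imp_bounded[OF K] unfolding bounded_pos by blast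
  have unif: "\<exists>d>0. \<forall>x\<in>K. \<forall>y\<in>K. norm (y - x) < d \<longrightarrow> \<bar>f y - f x\<bar> \<le> m/12" if "continuous_on K f" for f :: "'a \<Rightarrow> real"
  proof -
    have "m/12 > 0" using m by simp
    from compact_uniformly_continuous[OF that K, unfolded uniformly_continuous_on_def, rule_format, OF this]
    show ?thesis by (force simp: dist_norm)
  qed
  obtain d1 d2 d3 where d123: "d1 > 0" "d2 > 0" "d3 > 0"
    "\<forall>x\<in>K. \<forall>y\<in>K. norm (y - x) < d1 \<longrightarrow> \<bar>f1 y - f1 x\<bar> \<le> m/12"
    "\<forall>x\<in>K. \<forall>y\<in>K. norm (y - x) < d2 \<longrightarrow> \<bar>f2 y - f2 x\<bar> \<le> m/12"
    "\<forall>x\<in>K. \<forall>y\<in>K. norm (y - x) < d3 \<longrightarrow> \<bar>f3 y - f3 x\<bar> \<le> m/12"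
    using unif[OF f1] unif[OF f2] unif[OF f3] by blast
  define d where "d = min d1 (min d2 d3)"
  have d: "d > 0" and osc: "\<And>x y. x \<in> K \<Longrightarrow> y \<in> K \<Longrightarrow> norm (y - x) < d \<Longrightarrow>
      \<bar>f1 y - f1 x\<bar> \<le> m/12 \<and> \<bar>f2 y - f2 x\<bar> \<le> m/12 \<and> \<bar>f3 y - f3 x\<bar> \<le> m/12"
    using d123 by (auto simp: d_def)
  \<comment> \<open>A maximizer at distance at least \<open>d/2\<close> would pay a penalty of at
    least \<open>4 * B\<close>, while values of one function on \<open>K\<close> differ by at most
    \<open>2 * B\<close>. So maximizers stay within \<open>d/2\<close>.\<close>
  define c where "c = 16 * B / d\<^sup>2"
  have c: "c > 0" "c * d\<^sup>2 = 16 * B" using B d by (auto simp: c_def)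
  let ?S = "sup_conv c K"
  have near: "norm (x - y) < d/2"
    if x: "x \<in> K" and y: "y \<in> K" "?S f x = f y - c * (norm (x - y))\<^sup>2" and f: "continuous_on K f"
      and fB: "\<And>x. x \<in> K \<Longrightarrow> \<bar>f x\<bar> \<le> B" for f x y
  proof (rule ccontr)
    assume "\<not> norm (x - y) < d/2"
    hence "(d/2)\<^sup>2 \<le> (norm (x - y))\<^sup>2" using d by (intro power_mono) auto
    hence "c * (d/2)\<^sup>2 \<le> c * (norm (x - y))\<^sup>2" using c by (intro mult_left_mono) auto
    moreover have "f x \<le> ?S f x" using sup_conv_ge[OF K f x, of c x] by simp
    ultimately have "4 * B \<le> f y - f x" using y(2) c(2) by (simp add: power_divide)
    thus False using fB[OF x] fB[OF y(1)] B(1) by linarith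
  qed
  have S_bounds: "f x \<le> ?S f x \<and> ?S f x \<le> f x + m/12"
    if x: "x \<in> K" and f: "continuous_on K f" and fB: "\<And>x. x \<in> K \<Longrightarrow> \<bar>f x\<bar> \<le> B"
      and fo: "\<And>x y. x \<in> K \<Longrightarrow> y \<in> K \<Longrightarrow> norm (y - x) < d \<Longrightarrow> \<bar>f y - f x\<bar> \<le> m/12" for f x
  proof
    show "f x \<le> ?S f x" using sup_conv_ge[OF K f x, of c x] by simp
    obtain y where y: "y \<in> K" "?S f x = f y - c * (norm (x - y))\<^sup>2"
      using sup_conv_attained[OF K K0 f] by blast
    have "norm (y - x) < d" using near[OF x y f fB] d by (simp add: norm_minus_commute)
    hence "\<bar>f y - f x\<bar> \<le> m/12" by (intro fo x y)
    moreover have "c * (norm (x - y))\<^sup>2 \<ge> 0" using c by simp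
    ultimately show "?S f x \<le> f x + m/12" using y(2) by linarith
  qed
  define F where "F x = f1 x + f2 x + f3 x" for x
  define w where "w x = ?S f1 x + ?S f2 x + ?S f3 x" for x
  have w_bounds: "F x \<le> w x" "w x \<le> F x + m/4" if "x \<in> K" for x
    using S_bounds[OF that f1 B(2)] S_bounds[OF that f2 B(3)] S_bounds[OF that f3 B(4)] osc
    by (auto simp: F_def w_def)
  have cw: "continuous_on A w" for A
    unfolding w_def by (intro continuous_intros continuous_on_subset[OF sup_conv_continuous[OF K K0 _ c(1)]] f1 f2 f3) auto
  define \<rho> where "\<rho> = min \<rho>0 (m / (8 * R))"
  have \<rho>: "\<rho> > 0" "\<rho> \<le> \<rho>0" "\<rho> * R \<le> m/8"
  proof -
    show "\<rho> > 0" "\<rho> \<le> \<rho>0" using \<rho>0 m R by (auto simp: \<rho>_def)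
    have "\<rho> * R \<le> m / (8 * R) * R" using R by (intro mult_right_mono) (auto simp: \<rho>_def)
    thus "\<rho> * R \<le> m/8" using R by simp
  qed

  \<comment> \<open>The contact set and its distance from the boundary\<close>
  define A where "A = {x\<in>K. \<exists>p. norm p \<le> \<rho> \<and> (\<forall>y\<in>K. w y - p \<bullet> y \<le> w x - p \<bullet> x)}"
  have A: "compact A" unfolding A_def by (rule compact_contact_set[OF K cw])
  have AK: "A \<subseteq> K" by (auto simp: A_def)
  have pR: "\<bar>p \<bullet> x\<bar> \<le> m/8" if "norm p \<le> \<rho>" "x \<in> K" for p x
  proof -
    have "\<bar>p \<bullet> x\<bar> \<le> norm p * norm x" by (rule Cauchy_Schwarz_ineq2)
    also have "\<dots> \<le> \<rho> * R" using that R \<rho> by (intro mult_mono) auto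
    finally show ?thesis using \<rho> by linarith
  qed
  have deep: "ball x d \<subseteq> W" if "x \<in> A" for x
  proof (rule ccontr)
    assume nW: "\<not> ball x d \<subseteq> W"
    obtain p where xK: "x \<in> K" and p: "norm p \<le> \<rho>" "\<And>y. y \<in> K \<Longrightarrow> w y - p \<bullet> y \<le> w x - p \<bullet> x"
      using \<open>x \<in> A\<close> by (auto simp: A_def)
    have "F x0 = m" by (simp add: F_def m_def)
    \<comment> \<open>Of the value \<open>m\<close> at \<open>x0\<close> the slopes cost at most
      \<open>2 * (m/8)\<close> and the regularization at most \<open>m/4\<close>. Within distance
      \<open>d\<close> the sum changes by at most \<open>3 * (m/12)\<close>, so the ball around
      \<open>x\<close> cannot reach the boundary, where the sum is nonpositive.\<close>
    hence "F x \<ge> m/2"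
      using p(2)[OF x0K] w_bounds[OF xK] w_bounds[OF x0K] pR[OF p(1) x0K] pR[OF p(1) xK] by linarith
    hence "x \<in> W" using bd[of x] xK m by (force simp: F_def)
    have "ball x d \<inter> frontier W \<noteq> {}"
    proof (rule connected_Int_frontier)
      show "ball x d \<inter> W \<noteq> {}" using \<open>x \<in> W\<close> d centre_in_ball[of x d] by blast
      show "ball x d - W \<noteq> {}" using nW by blast
    qed simp
    then obtain z where z: "z \<in> ball x d" "z \<in> frontier W" by blast
    have "closure W \<subseteq> K" using W K by (simp add: closure_minimal compact_imp_closed)
    hence "z \<in> K - W" using z W(1) by (auto simp: frontier_def interior_open)
    moreover have "norm (z - x) < d" using z by (simp add: dist_norm norm_minus_commute)
    ultimately have "\<bar>f1 z - f1 x\<bar> \<le> m/12 \<and> \<bar>f2 z - f2 x\<bar> \<le> m/12 \<and> \<bar>f3 z - f3 x\<bar> \<le> m/12" "F z \<le> 0"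
      using osc[OF xK, of z] bd[of z] by (auto simp: F_def)
    thus False using \<open>F x \<ge> m/2\<close> m unfolding F_def by linarith
  qed
  have sel: "\<exists>y. \<forall>x. y x \<in> K \<and> ?S f x = f (y x) - c * (norm (x - y x))\<^sup>2" if "continuous_on K f" for f
    by (rule choice) (use sup_conv_attained[OF K K0 that] in blast)
  obtain y1 where y1: "\<And>x. y1 x \<in> K" "\<And>x. ?S f1 x = f1 (y1 x) - c * (norm (x - y1 x))\<^sup>2" using sel[OF f1] by blast
  obtain y2 where y2: "\<And>x. y2 x \<in> K" "\<And>x. ?S f2 x = f2 (y2 x) - c * (norm (x - y2 x))\<^sup>2" using sel[OF f2] by blast
  obtain y3 where y3: "\<And>x. y3 x \<in> K" "\<And>x. ?S f3 x = f3 (y3 x) - c * (norm (x - y3 x))\<^sup>2" using sel[OF f3] by blast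
  define q1 q2 q3 where "q1 x = (2 * c) *\<^sub>R (y1 x - x)" and "q2 x = (2 * c) *\<^sub>R (y2 x - x)" and "q3 x = (2 * c) *\<^sub>R (y3 x - x)" for x
  have contact: "q1 x + q2 x + q3 x = p \<and> (\<forall>h. norm h < d \<longrightarrow>
      \<bar>?S f1 (x + h) - ?S f1 x - q1 x \<bullet> h\<bar> \<le> 2 * c * (norm h)\<^sup>2 \<and>
      \<bar>?S f2 (x + h) - ?S f2 x - q2 x \<bullet> h\<bar> \<le> 2 * c * (norm h)\<^sup>2 \<and>
      \<bar>?S f3 (x + h) - ?S f3 x - q3 x \<bullet> h\<bar> \<le> 2 * c * (norm h)\<^sup>2)"
    if x: "x \<in> A" and p: "\<And>y. y \<in> K \<Longrightarrow> w y - p \<bullet> y \<le> w x - p \<bullet> x" for x p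
  proof -
    have up: "?S f1 (x + h) + ?S f2 (x + h) + ?S f3 (x + h) \<le> ?S f1 x + ?S f2 x + ?S f3 x + p \<bullet> h" if "norm h < d" for h
    proof -
      have "x + h \<in> K" using deep[OF x] W that by (auto simp: subset_eq dist_norm)
      from p[OF this] show ?thesis by (simp add: w_def inner_add_right)
    qed
    note lo = sup_conv_lower_paraboloid[OF K f1 y1, folded q1_def] sup_conv_lower_paraboloid[OF K f2 y2, folded q2_def]
      sup_conv_lower_paraboloid[OF K f3 y3, folded q3_def]
    note ce = contact_quadratic_error[OF d c(1) lo up]
    show ?thesis using ce by blast
  qed
  have sum_q: "norm (q1 x + q2 x + q3 x) \<le> \<rho>" if "x \<in> A" for x
    using that contact[OF that] by (auto simp: A_def)
  have c1: "\<bar>?S f1 (x + h) - ?S f1 x - q1 x \<bullet> h\<bar> \<le> 2 * c * (norm h)\<^sup>2"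
   and c2: "\<bar>?S f2 (x + h) - ?S f2 x - q2 x \<bullet> h\<bar> \<le> 2 * c * (norm h)\<^sup>2"
   and c3: "\<bar>?S f3 (x + h) - ?S f3 x - q3 x \<bullet> h\<bar> \<le> 2 * c * (norm h)\<^sup>2"
   if "x \<in> A" "norm h < d" for x h
    using that contact[OF that(1)] by (auto simp: A_def)
  \<comment> \<open>Pairs closer than \<open>d/2\<close> need \<open>6 * (2 * c)\<close>, from the
    quadratic errors. For distant pairs the bound \<open>c * d\<close> on each gradient suffices,
    and it follows from maximizers being within \<open>d/2\<close>.\<close>
  define L where "L = 12 * c + 8 * c"
  have L: "L \<ge> 0" using c by (simp add: L_def)
  have lip: "L-lipschitz_on A q"
    if err: "\<And>x h. x \<in> A \<Longrightarrow> norm h < d \<Longrightarrow> \<bar>G (x + h) - G x - q x \<bullet> h\<bar> \<le> 2 * c * (norm h)\<^sup>2"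
      and q: "\<And>x. x \<in> A \<Longrightarrow> norm (q x) \<le> c * d" for G :: "'a \<Rightarrow> real" and q
  proof (rule lipschitz_onI)
    fix x y assume xy: "x \<in> A" "y \<in> A"
    show "dist (q x) (q y) \<le> L * dist x y"
    proof (cases "norm (y - x) < d/2")
      case True
      have "norm (q y - q x) \<le> 6 * (2 * c) * norm (y - x)"
        by (rule gradient_lipschitz_of_quadratic_error[OF err xy True])
      also have "\<dots> \<le> L * norm (y - x)" using c by (intro mult_right_mono) (auto simp: L_def)
      finally show ?thesis by (simp add: dist_norm norm_minus_commute)
    next
      case False
      have "dist (q x) (q y) \<le> norm (q x) + norm (q y)" by (simp add: dist_norm norm_triangle_ineq4)
      also have "\<dots> \<le> 2 * (c * d)" using q[OF xy(1)] q[OF xy(2)] by linarith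
      also have "\<dots> = 4 * c * (d/2)" by simp
      also have "\<dots> \<le> L * norm (y - x)" using False c L d by (intro mult_mono) (auto simp: L_def)
      finally show ?thesis by (simp add: dist_norm norm_minus_commute)
    qed
  qed (rule L)
  have qb: "norm ((2 * c) *\<^sub>R (y - x)) \<le> c * d" if "norm (x - y) < d/2" for x y :: 'a
  proof -
    have "norm ((2 * c) *\<^sub>R (y - x)) = 2 * c * norm (x - y)" using c by (simp add: norm_minus_commute)
    also have "\<dots> \<le> 2 * c * (d/2)" using that c by (intro mult_left_mono) auto
    finally show ?thesis by simp
  qed
  have l1: "L-lipschitz_on A q1"
  proof (rule lip[OF c1])
    fix x assume "x \<in> A"
    show "norm (q1 x) \<le> c * d" unfolding q1_def
      by (rule qb, rule near[OF subsetD[OF AK \<open>x \<in> A\<close>] y1 f1 B(2)])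
  qed
  have l2: "L-lipschitz_on A q2"
  proof (rule lip[OF c2])
    fix x assume "x \<in> A"
    show "norm (q2 x) \<le> c * d" unfolding q2_def
      by (rule qb, rule near[OF subsetD[OF AK \<open>x \<in> A\<close>] y2 f2 B(3)])
  qed
  have l3: "L-lipschitz_on A q3"
  proof (rule lip[OF c3])
    fix x assume "x \<in> A"
    show "norm (q3 x) \<le> c * d" unfolding q3_def
      by (rule qb, rule near[OF subsetD[OF AK \<open>x \<in> A\<close>] y3 f3 B(4)])
  qed

  \<comment> \<open>The contact set is not negligible\<close>
  have nneg: "\<not> negligible A"
  proof
    assume neg: "negligible A"
    have "negligible ((\<lambda>x. q1 x + q2 x + q3 x) ` A)"
    proof (rule negligible_locally_Lipschitz_image[OF order_refl neg])
      fix x assume x: "x \<in> A"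
      have "norm ((q1 y + q2 y + q3 y) - (q1 x + q2 x + q3 x)) \<le> (3 * L) * norm (y - x)" if y: "y \<in> A" for y
      proof -
        have "norm ((q1 y + q2 y + q3 y) - (q1 x + q2 x + q3 x)) = norm ((q1 y - q1 x) + (q2 y - q2 x) + (q3 y - q3 x))"
          by (simp add: algebra_simps)
        also have "\<dots> \<le> norm (q1 y - q1 x) + norm (q2 y - q2 x) + norm (q3 y - q3 x)"
          by (intro norm_triangle_le add_mono norm_triangle_ineq) auto
        also have "\<dots> \<le> (3 * L) * norm (y - x)"
          using lipschitz_onD[OF l1 y x] lipschitz_onD[OF l2 y x] lipschitz_onD[OF l3 y x] by (simp add: dist_norm)
        finally show ?thesis .
      qed
      thus "\<exists>T B. open T \<and> x \<in> T \<and> (\<forall>y\<in>A \<inter> T. norm ((q1 y + q2 y + q3 y) - (q1 x + q2 x + q3 x)) \<le> B * norm (y - x))"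
        by (intro exI[of _ UNIV] exI[of _ "3 * L"]) auto
    qed
    \<comment> \<open>Maximizing \<open>w y - p \<bullet> y\<close> over \<open>K\<close> gives a
      contact point for each small slope \<open>p\<close>, where the three gradients must add up to
      \<open>p\<close>. A Lipschitz image of a null set cannot contain such a ball.\<close>
    moreover have "ball 0 \<rho> \<subseteq> (\<lambda>x. q1 x + q2 x + q3 x) ` A"
    proof
      fix p :: 'a assume p: "p \<in> ball 0 \<rho>"
      have "continuous_on K (\<lambda>y. w y - p \<bullet> y)" by (intro continuous_intros cw)
      from continuous_attains_sup[OF K K0 this] obtain x where x: "x \<in> K" "\<And>y. y \<in> K \<Longrightarrow> w y - p \<bullet> y \<le> w x - p \<bullet> x" by blast
      have "x \<in> A" using x p by (auto simp: A_def intro!: exI[of _ p])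
      moreover have "q1 x + q2 x + q3 x = p" using contact[OF \<open>x \<in> A\<close> x(2)] by blast
      ultimately show "p \<in> (\<lambda>x. q1 x + q2 x + q3 x) ` A" by blast
    qed
    ultimately have "negligible (ball (0::'a) \<rho>)" by (rule negligible_subset)
    thus False using \<rho> open_not_negligible[of "ball (0::'a) \<rho>"] by simp
  qed

  \<comment> \<open>A density point and the jets it carries\<close>
  obtain G1 where G1: "(real DIM('a) * L)-lipschitz_on UNIV G1" "\<And>x. x \<in> A \<Longrightarrow> G1 x = q1 x" using lipschitz_extend[OF l1] by blast
  obtain G2 where G2: "(real DIM('a) * L)-lipschitz_on UNIV G2" "\<And>x. x \<in> A \<Longrightarrow> G2 x = q2 x" using lipschitz_extend[OF l2] by blast
  obtain G3 where G3: "(real DIM('a) * L)-lipschitz_on UNIV G3" "\<And>x. x \<in> A \<Longrightarrow> G3 x = q3 x" using lipschitz_extend[OF l3] by blast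
  define good where "good x \<longleftrightarrow> G1 differentiable (at x) \<and> G2 differentiable (at x) \<and> G3 differentiable (at x) \<and>
     (x \<in> A \<longrightarrow> (\<forall>\<eta>>0. \<exists>r>0. \<forall>h. norm h < r \<longrightarrow> (\<exists>y\<in>A. norm (x + h - y) \<le> \<eta> * norm h)))" for x
  have "AE x in lborel. good x"
    using rademacher[OF G1(1)] rademacher[OF G2(1)] rademacher[OF G3(1)] AE_ball_dense[OF compact_imp_closed[OF A]]
    by eventually_elim (simp add: good_def)
  then obtain N where N: "{x. \<not> good x} \<subseteq> N" "N \<in> null_sets lborel" unfolding eventually_ae_filter by auto
  have "negligible N" using N(2) by (simp add: negligible_iff_null_sets null_sets_completionI)
  hence "\<not> A \<subseteq> N" using nneg negligible_subset by blast
  then obtain x where x: "x \<in> A" "good x" using N(1) by blast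
  obtain M1 M2 M3 where M: "(G1 has_derivative M1) (at x)" "(G2 has_derivative M2) (at x)" "(G3 has_derivative M3) (at x)"
    using x(2) unfolding good_def differentiable_def by blast
  have dens: "\<And>\<eta>. \<eta> > 0 \<Longrightarrow> \<exists>r>0. \<forall>h. norm h < r \<longrightarrow> (\<exists>y\<in>A. norm (x + h - y) \<le> \<eta> * norm h)"
    using x by (auto simp: good_def)
  have c0: "2 * c \<ge> 0" using c by simp
  have e1: "\<exists>r>0. \<forall>h. norm h < r \<longrightarrow> \<bar>?S f1 (x + h) - ?S f1 x - q1 x \<bullet> h - M1 h \<bullet> h / 2\<bar> \<le> \<kappa> * (norm h)\<^sup>2"
    if "\<kappa> > 0" for \<kappa>
    by (rule second_order_expansion[OF d c0 c1 x(1) G1(2) M(1) dens that])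
  have e2: "\<exists>r>0. \<forall>h. norm h < r \<longrightarrow> \<bar>?S f2 (x + h) - ?S f2 x - q2 x \<bullet> h - M2 h \<bullet> h / 2\<bar> \<le> \<kappa> * (norm h)\<^sup>2"
    if "\<kappa> > 0" for \<kappa>
    by (rule second_order_expansion[OF d c0 c2 x(1) G2(2) M(2) dens that])
  have e3: "\<exists>r>0. \<forall>h. norm h < r \<longrightarrow> \<bar>?S f3 (x + h) - ?S f3 x - q3 x \<bullet> h - M3 h \<bullet> h / 2\<bar> \<le> \<kappa> * (norm h)\<^sup>2"
    if "\<kappa> > 0" for \<kappa>
    by (rule second_order_expansion[OF d c0 c3 x(1) G3(2) M(3) dens that])
  have xK: "x \<in> K" using x AK by blast
  have yball: "y \<in> W \<and> ball y (d/2) \<subseteq> K" if "norm (x - y) < d/2" for y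
  proof -
    have "ball y (d/2) \<subseteq> ball x d"
    proof
      fix z assume "z \<in> ball y (d/2)"
      thus "z \<in> ball x d" using that norm_triangle_lt[of "x - y" "y - z" d] by (auto simp: dist_norm)
    qed
    moreover have "y \<in> ball x d" using that d by (simp add: dist_norm)
    ultimately show ?thesis using deep[OF x(1)] W(2) by blast
  qed
  note n1 = near[OF xK y1 f1 B(2)] and n2 = near[OF xK y2 f2 B(3)] and n3 = near[OF xK y3 f3 B(4)]
  have d2: "d/2 > 0" using d by simp
  have J1: "superjet f1 (y1 x) (q1 x) M1"
    by (rule superjet_of_sup_conv[OF K f1 y1 has_derivative_linear[OF M(1)] d2 conjunct2[OF yball[OF n1]] e1])
  have J2: "superjet f2 (y2 x) (q2 x) M2"
    by (rule superjet_of_sup_conv[OF K f2 y2 has_derivative_linear[OF M(2)] d2 conjunct2[OF yball[OF n2]] e2])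
  have J3: "superjet f3 (y3 x) (q3 x) M3"
    by (rule superjet_of_sup_conv[OF K f3 y3 has_derivative_linear[OF M(3)] d2 conjunct2[OF yball[OF n3]] e3])
  have Mle: "M1 h \<bullet> h + M2 h \<bullet> h + M3 h \<bullet> h \<le> 0" for h
  proof (rule ccontr)
    assume "\<not> ?thesis"
    hence gt: "M1 h \<bullet> h + M2 h \<bullet> h + M3 h \<bullet> h > 0" by simp
    define s where "s = M1 h \<bullet> h + M2 h \<bullet> h + M3 h \<bullet> h"
    have "h \<noteq> 0" using gt by auto
    \<comment> \<open>The three expansion errors, doubled, add up to
      \<open>6 * \<kappa> * (norm k)\<^sup>2\<close>, half of the supposed positive value at
      \<open>k = t *\<^sub>R h\<close>. The first-order terms cancel against the touching
      slope.\<close>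
    define \<kappa> where "\<kappa> = s / (12 * (norm h)\<^sup>2)"
    have \<kappa>: "\<kappa> > 0" using gt \<open>h \<noteq> 0\<close> by (simp add: \<kappa>_def s_def)
    obtain r1 where r1: "r1 > 0" "\<And>h. norm h < r1 \<Longrightarrow> \<bar>?S f1 (x + h) - ?S f1 x - q1 x \<bullet> h - M1 h \<bullet> h / 2\<bar> \<le> \<kappa> * (norm h)\<^sup>2"
      using e1[OF \<kappa>] by blast
    obtain r2 where r2: "r2 > 0" "\<And>h. norm h < r2 \<Longrightarrow> \<bar>?S f2 (x + h) - ?S f2 x - q2 x \<bullet> h - M2 h \<bullet> h / 2\<bar> \<le> \<kappa> * (norm h)\<^sup>2"
      using e2[OF \<kappa>] by blast
    obtain r3 where r3: "r3 > 0" "\<And>h. norm h < r3 \<Longrightarrow> \<bar>?S f3 (x + h) - ?S f3 x - q3 x \<bullet> h - M3 h \<bullet> h / 2\<bar> \<le> \<kappa> * (norm h)\<^sup>2"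
      using e3[OF \<kappa>] by blast
    define r where "r = min (min r1 r2) (min r3 d)"
    have r: "r > 0" using r1 r2 r3 d by (simp add: r_def)
    define t where "t = r / (2 * norm h)"
    have t: "t > 0" "norm (t *\<^sub>R h) < r" using r \<open>h \<noteq> 0\<close> by (auto simp: t_def)
    define k where "k = t *\<^sub>R h"
    have k: "norm k < r1" "norm k < r2" "norm k < r3" "norm k < d" using t(2) by (auto simp: r_def k_def)
    obtain p where p: "\<And>y. y \<in> K \<Longrightarrow> w y - p \<bullet> y \<le> w x - p \<bullet> x" using x(1) by (auto simp: A_def)
    have pq: "p \<bullet> k = q1 x \<bullet> k + q2 x \<bullet> k + q3 x \<bullet> k" using contact[OF x(1) p] by (metis inner_add_left)
    have "x + k \<in> K" using deep[OF x(1)] W k(4) by (auto simp: subset_eq dist_norm)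
    from p[OF this] have "?S f1 (x + k) + ?S f2 (x + k) + ?S f3 (x + k) \<le> ?S f1 x + ?S f2 x + ?S f3 x + p \<bullet> k"
      by (simp add: w_def inner_add_right)
    hence "M1 k \<bullet> k + M2 k \<bullet> k + M3 k \<bullet> k \<le> 6 * (\<kappa> * (norm k)\<^sup>2)"
      using r1(2)[OF k(1)] r2(2)[OF k(2)] r3(2)[OF k(3)] pq by linarith
    moreover have "N k \<bullet> k = t\<^sup>2 * (N h \<bullet> h)" if "linear N" for N
      by (simp add: k_def linear_scale[OF that] power2_eq_square)
    note this[OF has_derivative_linear[OF M(1)]] this[OF has_derivative_linear[OF M(2)]] this[OF has_derivative_linear[OF M(3)]]
    hence "M1 k \<bullet> k + M2 k \<bullet> k + M3 k \<bullet> k = t\<^sup>2 * s"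
      by (simp only: s_def distrib_left)
    moreover have "\<kappa> * (norm k)\<^sup>2 = t\<^sup>2 * s / 12" using \<open>h \<noteq> 0\<close> by (simp add: k_def \<kappa>_def power_mult_distrib)
    ultimately have "t\<^sup>2 * s \<le> 6 * (t\<^sup>2 * s / 12)" by simp
    moreover have "t\<^sup>2 * s > 0" using t gt by (simp add: s_def)
    ultimately show False by linarith
  qed
  have "y1 x \<in> W \<and> y2 x \<in> W \<and> y3 x \<in> W \<and> norm (q1 x + q2 x + q3 x) \<le> \<rho>0 \<and>
    (\<forall>h. M1 h \<bullet> h + M2 h \<bullet> h + M3 h \<bullet> h \<le> 0) \<and>
    superjet f1 (y1 x) (q1 x) M1 \<and> superjet f2 (y2 x) (q2 x) M2 \<and> superjet f3 (y3 x) (q3 x) M3"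
    by (intro conjI allI J1 J2 J3 Mle order_trans[OF sum_q[OF x(1)] \<rho>(2)]
       conjunct1[OF yball[OF n1]] conjunct1[OF yball[OF n2]] conjunct1[OF yball[OF n3]])
  thus ?thesis by (intro exI)
qed

section \<open>Eigenvalues, jets and parabolic comparison\<close>

text \<open>The inner supremum of \<open>eig\<close>. It sees a matrix only through its quadratic
  form, so the inequalities below hold without symmetry and apply to blocks of jets.\<close>

definition rayleigh_sup :: "real^'n^'n \<Rightarrow> (real^'n) set \<Rightarrow> real" where
  "rayleigh_sup A S = (SUP v\<in>{v\<in>S. norm v = 1}. (A *v v) \<bullet> v)"

lemma rayleigh_bounded:
  fixes A :: "real^'n^'n"
  shows "\<exists>K. \<forall>v. norm v = 1 \<longrightarrow> \<bar>(A *v v) \<bullet> v\<bar> \<le> K"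
proof -
  obtain K where K: "\<And>v. norm (A *v v) \<le> norm v * K"
    using bounded_linear.bounded[OF matrix_vector_mul_bounded_linear[of A]] by blast
  have "\<bar>(A *v v) \<bullet> v\<bar> \<le> K" if "norm v = 1" for v
    using Cauchy_Schwarz_ineq2[of "A *v v" v] K[of v] that by simp
  thus ?thesis by blast
qed

lemma rayleigh_bdd_above: "bdd_above ((\<lambda>v. (A *v v) \<bullet> v) ` {v\<in>S. norm v = 1})" for A :: "real^'n^'n"
proof -
  obtain K where "\<forall>v. norm v = 1 \<longrightarrow> \<bar>(A *v v) \<bullet> v\<bar> \<le> K" using rayleigh_bounded by blast
  thus ?thesis by (intro bdd_aboveI2[of _ _ K]) (auto simp: abs_le_iff)
qed

lemma rayleigh_sup_upper: "v \<in> S \<Longrightarrow> norm v = 1 \<Longrightarrow> (A *v v) \<bullet> v \<le> rayleigh_sup A S"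
  unfolding rayleigh_sup_def by (rule cSUP_upper[OF _ rayleigh_bdd_above]) auto

lemma unit_vector_in_subspace:
  fixes S :: "(real^'n) set"
  assumes "subspace S" "dim S \<ge> 1"
  shows "\<exists>v\<in>S. norm v = 1"
proof -
  have "S \<noteq> {0}" using assms(2) by auto
  then obtain x where x: "x \<in> S" "x \<noteq> 0" using subspace_0[OF assms(1)] by auto
  thus ?thesis using subspace_scale[OF assms(1) x(1), of "1 / norm x"] by (intro bexI[of _ "(1 / norm x) *\<^sub>R x"]) auto
qed

lemma eig_eq: "eig j A = (INF S\<in>{S. subspace S \<and> dim S = j}. rayleigh_sup A S)"
  by (simp add: eig_def rayleigh_sup_def)

text \<open>The whole space is the only subspace of full dimension, so the infimum in
  \<open>eig\<close> runs over a single term.\<close>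

lemma eig_top: "eig CARD('n) A = rayleigh_sup A UNIV" for A :: "real^'n^'n"
proof -
  have "{S :: (real^'n) set. subspace S \<and> dim S = CARD('n)} = {UNIV}"
  proof (intro set_eqI iffI)
    fix S :: "(real^'n) set" assume "S \<in> {S. subspace S \<and> dim S = CARD('n)}"
    hence "subspace S" "dim S = DIM(real^'n)" by auto
    hence "span S = UNIV" "span S = S" using dim_eq_full by (blast, simp add: span_eq_iff)
    thus "S \<in> {UNIV}" by simp
  qed (auto simp: dim_UNIV)
  thus ?thesis unfolding eig_eq by simp
qed

lemma eig_top_upper: "norm v = 1 \<Longrightarrow> (A *v v) \<bullet> v \<le> eig CARD('n) A" for A :: "real^'n^'n"
  unfolding eig_top by (rule rayleigh_sup_upper) auto

lemma eig_top_le: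
  fixes A :: "real^'n^'n"
  assumes "\<And>v. norm v = 1 \<Longrightarrow> (A *v v) \<bullet> v \<le> c"
  shows "eig CARD('n) A \<le> c"
  unfolding eig_top rayleigh_sup_def
proof (rule cSUP_least)
  show "{v :: real^'n. v \<in> UNIV \<and> norm v = 1} \<noteq> {}" using unit_vector_in_subspace[of "UNIV :: (real^'n) set"]
    by (auto simp: dim_UNIV Suc_leI)
qed (use assms in auto)

text \<open>The eigenvalue inequality that makes a subsolution for the j-th eigenvalue minus a
  supersolution for it a subsolution for the largest eigenvalue.\<close>
lemma eig_le_add_top:
  fixes A B C :: "real^'n^'n"
  assumes j: "1 \<le> j" "j \<le> CARD('n)" and le: "\<And>v. (A *v v) \<bullet> v \<le> (B *v v) \<bullet> v + (C *v v) \<bullet> v"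
  shows "eig j A \<le> eig j B + eig CARD('n) C"
proof -
  let ?J = "{S :: (real^'n) set. subspace S \<and> dim S = j}"
  have "j \<le> dim (UNIV :: (real^'n) set)" using j by (simp add: dim_UNIV)
  then obtain T :: "(real^'n) set" where "subspace T" "dim T = j"
    using choose_subspace_of_subspace by blast
  hence ne: "?J \<noteq> {}" by blast
  have "eig j A - eig CARD('n) C \<le> eig j B" unfolding eig_eq[of j B]
  proof (rule cINF_greatest[OF ne])
    fix S assume S: "S \<in> ?J"
    hence "\<exists>v\<in>S. norm v = 1" using j by (intro unit_vector_in_subspace) auto
    hence ne': "{v\<in>S. norm v = 1} \<noteq> {}" by blast
    obtain K where K: "\<forall>v. norm v = 1 \<longrightarrow> \<bar>(A *v v) \<bullet> v\<bar> \<le> K" using rayleigh_bounded by blast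
    have "bdd_below (rayleigh_sup A ` ?J)"
    proof (rule bdd_belowI2)
      fix S assume "S \<in> ?J"
      then obtain v where v: "v \<in> S" "norm v = 1" using j unit_vector_in_subspace[of S] by auto
      show "- K \<le> rayleigh_sup A S" using rayleigh_sup_upper[OF v, of A] K v(2) by (force simp: abs_le_iff)
    qed
    hence "eig j A \<le> rayleigh_sup A S" unfolding eig_eq by (rule cINF_lower[OF _ S])
    also have "\<dots> \<le> rayleigh_sup B S + eig CARD('n) C"
      unfolding rayleigh_sup_def[of A]
    proof (rule cSUP_least[OF ne'])
      fix v assume v: "v \<in> {v\<in>S. norm v = 1}"
      have "(B *v v) \<bullet> v \<le> rayleigh_sup B S" "(C *v v) \<bullet> v \<le> eig CARD('n) C"
        using v by (auto intro: rayleigh_sup_upper eig_top_upper)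
      thus "(A *v v) \<bullet> v \<le> rayleigh_sup B S + eig CARD('n) C" using le[of v] by linarith
    qed
    finally show "eig j A - eig CARD('n) C \<le> rayleigh_sup B S" by simp
  qed
  thus ?thesis by simp
qed

lemma eig_le_add:
  fixes A B :: "real^'n^'n"
  assumes j: "1 \<le> j" "j \<le> CARD('n)" and le: "\<And>v. (A *v v) \<bullet> v \<le> (B *v v) \<bullet> v + c * (norm v)\<^sup>2"
  shows "eig j A \<le> eig j B + c"
proof -
  have q: "((c *\<^sub>R mat 1) *v v) \<bullet> v = c * (norm v)\<^sup>2" for v :: "real^'n"
    by (simp add: scaleR_matrix_vector_assoc[symmetric] dot_square_norm)
  have "eig j A \<le> eig j B + eig CARD('n) (c *\<^sub>R mat 1 :: real^'n^'n)"
    by (rule eig_le_add_top[OF j]) (use le q in simp)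
  also have "eig CARD('n) (c *\<^sub>R mat 1 :: real^'n^'n) \<le> c"
    by (rule eig_top_le) (simp add: q)
  finally show ?thesis by simp
qed

lemma matrix_uminus_mult: "(- A) *v v = - (A *v v)" for A :: "real^'n^'m"
  by (simp add: matrix_vector_mult_def vec_eq_iff sum_negf)

section \<open>Jets as test functions\<close>

lemma pvisc_subD:
  assumes "pvisc_sub F W u" "p0 \<in> W" "open U" "p0 \<in> U" "U \<subseteq> W" "C21_on U \<phi> Dt Dx Dxx"
    "\<And>q. q \<in> U \<Longrightarrow> u q - \<phi> q \<le> u p0 - \<phi> p0"
  shows "Dt p0 + F p0 (u p0) (Dx p0) (Dxx p0) \<le> 0"
proof -
  have "\<forall>p0\<in>W. \<forall>U phi Dt Dx Dxx. open U \<and> p0 \<in> U \<and> U \<subseteq> W \<and> C21_on U phi Dt Dx Dxx \<and>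
        (\<forall>q\<in>U. u q - phi q \<le> u p0 - phi p0) \<longrightarrow> Dt p0 + F p0 (u p0) (Dx p0) (Dxx p0) \<le> 0"
    using assms(1) by (simp add: pvisc_sub_def)
  from this[rule_format, OF assms(2), of U \<phi> Dt Dx Dxx] show ?thesis using assms(3-) by simp
qed

lemma pvisc_superD:
  assumes "pvisc_super F W u" "p0 \<in> W" "open U" "p0 \<in> U" "U \<subseteq> W" "C21_on U \<phi> Dt Dx Dxx"
    "\<And>q. q \<in> U \<Longrightarrow> u p0 - \<phi> p0 \<le> u q - \<phi> q"
  shows "Dt p0 + F p0 (u p0) (Dx p0) (Dxx p0) \<ge> 0"
proof -
  have "\<forall>p0\<in>W. \<forall>U phi Dt Dx Dxx. open U \<and> p0 \<in> U \<and> U \<subseteq> W \<and> C21_on U phi Dt Dx Dxx \<and>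
        (\<forall>q\<in>U. u q - phi q \<ge> u p0 - phi p0) \<longrightarrow> Dt p0 + F p0 (u p0) (Dx p0) (Dxx p0) \<ge> 0"
    using assms(1) by (simp add: pvisc_super_def)
  from this[rule_format, OF assms(2), of U \<phi> Dt Dx Dxx] show ?thesis using assms(3-) by simp
qed

text \<open>The spatial block of a space-time Hessian; mixed and pure time second derivatives do not
  enter the equations.\<close>

definition space_block :: "((real^'n) \<times> real \<Rightarrow> (real^'n) \<times> real) \<Rightarrow> real^'n^'n" where
  "space_block H = matrix (\<lambda>v. fst (H (v, 0)))"

lemma space_block_mult:
  fixes H :: "(real^'n) \<times> real \<Rightarrow> (real^'n) \<times> real"
  assumes "linear H"
  shows "space_block H *v v = fst (H (v, 0))"
proof -
  interpret H: linear H by fact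
  have "linear (\<lambda>v. fst (H (v, 0)))"
  proof (rule linearI)
    fix x y :: "real^'n" and c :: real
    show "fst (H (x + y, 0)) = fst (H (x, 0)) + fst (H (y, 0))"
      using H.add[of "(x, 0)" "(y, 0)"] by simp
    show "fst (H (c *\<^sub>R x, 0)) = c *\<^sub>R fst (H (x, 0))"
      using H.scale[of c "(x, 0)"] by simp
  qed
  thus ?thesis by (simp add: space_block_def matrix_works)
qed

lemma space_block_form: "linear H \<Longrightarrow> (space_block H *v v) \<bullet> v = H (v, 0) \<bullet> (v, 0)"
  by (simp add: space_block_mult inner_prod_def)

lemma C21_on_quadratic:
  fixes H :: "(real^'n) \<times> real \<Rightarrow> (real^'n) \<times> real"
  assumes H: "linear H" and sym: "\<And>h k. H h \<bullet> k = h \<bullet> H k"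
  shows "C21_on U (\<lambda>z. q \<bullet> (z - y) + H (z - y) \<bullet> (z - y) / 2)
    (\<lambda>z. snd (q + H (z - y))) (\<lambda>z. fst (q + H (z - y))) (\<lambda>_. space_block H)"
proof -
  have bl: "bounded_linear H" using H by (simp add: linear_conv_bounded_linear)
  note dH = bounded_linear.has_derivative[OF bl]
  have cH: "continuous_on A H" for A using bl by (rule linear_continuous_on)
  let ?\<phi> = "\<lambda>z. q \<bullet> (z - y) + H (z - y) \<bullet> (z - y) / 2"
  have D: "(?\<phi> has_derivative (\<lambda>k. (q + H (z - y)) \<bullet> k)) (at z)" for z
  proof -
    have "(?\<phi> has_derivative (\<lambda>k. q \<bullet> k + (H (z - y) \<bullet> k + H k \<bullet> (z - y)) / 2)) (at z)"
      by (auto intro!: derivative_eq_intros dH simp: inner_commute)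
    moreover have "H k \<bullet> (z - y) = H (z - y) \<bullet> k" for k using sym[of k "z - y"] by (simp add: inner_commute)
    ultimately show ?thesis by (simp add: inner_add_left)
  qed
  have 1: "((\<lambda>x. ?\<phi> (x, s)) has_derivative (\<lambda>h. fst (q + H ((x, s) - y)) \<bullet> h)) (at x)" for x s
  proof -
    have "((\<lambda>x. (x, s)) has_derivative (\<lambda>h. (h, 0))) (at x)" by (auto intro!: derivative_eq_intros)
    from has_derivative_compose[OF this D] show ?thesis by (simp add: inner_prod_def)
  qed
  have 2: "((\<lambda>t. ?\<phi> (x, t)) has_real_derivative snd (q + H ((x, s) - y))) (at s)" for x s
  proof -
    have "((\<lambda>t. (x, t)) has_derivative (\<lambda>h. (0, h))) (at s)" by (auto intro!: derivative_eq_intros)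
    from has_derivative_compose[OF this D] show ?thesis
      by (simp add: inner_prod_def has_field_derivative_def)
  qed
  have 3: "((\<lambda>x. fst (q + H ((x, s) - y))) has_derivative (\<lambda>h. space_block H *v h)) (at x)" for x s
  proof -
    have "((\<lambda>x. (x, s) - y) has_derivative (\<lambda>h. (h, 0))) (at x)" by (auto intro!: derivative_eq_intros simp: zero_prod_def)
    from dH[OF this] have "((\<lambda>x. q + H ((x, s) - y)) has_derivative (\<lambda>h. H (h, 0))) (at x)"
      by (auto intro!: derivative_eq_intros)
    from has_derivative_fst[OF this] show ?thesis by (simp add: space_block_mult[OF H])
  qed
  show ?thesis unfolding C21_on_def
    using 1 2 3 by (auto intro!: continuous_intros continuous_on_compose2[OF cH[of UNIV]])
qed

text \<open>Test functions have symmetric Hessians, while the linear map of a superjet need not be symmetric;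
  the shift absorbs the quadratic error of the jet.\<close>
definition sym_shift :: "real \<Rightarrow> ('a::euclidean_space \<Rightarrow> 'a) \<Rightarrow> 'a \<Rightarrow> 'a" where
  "sym_shift \<kappa> M h = (M h + adjoint M h) /\<^sub>R 2 + (2 * \<kappa>) *\<^sub>R h"

lemma sym_shift:
  fixes M :: "'a::euclidean_space \<Rightarrow> 'a"
  assumes "linear M"
  shows "linear (sym_shift \<kappa> M)" "sym_shift \<kappa> M h \<bullet> k = h \<bullet> sym_shift \<kappa> M k"
    "sym_shift \<kappa> M h \<bullet> h = M h \<bullet> h + 2 * \<kappa> * (norm h)\<^sup>2"
proof -
  have lin: "linear (adjoint M)" using assms by (rule adjoint_linear)
  show "linear (sym_shift \<kappa> M)"
  proof (rule linearI)
    show "sym_shift \<kappa> M (x + y) = sym_shift \<kappa> M x + sym_shift \<kappa> M y" for x y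
      by (simp add: sym_shift_def linear_add[OF assms] linear_add[OF lin] scaleR_add_right algebra_simps)
    show "sym_shift \<kappa> M (r *\<^sub>R x) = r *\<^sub>R sym_shift \<kappa> M x" for r x
      by (simp add: sym_shift_def linear_scale[OF assms] linear_scale[OF lin] scaleR_add_right mult.commute)
  qed
  show "sym_shift \<kappa> M h \<bullet> k = h \<bullet> sym_shift \<kappa> M k"
    by (simp add: sym_shift_def inner_add_left inner_add_right adjoint_works[OF assms] adjoint_clauses[OF assms] add.commute)
  show "sym_shift \<kappa> M h \<bullet> h = M h \<bullet> h + 2 * \<kappa> * (norm h)\<^sup>2"
    by (simp add: sym_shift_def inner_add_left adjoint_clauses[OF assms] inner_commute[of h "M h"] dot_square_norm)
qed

lemma superjet_touching:
  assumes "superjet f y q M" "\<kappa> > 0"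
  obtains r where "r > 0" "\<And>z. z \<in> ball y r \<Longrightarrow>
    f z - (q \<bullet> (z - y) + sym_shift \<kappa> M (z - y) \<bullet> (z - y) / 2) \<le> f y"
proof -
  have lin: "linear M" using assms by (simp add: superjet_def)
  obtain r where r: "r > 0" "\<And>h. norm h < r \<Longrightarrow> f (y + h) \<le> f y + q \<bullet> h + M h \<bullet> h / 2 + \<kappa> * (norm h)\<^sup>2"
    using assms unfolding superjet_def by blast
  show ?thesis
  proof (rule that[OF r(1)])
    fix z assume "z \<in> ball y r"
    hence "norm (z - y) < r" by (simp add: dist_norm norm_minus_commute)
    from r(2)[OF this] show "f z - (q \<bullet> (z - y) + sym_shift \<kappa> M (z - y) \<bullet> (z - y) / 2) \<le> f y"
      by (simp add: sym_shift(3)[OF lin] add_divide_distrib)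
  qed
qed

text \<open>The jet becomes a genuine quadratic test function after symmetrizing \<open>M\<close>
  and adding a multiple of the identity. This raises the eigenvalue by at most
  \<open>2 * \<kappa>\<close>, and \<open>\<kappa>\<close> is arbitrary.\<close>

lemma pvisc_sub_superjet:
  fixes a :: "(real^'n) \<times> real \<Rightarrow> real"
  assumes sub: "pvisc_sub (\<lambda>q r p X. - eig j X + \<eta>) W a" and W: "open W" and y: "y \<in> W"
    and jet: "superjet a y q M" and j: "1 \<le> j" "j \<le> CARD('n)"
  shows "snd q + \<eta> \<le> eig j (space_block M)"
proof (rule field_le_epsilon)
  fix e :: real assume "e > 0"
  define \<kappa> where "\<kappa> = e / 2"
  have \<kappa>: "\<kappa> > 0" "2 * \<kappa> = e" using \<open>e > 0\<close> by (simp_all add: \<kappa>_def)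
  have lin: "linear M" using jet by (simp add: superjet_def)
  let ?H = "sym_shift \<kappa> M"
  obtain r where r: "r > 0" "\<And>z. z \<in> ball y r \<Longrightarrow> a z - (q \<bullet> (z - y) + ?H (z - y) \<bullet> (z - y) / 2) \<le> a y"
    using superjet_touching[OF jet \<kappa>(1)] by blast
  have H0: "?H 0 = 0" using linear_0[OF sym_shift(1)[OF lin]] .
  let ?U = "ball y r \<inter> W"
  have c21: "C21_on ?U (\<lambda>z. q \<bullet> (z - y) + ?H (z - y) \<bullet> (z - y) / 2)
    (\<lambda>z. snd (q + ?H (z - y))) (\<lambda>z. fst (q + ?H (z - y))) (\<lambda>_. space_block ?H)"
    by (rule C21_on_quadratic[OF sym_shift(1,2)[OF lin]])
  have "snd (q + ?H (y - y)) + (- eig j (space_block ?H) + \<eta>) \<le> 0"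
  proof (rule pvisc_subD[OF sub y _ _ _ c21])
    show "open ?U" "y \<in> ?U" "?U \<subseteq> W" using W y r by auto
    fix z assume "z \<in> ?U"
    thus "a z - (q \<bullet> (z - y) + ?H (z - y) \<bullet> (z - y) / 2) \<le> a y - (q \<bullet> (y - y) + ?H (y - y) \<bullet> (y - y) / 2)"
      using r(2)[of z] by simp
  qed
  moreover have "eig j (space_block ?H) \<le> eig j (space_block M) + 2 * \<kappa>"
    by (rule eig_le_add[OF j]) (simp add: space_block_form[OF sym_shift(1)[OF lin]] space_block_form[OF lin] sym_shift(3)[OF lin])
  ultimately show "snd q + \<eta> \<le> eig j (space_block M) + e" using H0 \<kappa>(2) by simp
qed

text \<open>A superjet of \<open>- b\<close>, negated, touches \<open>b\<close> from below. The
  eigenvalue of the negated block is kept as it stands, since this is the form in which the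
  eigenvalue inequality is applied later.\<close>

lemma pvisc_super_superjet:
  fixes b :: "(real^'n) \<times> real \<Rightarrow> real"
  assumes super: "pvisc_super (\<lambda>q r p X. - eig j X) W b" and W: "open W" and y: "y \<in> W"
    and jet: "superjet (\<lambda>z. - b z) y q M" and j: "1 \<le> j" "j \<le> CARD('n)"
  shows "snd q + eig j (- space_block M) \<le> 0"
proof (rule field_le_epsilon)
  fix e :: real assume "e > 0"
  define \<kappa> where "\<kappa> = e / 2"
  have \<kappa>: "\<kappa> > 0" "2 * \<kappa> = e" using \<open>e > 0\<close> by (simp_all add: \<kappa>_def)
  have lin: "linear M" using jet by (simp add: superjet_def)
  let ?H = "sym_shift \<kappa> M"
  obtain r where r: "r > 0" "\<And>z. z \<in> ball y r \<Longrightarrow> - b z - (q \<bullet> (z - y) + ?H (z - y) \<bullet> (z - y) / 2) \<le> - b y"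
    using superjet_touching[OF jet \<kappa>(1)] by blast
  have linH: "linear ?H" by (rule sym_shift(1)[OF lin])
  have H0: "?H 0 = 0" using linear_0[OF linH] .
  have linN: "linear (\<lambda>h. - ?H h)" using linH by (rule linear_compose_neg)
  let ?U = "ball y r \<inter> W"
  have c21: "C21_on ?U (\<lambda>z. (- q) \<bullet> (z - y) + (- ?H (z - y)) \<bullet> (z - y) / 2)
    (\<lambda>z. snd (- q + - ?H (z - y))) (\<lambda>z. fst (- q + - ?H (z - y))) (\<lambda>_. space_block (\<lambda>h. - ?H h))"
    by (rule C21_on_quadratic[OF linN]) (simp add: sym_shift(2)[OF lin])
  have "snd (- q + - ?H (y - y)) + - eig j (space_block (\<lambda>h. - ?H h)) \<ge> 0"
  proof (rule pvisc_superD[OF super y _ _ _ c21])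
    show "open ?U" "y \<in> ?U" "?U \<subseteq> W" using W y r by auto
    fix z assume "z \<in> ?U"
    thus "b z - ((- q) \<bullet> (z - y) + (- ?H (z - y)) \<bullet> (z - y) / 2)
        \<ge> b y - ((- q) \<bullet> (y - y) + (- ?H (y - y)) \<bullet> (y - y) / 2)"
      using r(2)[of z] by simp
  qed
  moreover have "eig j (- space_block M) \<le> eig j (space_block (\<lambda>h. - ?H h)) + 2 * \<kappa>"
    by (rule eig_le_add[OF j]) (simp add: space_block_form[OF linN] space_block_form[OF lin] sym_shift(3)[OF lin] matrix_uminus_mult)
  ultimately show "snd q + eig j (- space_block M) \<le> 0 + e" using H0 \<kappa>(2) by simp
qed

text \<open>A positive maximum of the difference yields three jets whose time slopes would add up to
  at most \<open>- \<eta>\<close>, although their sum has norm at most \<open>\<eta>/2\<close>. The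
  boundary includes the final time, so any use must provide an ordering there too.\<close>

theorem parabolic_comparison:
  fixes a b c :: "(real^'n) \<times> real \<Rightarrow> real"
  assumes K: "compact K" and W: "open W" "W \<subseteq> K"
    and cont: "continuous_on K a" "continuous_on K b" "continuous_on K c"
    and a: "pvisc_sub (\<lambda>q r p X. - eig j X + \<eta>) W a" and \<eta>: "\<eta> > 0"
    and b: "pvisc_super (\<lambda>q r p X. - eig j X) W b"
    and c: "pvisc_super (\<lambda>q r p X. - eig CARD('n) X) W c"
    and j: "1 \<le> j" "j \<le> CARD('n)"
    and bd: "\<And>p. p \<in> K - W \<Longrightarrow> a p \<le> b p + c p" and p: "p \<in> W"
  shows "a p \<le> b p + c p"
proof (rule ccontr)
  assume "\<not> a p \<le> b p + c p"
  hence pos: "a p + - b p + - c p > 0" by simp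
  have cb: "continuous_on K (\<lambda>x. - b x)" and cc: "continuous_on K (\<lambda>x. - c x)"
    using cont by (auto intro: continuous_intros)
  have bd': "a x + - b x + - c x \<le> 0" if "x \<in> K - W" for x using bd[OF that] by simp
  have \<eta>2: "\<eta>/2 > 0" using \<eta> by simp
  obtain y1 y2 y3 q1 q2 q3 M1 M2 M3 where y: "y1 \<in> W" "y2 \<in> W" "y3 \<in> W" and q: "norm (q1 + q2 + q3) \<le> \<eta>/2"
    and M: "\<And>h. M1 h \<bullet> h + M2 h \<bullet> h + M3 h \<bullet> h \<le> 0"
    and jets: "superjet a y1 q1 M1" "superjet (\<lambda>x. - b x) y2 q2 M2" "superjet (\<lambda>x. - c x) y3 q3 M3"
    using theorem_on_sums[OF K W cont(1) cb cc p pos bd' \<eta>2] by blast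
  have N: "1 \<le> CARD('n)" by (simp add: Suc_leI)
  have lin: "linear M1" "linear M2" "linear M3" using jets by (auto simp: superjet_def)
  have "snd q1 + \<eta> \<le> eig j (space_block M1)" by (rule pvisc_sub_superjet[OF a W(1) y(1) jets(1) j])
  also have "\<dots> \<le> eig j (- space_block M2) + eig CARD('n) (- space_block M3)"
  proof (rule eig_le_add_top[OF j])
    fix v :: "real^'n"
    show "(space_block M1 *v v) \<bullet> v \<le> (- space_block M2 *v v) \<bullet> v + (- space_block M3 *v v) \<bullet> v"
      \<comment> \<open>Purely spatial directions turn the joint space-time inequality into one
        between spatial blocks.\<close>
      using M[of "(v, 0)"] by (simp add: matrix_uminus_mult space_block_form lin)
  qed
  also have "\<dots> \<le> - snd q2 - snd q3"
    using pvisc_super_superjet[OF b W(1) y(2) jets(2) j] pvisc_super_superjet[OF c W(1) y(3) jets(3) N order_refl]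
    by simp
  finally have "snd (q1 + q2 + q3) \<le> - \<eta>" by simp
  moreover have "\<bar>snd (q1 + q2 + q3)\<bar> \<le> \<eta>/2"
    using norm_snd_le[of "snd (q1 + q2 + q3)" "fst (q1 + q2 + q3)"] q by (simp only: prod.collapse real_norm_def)
  ultimately show False using \<eta> by linarith
qed

section \<open>Exponential decay\<close>

text \<open>If \<open>\<phi>\<close> touches \<open>u - P\<close> from above, then
  \<open>\<phi> + P\<close> touches \<open>u\<close>; only the time derivative changes, by at least
  \<open>\<eta>\<close>.\<close>

lemma pvisc_sub_minus_time:
  fixes u :: "(real^'n) \<times> real \<Rightarrow> real"
  assumes u: "pvisc_sub (\<lambda>q r p X. - eig j X) W u" and W: "W' \<subseteq> W"
    and P: "\<And>t. (P has_real_derivative P' t) (at t)" "continuous_on UNIV P'"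
    and \<eta>: "\<And>p. p \<in> W' \<Longrightarrow> \<eta> \<le> P' (snd p)"
  shows "pvisc_sub (\<lambda>q r p X. - eig j X + \<eta>) W' (\<lambda>p. u p - P (snd p))"
  unfolding pvisc_sub_def
proof (intro conjI ballI allI impI)
  have cP: "continuous_on A P" for A
    using P(1) by (meson DERIV_isCont continuous_at_imp_continuous_on)
  show "continuous_on W' (\<lambda>p. u p - P (snd p))"
    using u W by (auto simp: pvisc_sub_def intro!: continuous_intros continuous_on_compose2[OF cP[of UNIV]] intro: continuous_on_subset)
  fix p0 U \<phi> Dt Dx Dxx
  assume p0: "p0 \<in> W'" and A: "open U \<and> p0 \<in> U \<and> U \<subseteq> W' \<and> C21_on U \<phi> Dt Dx Dxx \<and>
    (\<forall>q\<in>U. u q - P (snd q) - \<phi> q \<le> u p0 - P (snd p0) - \<phi> p0)"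
  have "C21_on U (\<lambda>p. \<phi> p + P (snd p)) (\<lambda>p. Dt p + P' (snd p)) Dx Dxx"
    using A unfolding C21_on_def
    by (auto intro!: continuous_intros derivative_eq_intros P continuous_on_compose2[OF P(2)] has_derivative_add_const)
  from pvisc_subD[OF u _ _ _ _ this, of p0] p0 W A
  have "Dt p0 + P' (snd p0) + - eig j (Dxx p0) \<le> 0" by force
  thus "Dt p0 + (- eig j (Dxx p0) + \<eta>) \<le> 0" using \<eta>[OF p0] by simp
qed

text \<open>On the time line through the contact point the difference of two differentiable
  functions has a local extremum. This fixes the time derivative of a test function for products of
  a time factor and a possibly nonsmooth space factor.\<close>

lemma C21_on_time_stationary:
  fixes \<phi> :: "(real^'n) \<times> real \<Rightarrow> real"
  assumes C: "C21_on U \<phi> Dt Dx Dxx" and U: "open U" "(x0, t0) \<in> U"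
    and f: "(f has_real_derivative l) (at t0)"
    and ext: "(\<forall>t. (x0, t) \<in> U \<longrightarrow> f t - \<phi> (x0, t) \<le> f t0 - \<phi> (x0, t0)) \<or>
              (\<forall>t. (x0, t) \<in> U \<longrightarrow> f t - \<phi> (x0, t) \<ge> f t0 - \<phi> (x0, t0))"
  shows "Dt (x0, t0) = l"
proof -
  obtain e where e: "e > 0" "ball (x0, t0) e \<subseteq> U" using U openE by blast
  have inU: "(x0, t) \<in> U" if "\<bar>t0 - t\<bar> < e" for t
    using e(2) that by (auto simp: subset_eq dist_Pair_Pair dist_real_def)
  have "((\<lambda>t. \<phi> (x0, t)) has_real_derivative Dt (x0, t0)) (at t0)"
    using C U(2) by (auto simp: C21_on_def)
  hence D: "((\<lambda>t. f t - \<phi> (x0, t)) has_real_derivative l - Dt (x0, t0)) (at t0)"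
    by (intro derivative_intros f)
  from ext have "l - Dt (x0, t0) = 0"
  proof
    assume "\<forall>t. (x0, t) \<in> U \<longrightarrow> f t - \<phi> (x0, t) \<le> f t0 - \<phi> (x0, t0)"
    thus ?thesis using inU by (intro DERIV_local_max[OF D e(1)]) auto
  next
    assume "\<forall>t. (x0, t) \<in> U \<longrightarrow> f t - \<phi> (x0, t) \<ge> f t0 - \<phi> (x0, t0)"
    thus ?thesis using inU by (intro DERIV_local_min[OF D e(1)]) auto
  qed
  thus ?thesis by simp
qed

text \<open>The factor \<open>k\<close> serves to divide a test function by the time factor of a
  separated function; stationary functions take \<open>k = 1\<close>.\<close>

lemma C2_on_time_slice:
  fixes \<phi> :: "(real^'n) \<times> real \<Rightarrow> real"
  assumes C: "C21_on U \<phi> Dt Dx Dxx"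
  shows "C2_on {x. (x, t) \<in> U} (\<lambda>x. k * \<phi> (x, t)) (\<lambda>x. k *\<^sub>R Dx (x, t)) (\<lambda>x. k *\<^sub>R Dxx (x, t))"
  unfolding C2_on_def
proof (intro conjI ballI)
  fix y assume "y \<in> {x. (x, t) \<in> U}"
  hence y: "(y, t) \<in> U" by simp
  have 1: "((\<lambda>x. \<phi> (x, t)) has_derivative (\<lambda>h. Dx (y, t) \<bullet> h)) (at y)"
    and 2: "((\<lambda>x. Dx (x, t)) has_derivative (\<lambda>h. Dxx (y, t) *v h)) (at y)"
    using C y by (auto simp: C21_on_def)
  show "((\<lambda>x. k * \<phi> (x, t)) has_derivative (\<lambda>h. k *\<^sub>R Dx (y, t) \<bullet> h)) (at y)"
    using has_derivative_mult_right[OF 1, of k] by simp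
  show "((\<lambda>x. k *\<^sub>R Dx (x, t)) has_derivative (\<lambda>h. k *\<^sub>R Dxx (y, t) *v h)) (at y)"
    using has_derivative_scaleR_right[OF 2, of k] by (simp add: scaleR_matrix_vector_assoc)
next
  have "continuous_on U Dxx" using C by (simp add: C21_on_def)
  moreover have "continuous_on {x. (x, t) \<in> U} (\<lambda>x. (x, t))" by (intro continuous_intros)
  ultimately have "continuous_on {x. (x, t) \<in> U} (\<lambda>x. Dxx (x, t))"
    by (rule continuous_on_compose2) auto
  thus "continuous_on {x. (x, t) \<in> U} (\<lambda>x. k *\<^sub>R Dxx (x, t))" by (intro continuous_intros)
qed

lemma open_time_slice: "open U \<Longrightarrow> open {x. (x, t) \<in> U}"
  for U :: "('a::topological_space \<times> 'b::topological_space) set"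
  using open_vimage[of U "\<lambda>x. (x, t)"] by (simp add: vimage_def continuous_on_Pair)

lemma pvisc_sub_stationary:
  fixes z :: "real^'n \<Rightarrow> real"
  assumes z: "visc_sub (\<lambda>x r p X. - eig j X) \<Omega> z"
  shows "pvisc_sub (\<lambda>q r p X. - eig j X) (\<Omega> \<times> {0<..}) (\<lambda>p. z (fst p))"
  unfolding pvisc_sub_def
proof (intro conjI ballI allI impI)
  show "continuous_on (\<Omega> \<times> {0<..}) (\<lambda>p. z (fst p))"
    using z by (auto simp: visc_sub_def intro!: continuous_on_compose2[of \<Omega> z] continuous_intros)
  fix p0 U \<phi> Dt Dx Dxx
  assume p0: "p0 \<in> \<Omega> \<times> {0<..}" and A: "open U \<and> p0 \<in> U \<and> U \<subseteq> \<Omega> \<times> {0<..} \<and> C21_on U \<phi> Dt Dx Dxx \<and>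
    (\<forall>q\<in>U. z (fst q) - \<phi> q \<le> z (fst p0) - \<phi> p0)"
  obtain x0 t0 where [simp]: "p0 = (x0, t0)" by (cases p0)
  have "Dt (x0, t0) = 0"
    by (rule C21_on_time_stationary[of U \<phi> Dt Dx Dxx x0 t0 "\<lambda>_. z x0" 0]) (use A in \<open>auto intro!: derivative_eq_intros\<close>)
  moreover have "- eig j (1 *\<^sub>R Dxx (x0, t0)) \<le> 0"
  proof (rule z[unfolded visc_sub_def, THEN conjunct2, rule_format, of x0 "{x. (x, t0) \<in> U}" "\<lambda>x. 1 * \<phi> (x, t0)" "\<lambda>x. 1 *\<^sub>R Dx (x, t0)" "\<lambda>x. 1 *\<^sub>R Dxx (x, t0)"])
    show "x0 \<in> \<Omega>" using p0 by simp
    have "z y - \<phi> (y, t0) \<le> z x0 - \<phi> (x0, t0)" if "(y, t0) \<in> U" for y using A that by force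
    thus "open {x. (x, t0) \<in> U} \<and> x0 \<in> {x. (x, t0) \<in> U} \<and> {x. (x, t0) \<in> U} \<subseteq> \<Omega> \<and>
      C2_on {x. (x, t0) \<in> U} (\<lambda>x. 1 * \<phi> (x, t0)) (\<lambda>x. 1 *\<^sub>R Dx (x, t0)) (\<lambda>x. 1 *\<^sub>R Dxx (x, t0)) \<and>
      (\<forall>y\<in>{x. (x, t0) \<in> U}. z y - 1 * \<phi> (y, t0) \<le> z x0 - 1 * \<phi> (x0, t0))"
      using A by (intro conjI C2_on_time_slice open_time_slice) auto
  qed
  ultimately show "Dt p0 + - eig j (Dxx p0) \<le> 0" by simp
qed

lemma pvisc_super_stationary:
  fixes z :: "real^'n \<Rightarrow> real"
  assumes z: "visc_super (\<lambda>x r p X. - eig j X) \<Omega> z"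
  shows "pvisc_super (\<lambda>q r p X. - eig j X) (\<Omega> \<times> {0<..}) (\<lambda>p. z (fst p))"
  unfolding pvisc_super_def
proof (intro conjI ballI allI impI)
  show "continuous_on (\<Omega> \<times> {0<..}) (\<lambda>p. z (fst p))"
    using z by (auto simp: visc_super_def intro!: continuous_on_compose2[of \<Omega> z] continuous_intros)
  fix p0 U \<phi> Dt Dx Dxx
  assume p0: "p0 \<in> \<Omega> \<times> {0<..}" and A: "open U \<and> p0 \<in> U \<and> U \<subseteq> \<Omega> \<times> {0<..} \<and> C21_on U \<phi> Dt Dx Dxx \<and>
    (\<forall>q\<in>U. z (fst q) - \<phi> q \<ge> z (fst p0) - \<phi> p0)"
  obtain x0 t0 where [simp]: "p0 = (x0, t0)" by (cases p0)
  have "Dt (x0, t0) = 0"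
    by (rule C21_on_time_stationary[of U \<phi> Dt Dx Dxx x0 t0 "\<lambda>_. z x0" 0]) (use A in \<open>auto intro!: derivative_eq_intros\<close>)
  moreover have "- eig j (1 *\<^sub>R Dxx (x0, t0)) \<ge> 0"
  proof (rule z[unfolded visc_super_def, THEN conjunct2, rule_format, of x0 "{x. (x, t0) \<in> U}" "\<lambda>x. 1 * \<phi> (x, t0)" "\<lambda>x. 1 *\<^sub>R Dx (x, t0)" "\<lambda>x. 1 *\<^sub>R Dxx (x, t0)"])
    show "x0 \<in> \<Omega>" using p0 by simp
    have "z y - \<phi> (y, t0) \<ge> z x0 - \<phi> (x0, t0)" if "(y, t0) \<in> U" for y using A that by force
    thus "open {x. (x, t0) \<in> U} \<and> x0 \<in> {x. (x, t0) \<in> U} \<and> {x. (x, t0) \<in> U} \<subseteq> \<Omega> \<and>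
      C2_on {x. (x, t0) \<in> U} (\<lambda>x. 1 * \<phi> (x, t0)) (\<lambda>x. 1 *\<^sub>R Dx (x, t0)) (\<lambda>x. 1 *\<^sub>R Dxx (x, t0)) \<and>
      (\<forall>y\<in>{x. (x, t0) \<in> U}. z y - 1 * \<phi> (y, t0) \<ge> z x0 - 1 * \<phi> (x0, t0))"
      using A by (intro conjI C2_on_time_slice open_time_slice) auto
  qed
  ultimately show "Dt p0 + - eig j (Dxx p0) \<ge> 0" by simp
qed

text \<open>With \<open>k = C * exp (- \<mu> * t0)\<close>, the time line gives a test function the
  time derivative \<open>- \<mu> * k * \<psi> x0\<close>, while its slice divided by
  \<open>k\<close> touches \<open>\<psi>\<close> from below. The zero-order term of the eigenvalue
  inequality then cancels the time derivative.\<close>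

lemma pvisc_super_decaying:
  fixes \<psi> :: "real^'n \<Rightarrow> real"
  assumes \<psi>: "visc_super (\<lambda>x r p X. - eig CARD('n) X - \<mu> * r) \<Omega>R \<psi>" and sub: "\<Omega> \<subseteq> \<Omega>R" and C: "C > 0"
  shows "pvisc_super (\<lambda>q r p X. - eig CARD('n) X) (\<Omega> \<times> {0<..}) (\<lambda>p. C * exp (- \<mu> * snd p) * \<psi> (fst p))"
  unfolding pvisc_super_def
proof (intro conjI ballI allI impI)
  have "continuous_on \<Omega>R \<psi>" using \<psi> by (simp add: visc_super_def)
  hence "continuous_on \<Omega> \<psi>" using sub by (rule continuous_on_subset)
  hence "continuous_on (\<Omega> \<times> {0<..}) (\<lambda>p. \<psi> (fst p))"
    by (rule continuous_on_compose2) (auto intro: continuous_intros)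
  thus "continuous_on (\<Omega> \<times> {0<..}) (\<lambda>p. C * exp (- \<mu> * snd p) * \<psi> (fst p))"
    by (intro continuous_intros)
  fix p0 U \<phi> Dt Dx Dxx
  assume p0: "p0 \<in> \<Omega> \<times> {0<..}" and A: "open U \<and> p0 \<in> U \<and> U \<subseteq> \<Omega> \<times> {0<..} \<and> C21_on U \<phi> Dt Dx Dxx \<and>
    (\<forall>q\<in>U. C * exp (- \<mu> * snd q) * \<psi> (fst q) - \<phi> q \<ge> C * exp (- \<mu> * snd p0) * \<psi> (fst p0) - \<phi> p0)"
  obtain x0 t0 where [simp]: "p0 = (x0, t0)" by (cases p0)
  define k where "k = C * exp (- \<mu> * t0)"
  have k: "k > 0" using C by (simp add: k_def)
  have "Dt (x0, t0) = - \<mu> * (k * \<psi> x0)"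
    by (rule C21_on_time_stationary[of U \<phi> Dt Dx Dxx x0 t0 "\<lambda>t. C * exp (- \<mu> * t) * \<psi> x0"])
       (use A in \<open>auto intro!: derivative_eq_intros simp: k_def\<close>)
  moreover have "- eig CARD('n) ((1/k) *\<^sub>R Dxx (x0, t0)) - \<mu> * \<psi> x0 \<ge> 0"
  proof (rule \<psi>[unfolded visc_super_def, THEN conjunct2, rule_format, of x0 "{x. (x, t0) \<in> U}" "\<lambda>x. (1/k) * \<phi> (x, t0)" "\<lambda>x. (1/k) *\<^sub>R Dx (x, t0)" "\<lambda>x. (1/k) *\<^sub>R Dxx (x, t0)"])
    show "x0 \<in> \<Omega>R" using p0 sub by auto
    have "\<psi> y - (1/k) * \<phi> (y, t0) \<ge> \<psi> x0 - (1/k) * \<phi> (x0, t0)" if "(y, t0) \<in> U" for y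
    proof -
      have "k * \<psi> x0 - \<phi> (x0, t0) \<le> k * \<psi> y - \<phi> (y, t0)" using A that by (auto simp: k_def dest!: bspec)
      hence "(1/k) * (k * \<psi> x0 - \<phi> (x0, t0)) \<le> (1/k) * (k * \<psi> y - \<phi> (y, t0))" using k by (intro mult_left_mono) auto
      thus ?thesis using k by (simp add: right_diff_distrib)
    qed
    thus "open {x. (x, t0) \<in> U} \<and> x0 \<in> {x. (x, t0) \<in> U} \<and> {x. (x, t0) \<in> U} \<subseteq> \<Omega>R \<and>
      C2_on {x. (x, t0) \<in> U} (\<lambda>x. (1/k) * \<phi> (x, t0)) (\<lambda>x. (1/k) *\<^sub>R Dx (x, t0)) (\<lambda>x. (1/k) *\<^sub>R Dxx (x, t0)) \<and>
      (\<forall>y\<in>{x. (x, t0) \<in> U}. \<psi> y - (1/k) * \<phi> (y, t0) \<ge> \<psi> x0 - (1/k) * \<phi> (x0, t0))"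
      using A sub by (intro conjI C2_on_time_slice open_time_slice) auto
  qed
  moreover have "eig CARD('n) (Dxx (x0, t0)) \<le> k * eig CARD('n) ((1/k) *\<^sub>R Dxx (x0, t0))"
  proof (rule eig_top_le)
    fix v :: "real^'n" assume v: "norm v = 1"
    have "(((1/k) *\<^sub>R Dxx (x0, t0)) *v v) \<bullet> v \<le> eig CARD('n) ((1/k) *\<^sub>R Dxx (x0, t0))" by (rule eig_top_upper[OF v])
    hence "k * ((((1/k) *\<^sub>R Dxx (x0, t0)) *v v) \<bullet> v) \<le> k * eig CARD('n) ((1/k) *\<^sub>R Dxx (x0, t0))"
      using k by (intro mult_left_mono) auto
    thus "(Dxx (x0, t0) *v v) \<bullet> v \<le> k * eig CARD('n) ((1/k) *\<^sub>R Dxx (x0, t0))"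
      using k by (simp add: scaleR_matrix_vector_assoc[symmetric])
  qed
  moreover have "k * eig CARD('n) ((1/k) *\<^sub>R Dxx (x0, t0)) \<le> k * (- \<mu> * \<psi> x0)"
    using k calculation(2) by (intro mult_left_mono) auto
  ultimately show "Dt p0 + - eig CARD('n) (Dxx p0) \<ge> 0" by (simp add: mult_ac)
qed

text \<open>Stated for an arbitrary subsolution \<open>a\<close> and supersolution \<open>b\<close>,
  so that the evolution and the stationary solution can take either role; the two choices give the
  two halves of the estimate.\<close>

lemma exponential_bound:
  fixes a b :: "(real^'n) \<times> real \<Rightarrow> real" and \<psi> :: "real^'n \<Rightarrow> real"
  assumes \<Omega>: "open \<Omega>" "bounded \<Omega>" and j: "1 \<le> j" "j \<le> CARD('n)"
    and cont: "continuous_on (closure \<Omega> \<times> {0..}) a" "continuous_on (closure \<Omega> \<times> {0..}) b"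
    and a: "pvisc_sub (\<lambda>q r p X. - eig j X) (\<Omega> \<times> {0<..}) a"
    and b: "pvisc_super (\<lambda>q r p X. - eig j X) (\<Omega> \<times> {0<..}) b"
    and lateral: "\<And>x t. x \<in> frontier \<Omega> \<Longrightarrow> t > 0 \<Longrightarrow> a (x, t) = b (x, t)"
    and initial: "\<And>x. x \<in> closure \<Omega> \<Longrightarrow> a (x, 0) \<le> b (x, 0) + C * \<psi> x" and C: "C > 0"
    and sub: "closure \<Omega> \<subseteq> \<Omega>R" and \<psi>c: "continuous_on (closure \<Omega>) \<psi>" and \<psi>pos: "\<And>x. x \<in> closure \<Omega> \<Longrightarrow> \<psi> x > 0"
    and \<psi>: "visc_super (\<lambda>x r p X. - eig CARD('n) X - \<mu> * r) \<Omega>R \<psi>"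
    and x: "x \<in> \<Omega>" and t: "t > 0"
  shows "a (x, t) \<le> b (x, t) + C * exp (- \<mu> * t) * \<psi> x"
proof (rule ccontr)
  define c where "c p = C * exp (- \<mu> * snd p) * \<psi> (fst p)" for p :: "(real^'n) \<times> real"
  assume "\<not> a (x, t) \<le> b (x, t) + C * exp (- \<mu> * t) * \<psi> x"
  hence gt: "a (x, t) - b (x, t) - c (x, t) > 0" by (simp add: c_def)
  \<comment> \<open>Half of the supposed excess: since \<open>P t\<close> equals
    \<open>\<eta>0\<close>, comparison will bound the excess by half of itself.\<close>
  define \<eta>0 where "\<eta>0 = (a (x, t) - b (x, t) - c (x, t)) / 2"
  have \<eta>0: "\<eta>0 > 0" using gt by (simp add: \<eta>0_def)
  define T where "T = t + 1"
  define K where "K = closure \<Omega> \<times> {0..T}"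
  have K: "compact K" unfolding K_def using \<Omega> by (intro compact_Times) (auto simp: compact_closure)
  define W where "W = \<Omega> \<times> {0<..<T}"
  have W: "open W" "W \<subseteq> K" "W \<subseteq> \<Omega> \<times> {0<..}" using \<Omega>(1) closure_subset[of \<Omega>]
    by (auto simp: W_def K_def intro!: open_Times)
  have KI: "K \<subseteq> closure \<Omega> \<times> {0..}" by (auto simp: K_def)
  have cc: "continuous_on K c" unfolding c_def K_def
    by (intro continuous_intros continuous_on_compose2[OF \<psi>c]) auto
  have ca: "continuous_on K a" and cb: "continuous_on K b" using cont KI continuous_on_subset by blast+
  have "continuous_on K (\<lambda>p. a p - b p - c p)" by (intro continuous_intros ca cb cc)
  from compact_imp_bounded[OF compact_continuous_image[OF this K]]
  obtain B where B: "B > 0" "\<And>p. p \<in> K \<Longrightarrow> \<bar>a p - b p - c p\<bar> \<le> B" unfolding bounded_pos by auto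
  \<comment> \<open>With \<open>T = t + 1\<close> the penalty on the lid is
    \<open>\<eta>0 * exp L\<close>, which is at least \<open>\<eta>0 * L = B\<close>.\<close>
  define L where "L = B / \<eta>0"
  have L: "L > 0" using B \<eta>0 by (simp add: L_def)
  (* The penalty P makes the subsolution strict and exceeds a - b - c on the lid t = T. *)
  define P where "P s = \<eta>0 * exp (L * (s - t))" for s
  \<comment> \<open>The derivative of \<open>P\<close> at time 0, its smallest value on nonnegative
    times.\<close>
  define \<eta> where "\<eta> = L * (\<eta>0 * exp (- L * t))"
  have \<eta>: "\<eta> > 0" using L \<eta>0 by (simp add: \<eta>_def)
  have P: "P s > 0" for s using \<eta>0 by (simp add: P_def)
  have "L \<le> exp L" using exp_ge_add_one_self[of L] by linarith
  hence "\<eta>0 * L \<le> \<eta>0 * exp L" using \<eta>0 by (intro mult_left_mono) auto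
  hence PT: "P T \<ge> B" using \<eta>0 by (simp add: P_def T_def L_def)
  have a': "pvisc_sub (\<lambda>q r p X. - eig j X + \<eta>) W (\<lambda>p. a p - P (snd p))"
  proof (rule pvisc_sub_minus_time[OF a W(3)])
    show "(P has_real_derivative L * P s) (at s)" for s
      unfolding P_def by (auto intro!: derivative_eq_intros)
    show "continuous_on UNIV (\<lambda>s. L * P s)" unfolding P_def by (intro continuous_intros)
    fix p assume "p \<in> W"
    hence "- L * t \<le> L * (snd p - t)" using L by (auto simp: W_def algebra_simps)
    hence "\<eta>0 * exp (- L * t) \<le> P (snd p)" unfolding P_def using \<eta>0 by (intro mult_left_mono) auto
    thus "\<eta> \<le> L * P (snd p)" unfolding \<eta>_def using L by (intro mult_left_mono) auto
  qed
  have b': "pvisc_super (\<lambda>q r p X. - eig j X) W b"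
    using b W(3) unfolding pvisc_super_def by (meson continuous_on_subset subset_trans subsetD)
  have c': "pvisc_super (\<lambda>q r p X. - eig CARD('n) X) W c"
  proof -
    have "\<Omega> \<subseteq> \<Omega>R" using sub closure_subset by blast
    from pvisc_super_decaying[OF \<psi> this C] show ?thesis
      using W(3) unfolding pvisc_super_def c_def by (meson continuous_on_subset subset_trans subsetD)
  qed
  have ca': "continuous_on K (\<lambda>p. a p - P (snd p))" unfolding P_def by (intro continuous_intros ca)
  have "a (x, t) - P (snd (x, t)) \<le> b (x, t) + c (x, t)"
  proof (rule parabolic_comparison[OF K W(1,2) ca' cb cc a' \<eta> b' c' j])
    show "(x, t) \<in> W" using x t by (simp add: W_def T_def)
    fix p assume p: "p \<in> K - W"
    obtain y s where ys: "p = (y, s)" by (cases p)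
    have y: "y \<in> closure \<Omega>" and s: "0 \<le> s" "s \<le> T" using p by (auto simp: K_def ys)
    have cpos: "c p > 0" using \<psi>pos[OF y] C by (simp add: c_def ys)
    consider "s = 0" | "s > 0" "s < T" | "s = T" using s by linarith
    thus "a p - P (snd p) \<le> b p + c p"
    proof cases
      case 1 thus ?thesis using initial[OF y] P[of s] by (simp add: c_def ys)
    next
      case 2
      hence "y \<in> frontier \<Omega>" using p y \<Omega>(1) by (auto simp: W_def ys frontier_def interior_open)
      thus ?thesis using lateral[of y s] 2 cpos P[of s] by (simp add: ys)
    next
      case 3 thus ?thesis using B(2)[of p] p PT by (auto simp: ys abs_le_iff)
    qed
  qed
  hence "a (x, t) - b (x, t) - c (x, t) \<le> P t" by simp
  moreover have "P t = \<eta>0" by (simp add: P_def)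
  ultimately show False using \<eta>0 by (simp add: \<eta>0_def)
qed

theorem theorem3p2:
  fixes \<Omega> \<Omega>R :: "(real^'n) set"
    and j :: nat
    and g u0 z \<psi>R :: "real^'n \<Rightarrow> real"
    and u :: "(real^'n) \<times> real \<Rightarrow> real"
    and \<mu>R :: real
  assumes dom: "domain \<Omega>" "bounded \<Omega>"
    and j: "1 \<le> j" "j \<le> CARD('n)"
    and u0: "continuous_on (closure \<Omega>) u0" "\<forall>x\<in>frontier \<Omega>. u0 x = g x"
    and OR: "domain \<Omega>R" "bounded \<Omega>R" "strictly_convex \<Omega>R" "closure \<Omega> \<subseteq> \<Omega>R"
    and psi: "\<mu>R > 0" "continuous_on (closure \<Omega>R) \<psi>R"
      "\<forall>x\<in>\<Omega>R. \<psi>R x > 0" "\<forall>x\<in>frontier \<Omega>R. \<psi>R x = 0"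
      "visc_sol (\<lambda>x r p X. - eig CARD('n) X - \<mu>R * r) \<Omega>R \<psi>R"
    and usol: "continuous_on (closure \<Omega> \<times> {0..}) u"
      "pvisc_sol (\<lambda>q r p X. - eig j X) (\<Omega> \<times> {0<..}) u"
      "\<forall>x\<in>frontier \<Omega>. \<forall>t>0. u (x, t) = g x"
      "\<forall>x\<in>closure \<Omega>. u (x, 0) = u0 x"
    and zsol: "continuous_on (closure \<Omega>) z"
      "visc_sol (\<lambda>x r p X. - eig j X) \<Omega> z"
      "\<forall>x\<in>frontier \<Omega>. z x = g x"
  shows "\<exists>C1 C2. C1 > 0 \<and> C2 > 0 \<and>
     (\<forall>x\<in>\<Omega>. \<forall>t>0. z x + C1 * exp (- \<mu>R * t) * (- \<psi>R x) \<le> u (x, t) \<and>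
                    u (x, t) \<le> z x + C2 * exp (- \<mu>R * t) * \<psi>R x)"
proof -
  have \<Omega>: "open \<Omega>" "\<Omega> \<noteq> {}" using dom(1) by (auto simp: domain_def)
  have cpt: "compact (closure \<Omega>)" using dom(2) by (simp add: compact_closure)
  have ne: "closure \<Omega> \<noteq> {}" using \<Omega>(2) by simp
  have \<psi>c: "continuous_on (closure \<Omega>) \<psi>R"
    using psi(2) OR(4) closure_subset[of \<Omega>R] by (meson continuous_on_subset subset_trans)
  have \<psi>pos: "\<psi>R x > 0" if "x \<in> closure \<Omega>" for x using that OR(4) psi(3) by blast
  \<comment> \<open>This is where the larger domain matters: \<open>\<psi>R\<close> is positive up
    to the boundary of \<open>\<Omega>\<close>, so the quotient is continuous on a compact set and
    its bound is the constant \<open>C\<close>.\<close>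
  have "continuous_on (closure \<Omega>) (\<lambda>x. \<bar>u0 x - z x\<bar> / \<psi>R x)"
    using \<psi>pos by (intro continuous_intros u0 zsol \<psi>c) force
  from compact_imp_bounded[OF compact_continuous_image[OF this cpt]]
  obtain C where C: "C > 0" "\<And>x. x \<in> closure \<Omega> \<Longrightarrow> \<bar>\<bar>u0 x - z x\<bar> / \<psi>R x\<bar> \<le> C" unfolding bounded_pos by auto
  have init: "\<bar>u0 x - z x\<bar> \<le> C * \<psi>R x" if "x \<in> closure \<Omega>" for x
    using C(2)[OF that] \<psi>pos[OF that] by (simp add: field_simps)
  have \<psi>: "visc_super (\<lambda>x r p X. - eig CARD('n) X - \<mu>R * r) \<Omega>R \<psi>R" using psi(5) by (simp add: visc_sol_def)
  have us: "pvisc_sub (\<lambda>q r p X. - eig j X) (\<Omega> \<times> {0<..}) u" "pvisc_super (\<lambda>q r p X. - eig j X) (\<Omega> \<times> {0<..}) u"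
    using usol(2) by (auto simp: pvisc_sol_def)
  have zs: "pvisc_sub (\<lambda>q r p X. - eig j X) (\<Omega> \<times> {0<..}) (\<lambda>p. z (fst p))"
    "pvisc_super (\<lambda>q r p X. - eig j X) (\<Omega> \<times> {0<..}) (\<lambda>p. z (fst p))"
    using zsol(2) by (auto simp: visc_sol_def intro!: pvisc_sub_stationary pvisc_super_stationary)
  have cz: "continuous_on (closure \<Omega> \<times> {0..}) (\<lambda>p. z (fst p))"
    by (intro continuous_on_compose2[OF zsol(1)] continuous_intros) auto
  have up: "u (x, t) \<le> z x + C * exp (- \<mu>R * t) * \<psi>R x" if "x \<in> \<Omega>" "t > 0" for x t
  proof -
    have "u (x, t) \<le> z (fst (x, t)) + C * exp (- \<mu>R * t) * \<psi>R x"
    proof (rule exponential_bound[OF \<Omega>(1) dom(2) j usol(1) cz us(1) zs(2) _ _ C(1) OR(4) \<psi>c \<psi>pos \<psi> that])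
      show "u (y, s) = z (fst (y, s))" if "y \<in> frontier \<Omega>" "s > 0" for y s using that usol(3) zsol(3) by simp
      show "u (y, 0) \<le> z (fst (y, 0::real)) + C * \<psi>R y" if "y \<in> closure \<Omega>" for y
        using init[OF that] usol(4) that by (simp add: abs_le_iff)
    qed
    thus ?thesis by simp
  qed
  \<comment> \<open>The roles are exchanged: \<open>z\<close> is now the subsolution and
    \<open>u\<close> the supersolution. The same \<open>C\<close> and the same decaying
    supersolution serve, so \<open>-\<psi>R\<close> never has to be treated as a
    subsolution.\<close>
  have lo: "z x \<le> u (x, t) + C * exp (- \<mu>R * t) * \<psi>R x" if "x \<in> \<Omega>" "t > 0" for x t
  proof -
    have "z (fst (x, t)) \<le> u (x, t) + C * exp (- \<mu>R * t) * \<psi>R x"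
    proof (rule exponential_bound[OF \<Omega>(1) dom(2) j cz usol(1) zs(1) us(2) _ _ C(1) OR(4) \<psi>c \<psi>pos \<psi> that])
      show "z (fst (y, s)) = u (y, s)" if "y \<in> frontier \<Omega>" "s > 0" for y s using that usol(3) zsol(3) by simp
      show "z (fst (y, 0::real)) \<le> u (y, 0) + C * \<psi>R y" if "y \<in> closure \<Omega>" for y
        using init[OF that] usol(4) that by (simp add: abs_le_iff)
    qed
    thus ?thesis by simp
  qed
  show ?thesis
    by (intro exI[of _ C] conjI C(1) ballI allI impI) (use up lo in \<open>auto simp: algebra_simps\<close>)
qed

end
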